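(* Let $K$ be a local field with finite residue field of characteristic $p$ and cardinality $q$, let $\tilde K$ be a separable algebraic closure of $K$, let $e>0$ be an integer with $e\not\equiv0\pmod p$, and put $n=ep$. Then $$\sum_{E} q^{-c_K(E)}=n,$$ where $E$ runs over all totally ramified extensions of $K$ of degree $n$ contained in $\tilde K$.
   Context: A local field is a field complete for a discrete valuation with finite residue field. Let $w$ be the normalised valuation of $K$. For a finite separable totally ramified extension $E|K$ of degree $n$, $c_K(E)=w(\delta_{E|K})-(n-1)$, where $\delta_{E|K}$ is the discriminant of $E|K$. The sum may be infinite (when $K$ has characteristic $p$), in which case it is understood as a convergent series of nonnegative terms. *)

theory Defs
  imports
    "HOL-Analysis.Infinite_Sum"
    "HOL-Computational_Algebra.Polynomial_Factorial"
    "HOL-Number_Theory.Cong"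
    "Jordan_Normal_Form.Determinant"
begin

section \<open>Discrete valuations and local fields\<close>

text \<open>
  A discrete valuation is an integer-valued function \<open>v\<close> whose value at \<open>0\<close> is irrelevant:
  the convention \<open>v 0 = \<infinity>\<close> is built into \<open>val_ge v k x\<close>, which expresses \<open>v x \<ge> k\<close>.
  Valuations are considered on a subfield \<open>F\<close> of the ambient field; normalised means that
  the value group is all of the integers.
\<close>

definition val_ge :: "('a::field \<Rightarrow> int) \<Rightarrow> int \<Rightarrow> 'a \<Rightarrow> bool" where
  "val_ge v k x \<longleftrightarrow> x = 0 \<or> v x \<ge> k"

definition normalised_valuation_on :: "'a::field set \<Rightarrow> ('a \<Rightarrow> int) \<Rightarrow> bool" where
  "normalised_valuation_on F v \<longleftrightarrow>
     (\<forall>x\<in>F - {0}. \<forall>y\<in>F - {0}. v (x * y) = v x + v y) \<and>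
     (\<forall>x\<in>F - {0}. \<forall>y\<in>F - {0}. x + y \<noteq> 0 \<longrightarrow> v (x + y) \<ge> min (v x) (v y)) \<and>
     v ` (F - {0}) = UNIV"

definition val_ring :: "('k::field \<Rightarrow> int) \<Rightarrow> 'k set" where
  "val_ring w = {x. val_ge w 0 x}"

definition max_ideal :: "('k::field \<Rightarrow> int) \<Rightarrow> 'k set" where
  "max_ideal w = {x. val_ge w 1 x}"

definition residue_field :: "('k::field \<Rightarrow> int) \<Rightarrow> 'k set set" where
  "residue_field w = val_ring w // {(x, y) \<in> val_ring w \<times> val_ring w. x - y \<in> max_ideal w}"

text \<open>
  The characteristic of the residue field, as in the library's \<open>semiring_char\<close>: \<open>n\<close> is zero in the
  residue field iff it lies in the maximal ideal.
\<close>

definition residue_char :: "('k::field \<Rightarrow> int) \<Rightarrow> nat" where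
  "residue_char w = Gcd {n. (of_nat n :: 'k) \<in> max_ideal w}"

definition val_Cauchy :: "('k::field \<Rightarrow> int) \<Rightarrow> (nat \<Rightarrow> 'k) \<Rightarrow> bool" where
  "val_Cauchy w s \<longleftrightarrow> (\<forall>k. \<exists>N. \<forall>m\<ge>N. \<forall>n\<ge>N. val_ge w k (s m - s n))"

definition val_tendsto :: "('k::field \<Rightarrow> int) \<Rightarrow> (nat \<Rightarrow> 'k) \<Rightarrow> 'k \<Rightarrow> bool" where
  "val_tendsto w s l \<longleftrightarrow> (\<forall>k. \<exists>N. \<forall>n\<ge>N. val_ge w k (s n - l))"

locale local_field =
  fixes w :: "'k::field \<Rightarrow> int"
  assumes normalised: "normalised_valuation_on UNIV w"
    and complete: "val_Cauchy w s \<Longrightarrow> \<exists>l. val_tendsto w s l"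
    and finite_residue_field: "finite (residue_field w)"


section \<open>Separable closures\<close>

definition separable_poly :: "'a::field poly \<Rightarrow> bool" where
  "separable_poly f \<longleftrightarrow> coprime f (pderiv f)"

text \<open>
  \<open>x\<close> is algebraic and separable over the base field; the irreducible polynomial \<open>f\<close> is the
  minimal polynomial of \<open>x\<close> up to a unit.
\<close>

definition separable_over :: "('k::field \<Rightarrow> 'a::field) \<Rightarrow> 'a \<Rightarrow> bool" where
  "separable_over \<iota> x \<longleftrightarrow>
     (\<exists>f. irreducible f \<and> separable_poly f \<and> poly (map_poly \<iota> f) x = 0)"

locale separable_closure = field_hom \<iota>
  for \<iota> :: "'k::field \<Rightarrow> 'a::field" +
  assumes separable: "separable_over \<iota> x"
    and separably_closed:
      "degree (g :: 'a poly) > 0 \<Longrightarrow> separable_poly g \<Longrightarrow> \<exists>x. poly g x = 0"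


section \<open>Intermediate fields\<close>

definition intermediate_field :: "('k::field \<Rightarrow> 'a::field) \<Rightarrow> 'a set \<Rightarrow> bool" where
  "intermediate_field \<iota> E \<longleftrightarrow> range \<iota> \<subseteq> E \<and>
     (\<forall>x\<in>E. \<forall>y\<in>E. x + y \<in> E \<and> x * y \<in> E) \<and> (\<forall>x\<in>E. - x \<in> E \<and> inverse x \<in> E)"

abbreviation ext_scale :: "('k::field \<Rightarrow> 'a::field) \<Rightarrow> 'k \<Rightarrow> 'a \<Rightarrow> 'a" where
  "ext_scale \<iota> \<equiv> (\<lambda>c x. \<iota> c * x)"

lemma (in field_hom) vector_space_ext_scale: "vector_space (ext_scale hom)"
  by unfold_locales (simp_all add: algebra_simps hom_distribs)

text \<open>This is \<open>0\<close> for infinite extensions.\<close>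

definition ext_degree :: "('k::field \<Rightarrow> 'a::field) \<Rightarrow> 'a set \<Rightarrow> nat" where
  "ext_degree \<iota> E = vector_space.dim (ext_scale \<iota>) E"

definition ext_basis :: "('k::field \<Rightarrow> 'a::field) \<Rightarrow> 'a set \<Rightarrow> 'a list \<Rightarrow> bool" where
  "ext_basis \<iota> E xs \<longleftrightarrow> distinct xs \<and>
     \<not> Modules.module.dependent (ext_scale \<iota>) (set xs) \<and>
     Modules.module.span (ext_scale \<iota>) (set xs) = E"

text \<open>
  The trace of the \<open>K\<close>-linear endomorphism of \<open>E\<close> given by multiplication by \<open>x\<close>,
  computed in some basis.
\<close>

definition ext_trace :: "('k::field \<Rightarrow> 'a::field) \<Rightarrow> 'a set \<Rightarrow> 'a \<Rightarrow> 'k" where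
  "ext_trace \<iota> E x = (let bs = (SOME bs. ext_basis \<iota> E bs) in
     \<Sum>b\<in>set bs. Modules.module.representation (ext_scale \<iota>) (set bs) (x * b) b)"

text \<open>
  When \<open>K\<close> is complete, a finite extension \<open>E\<close> carries only one normalised valuation \<open>v\<close>
  inducing the given topology on \<open>K\<close>, so \<open>e\<close> is determined by \<open>E\<close>.
\<close>

definition has_ramification_index ::
    "('k::field \<Rightarrow> 'a::field) \<Rightarrow> ('k \<Rightarrow> int) \<Rightarrow> 'a set \<Rightarrow> nat \<Rightarrow> bool" where
  "has_ramification_index \<iota> w E e \<longleftrightarrow> e > 0 \<and>
     (\<exists>v. normalised_valuation_on E v \<and> (\<forall>x. x \<noteq> 0 \<longrightarrow> v (\<iota> x) = int e * w x))"

definition totally_ramified ::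
    "('k::field \<Rightarrow> 'a::field) \<Rightarrow> ('k \<Rightarrow> int) \<Rightarrow> 'a set \<Rightarrow> bool" where
  "totally_ramified \<iota> w E \<longleftrightarrow> intermediate_field \<iota> E \<and> ext_degree \<iota> E > 0 \<and>
     has_ramification_index \<iota> w E (ext_degree \<iota> E)"


section \<open>The discriminant\<close>

definition integers_of ::
    "('k::field \<Rightarrow> 'a::field) \<Rightarrow> ('k \<Rightarrow> int) \<Rightarrow> 'a set \<Rightarrow> 'a set" where
  "integers_of \<iota> w E = {x \<in> E. \<exists>f. lead_coeff f = 1 \<and> (\<forall>i. coeff f i \<in> val_ring w) \<and>
     poly (map_poly \<iota> f) x = 0}"

definition basis_disc :: "('k::field \<Rightarrow> 'a::field) \<Rightarrow> 'a set \<Rightarrow> 'a list \<Rightarrow> 'k" where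
  "basis_disc \<iota> E xs =
     Determinant.det (mat (length xs) (length xs) (\<lambda>(i, j). ext_trace \<iota> E (xs ! i * xs ! j)))"

definition generated_ideal :: "('k::field \<Rightarrow> int) \<Rightarrow> 'k set \<Rightarrow> 'k set" where
  "generated_ideal w D =
     {\<Sum>d\<in>T. a d * d | T a. finite T \<and> T \<subseteq> D \<and> a ` T \<subseteq> val_ring w}"

text \<open>
  The discriminant is the ideal of the valuation ring of \<open>K\<close> generated by the discriminants
  of all \<open>K\<close>-bases of \<open>E\<close> consisting of integers of \<open>E\<close>.
\<close>

definition discriminant_ideal ::
    "('k::field \<Rightarrow> 'a::field) \<Rightarrow> ('k \<Rightarrow> int) \<Rightarrow> 'a set \<Rightarrow> 'k set" where
  "discriminant_ideal \<iota> w E =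
     generated_ideal w {basis_disc \<iota> E xs | xs. ext_basis \<iota> E xs \<and> set xs \<subseteq> integers_of \<iota> w E}"

text \<open>For a nonzero ideal \<open>I\<close> this is the exponent \<open>k\<close> such that \<open>I\<close> is the \<open>k\<close>-th power of the
  maximal ideal.\<close>

definition ideal_val :: "('k::field \<Rightarrow> int) \<Rightarrow> 'k set \<Rightarrow> int" where
  "ideal_val w I = (INF x\<in>I - {0}. w x)"

definition disc_excess :: "('k::field \<Rightarrow> 'a::field) \<Rightarrow> ('k \<Rightarrow> int) \<Rightarrow> 'a set \<Rightarrow> int" where
  "disc_excess \<iota> w E = ideal_val w (discriminant_ideal \<iota> w E) - (int (ext_degree \<iota> E) - 1)"

end

theory Submission
  imports Defs "Jordan_Normal_Form.Char_Poly"
begin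

text \<open>
  Uniformizers of totally ramified extensions of degree \<open>n\<close> are exactly the roots of Eisenstein
  polynomials \<open>g\<close> of degree \<open>n\<close>, so each separable \<open>g\<close> has \<open>n\<close> roots \<open>\<beta>\<close>, each lying in exactly one
  such extension \<open>E = K(\<beta>)\<close>, and the discriminant of \<open>E\<close> has valuation \<open>d = v\<^sub>E(g'(\<beta>))\<close>. For a fixed
  \<open>E\<close> count pairs of a uniformizer \<open>\<alpha>\<close> modulo the \<open>s\<close>-th power of the maximal ideal and an
  Eisenstein polynomial \<open>g\<close> modulo a large power, such that \<open>v\<^sub>E(g(\<alpha>)) \<ge> d + s\<close>. As
  \<open>g \<mapsto> g(\<alpha>) - \<alpha>\<^sup>n\<close> maps coefficients bijectively to \<open>\<alpha>\<close>-adic expansions, the number of \<open>g\<close> is the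
  same for every \<open>\<alpha>\<close>; by Hensel's lemma the number of \<open>\<alpha>\<close> is the number of roots of \<open>g\<close> in \<open>E\<close>.
  Hence an Eisenstein polynomial has on average \<open>q\<^bsup>n-1-d\<^esup>\<close> roots in \<open>E\<close>. Summing over the \<open>E\<close> with
  \<open>d \<le> D\<close> gives \<open>n\<close> times the proportion of the \<open>g\<close> whose roots satisfy \<open>v\<^sub>E(g'(\<beta>)) \<le> D\<close>. This
  proportion tends to one because \<open>v\<^sub>E(g'(\<beta>))\<close> is at most \<open>n\<close> times the valuation of the linear
  coefficient of \<open>g\<close>.
\<close>

section \<open>Valued fields and representatives modulo powers of the maximal ideal\<close>

text \<open>The mean number of roots is an exact ratio of finite cardinalities. With coefficients
  taken modulo the L-th power of the maximal ideal of K there are (q-1) q^(L-2) q^((L-1)(n-1))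
  Eisenstein polynomials; for a fixed E there are (q-1) q^(s-2) uniformizers modulo the s-th power,
  each with q^(nL-d-s) polynomials. The quotient is q^(n-1-d), whatever L and s are, and this is
  q^(-c). The precision needed grows with d, and d may be unbounded in characteristic p; therefore
  the E are truncated at d \<le> D, with L chosen from D, and the truncation is removed only at the
  end. Finiteness of the set of E with d \<le> D is an outcome of the count, since each such E has
  positive weight and so contains a root of one of finitely many polynomials. Inseparable g have no
  root in the separable closure and are sorted out by the bound on the different. That the root
  fields K(\<beta>) are totally ramified requires a valuation on them; it is written down from the
  coefficients of remainders modulo g, and its multiplicativity also yields the irreducibility of
  g.\<close>

locale valued_field =
  fixes F :: "'a::field set" and v :: "'a \<Rightarrow> int"
  assumes zero_mem: "0 \<in> F" and one_mem: "1 \<in> F"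
    and add_mem: "x \<in> F \<Longrightarrow> y \<in> F \<Longrightarrow> x + y \<in> F"
    and mult_mem: "x \<in> F \<Longrightarrow> y \<in> F \<Longrightarrow> x * y \<in> F"
    and uminus_mem: "x \<in> F \<Longrightarrow> - x \<in> F"
    and inverse_mem: "x \<in> F \<Longrightarrow> inverse x \<in> F"
    and normalised: "normalised_valuation_on F v"
begin

lemma diff_mem: "x \<in> F \<Longrightarrow> y \<in> F \<Longrightarrow> x - y \<in> F"
  using add_mem[of x "- y"] uminus_mem[of y] by simp

lemma divide_mem: "x \<in> F \<Longrightarrow> y \<in> F \<Longrightarrow> x / y \<in> F"
  by (simp add: divide_inverse mult_mem inverse_mem)

lemma power_mem: "x \<in> F \<Longrightarrow> x ^ m \<in> F"
  by (induction m) (simp_all add: one_mem mult_mem)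

lemma of_nat_mem: "of_nat m \<in> F"
  by (induction m) (simp_all add: zero_mem one_mem add_mem)

lemma sum_mem: "(\<And>i. i \<in> I \<Longrightarrow> f i \<in> F) \<Longrightarrow> sum f I \<in> F"
  by (induction I rule: infinite_finite_induct) (simp_all add: zero_mem add_mem)

lemmas mem_intros = zero_mem one_mem add_mem mult_mem uminus_mem inverse_mem diff_mem
  divide_mem power_mem of_nat_mem

lemma v_mult: "x \<in> F \<Longrightarrow> y \<in> F \<Longrightarrow> x \<noteq> 0 \<Longrightarrow> y \<noteq> 0 \<Longrightarrow> v (x * y) = v x + v y"
  using normalised by (auto simp: normalised_valuation_on_def)

lemma v_add: "x \<in> F \<Longrightarrow> y \<in> F \<Longrightarrow> x \<noteq> 0 \<Longrightarrow> y \<noteq> 0 \<Longrightarrow> x + y \<noteq> 0 \<Longrightarrow> v (x + y) \<ge> min (v x) (v y)"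
  using normalised unfolding normalised_valuation_on_def by fast

lemma v_surj: "\<exists>x\<in>F. x \<noteq> 0 \<and> v x = k"
proof -
  have "k \<in> v ` (F - {0})" using normalised unfolding normalised_valuation_on_def by blast
  then show ?thesis by blast
qed

lemma v_one: "v 1 = 0"
  using v_mult[of 1 1] one_mem by simp

lemma v_minus_one: "v (- 1) = 0"
  using v_mult[of "-1" "-1"] one_mem uminus_mem v_one by force

lemma v_uminus: "x \<in> F \<Longrightarrow> v (- x) = v x"
proof (cases "x = 0")
  case False
  assume "x \<in> F"
  then have "v (- 1 * x) = v x"
    using v_mult[of "-1" x] False v_minus_one one_mem uminus_mem by force
  then show ?thesis by simp
qed simp

lemma v_power: "x \<in> F \<Longrightarrow> x \<noteq> 0 \<Longrightarrow> v (x ^ m) = int m * v x"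
  by (induction m) (simp_all add: v_one v_mult power_mem algebra_simps)

lemma v_prod:
  "finite I \<Longrightarrow> (\<And>i. i \<in> I \<Longrightarrow> f i \<in> F \<and> f i \<noteq> 0) \<Longrightarrow>
     prod f I \<in> F \<and> v (prod f I) = (\<Sum>i\<in>I. v (f i))"
  by (induction I rule: finite_induct) (simp_all add: one_mem v_one v_mult mult_mem)

lemma vge_0 [simp]: "val_ge v k 0"
  by (simp add: val_ge_def)

lemma vge_mono: "val_ge v k x \<Longrightarrow> l \<le> k \<Longrightarrow> val_ge v l x"
  by (auto simp: val_ge_def)

lemma vge_add: "x \<in> F \<Longrightarrow> y \<in> F \<Longrightarrow> val_ge v k x \<Longrightarrow> val_ge v k y \<Longrightarrow> val_ge v k (x + y)"
  using v_add[of x y] by (fastforce simp: val_ge_def)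

lemma vge_uminus: "x \<in> F \<Longrightarrow> val_ge v k (- x) \<longleftrightarrow> val_ge v k x"
  by (simp add: val_ge_def v_uminus)

lemma vge_diff: "x \<in> F \<Longrightarrow> y \<in> F \<Longrightarrow> val_ge v k x \<Longrightarrow> val_ge v k y \<Longrightarrow> val_ge v k (x - y)"
  using vge_add[of x "- y" k] by (simp add: vge_uminus uminus_mem)

lemma vge_diff_commute: "x \<in> F \<Longrightarrow> y \<in> F \<Longrightarrow> val_ge v k (x - y) \<longleftrightarrow> val_ge v k (y - x)"
  using vge_uminus[of "x - y" k] by (simp add: diff_mem)

lemma vge_mult:
  "x \<in> F \<Longrightarrow> y \<in> F \<Longrightarrow> val_ge v k x \<Longrightarrow> val_ge v l y \<Longrightarrow> val_ge v (k + l) (x * y)"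
  by (cases "x = 0"; cases "y = 0") (simp_all add: val_ge_def v_mult)

lemma vge_mult0:
  "x \<in> F \<Longrightarrow> y \<in> F \<Longrightarrow> val_ge v 0 x \<Longrightarrow> val_ge v l y \<Longrightarrow> val_ge v l (x * y)"
  using vge_mult[of x y 0 l] by simp

lemma vge_mult_iff:
  "x \<in> F \<Longrightarrow> y \<in> F \<Longrightarrow> x \<noteq> 0 \<Longrightarrow> val_ge v k (x * y) \<longleftrightarrow> val_ge v (k - v x) y"
  by (cases "y = 0") (auto simp: val_ge_def v_mult)

lemma vge_sum:
  "(\<And>i. i \<in> I \<Longrightarrow> f i \<in> F \<and> val_ge v k (f i)) \<Longrightarrow> val_ge v k (sum f I)"
  by (induction I rule: infinite_finite_induct) (simp_all add: vge_add sum_mem)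

lemma vge_one: "val_ge v 0 1"
  by (simp add: val_ge_def v_one)

lemma vge_of_nat: "val_ge v 0 (of_nat m)"
  by (induction m) (simp_all add: vge_add vge_one one_mem of_nat_mem)

lemma vge_power: "x \<in> F \<Longrightarrow> val_ge v k x \<Longrightarrow> val_ge v (int m * k) (x ^ m)"
proof (induction m)
  case (Suc m)
  then show ?case using vge_mult[of x "x ^ m" k "int m * k"] by (simp add: power_mem algebra_simps)
qed (simp add: vge_one)

lemma vge_power0: "x \<in> F \<Longrightarrow> val_ge v 0 x \<Longrightarrow> val_ge v 0 (x ^ m)"
  using vge_power[of x 0 m] by simp

lemma vge_all_imp_0:
  assumes "\<And>k::nat. val_ge v (int k) x"
  shows "x = 0"
  using assms[of "nat (v x + 1)"] by (auto simp: val_ge_def split: if_splits)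

lemma v_eqI: "val_ge v k x \<Longrightarrow> \<not> val_ge v (k + 1) x \<Longrightarrow> x \<noteq> 0 \<and> v x = k"
  by (auto simp: val_ge_def)

text \<open>\<open>y\<close> is \<open>x\<close> plus something of larger valuation, and conversely,
  so neither valuation can exceed the other. This carries a valuation along an approximation, for
  derivatives in Newton steps as well as for uniformizers.\<close>

lemma v_perturb:
  assumes "x \<in> F" "y \<in> F" "x \<noteq> 0" "val_ge v (v x + 1) (y - x)"
  shows "y \<noteq> 0 \<and> v y = v x"
proof (rule v_eqI)
  have 1: "val_ge v (v x) x" by (simp add: val_ge_def)
  have "val_ge v (v x) (x + (y - x))"
    by (rule vge_add) (use assms 1 vge_mono[OF assms(4), of "v x"] in \<open>auto intro: mem_intros\<close>)
  then show "val_ge v (v x) y" by simp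
  show "\<not> val_ge v (v x + 1) y"
  proof
    assume y: "val_ge v (v x + 1) y"
    have "val_ge v (v x + 1) (y - (y - x))"
      by (rule vge_diff) (use assms y in \<open>auto intro: mem_intros\<close>)
    then show False using assms(3) by (simp add: val_ge_def)
  qed
qed

lemma v_sum_unique_min:
  assumes "finite I" "j \<in> I" "\<And>i. i \<in> I \<Longrightarrow> f i \<in> F" "f j \<noteq> 0"
    and "\<And>i. i \<in> I \<Longrightarrow> i \<noteq> j \<Longrightarrow> val_ge v (v (f j) + 1) (f i)"
  shows "sum f I \<noteq> 0 \<and> v (sum f I) = v (f j)"
proof (rule v_perturb)
  have "sum f I - f j = sum f (I - {j})"
    using assms(1,2) by (simp add: sum.remove)
  then show "val_ge v (v (f j) + 1) (sum f I - f j)"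
    using assms by (auto intro!: vge_sum)
qed (use assms in \<open>auto intro: sum_mem\<close>)

text \<open>Nonzero summands of pairwise distinct valuation cannot cancel.\<close>

lemma vge_sum_distinct:
  assumes "finite I" "\<And>i. i \<in> I \<Longrightarrow> f i \<in> F"
    and "\<And>i j. i \<in> I \<Longrightarrow> j \<in> I \<Longrightarrow> f i \<noteq> 0 \<Longrightarrow> f j \<noteq> 0 \<Longrightarrow> v (f i) = v (f j) \<Longrightarrow> i = j"
  shows "val_ge v k (sum f I) \<longleftrightarrow> (\<forall>i\<in>I. val_ge v k (f i))"
proof
  assume L: "val_ge v k (sum f I)"
  show "\<forall>i\<in>I. val_ge v k (f i)"
  proof (cases "\<exists>i\<in>I. f i \<noteq> 0")
    case True
    define J where "J = {i\<in>I. f i \<noteq> 0}"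
    have J: "finite J" "J \<noteq> {}" using True assms(1) by (auto simp: J_def)
    define j where "j = arg_min_on (\<lambda>i. v (f i)) J"
    have jJ: "j \<in> J" unfolding j_def using arg_min_if_finite(1)[OF J] .
    have jm: "v (f j) \<le> v (f i)" if "i \<in> J" for i
      using arg_min_least[OF J that] unfolding j_def .
    have "sum f I \<noteq> 0 \<and> v (sum f I) = v (f j)"
    proof (rule v_sum_unique_min[OF assms(1) _ assms(2)])
      fix i assume i: "i \<in> I" "i \<noteq> j"
      show "val_ge v (v (f j) + 1) (f i)"
      proof (cases "f i = 0")
        case False
        then have "v (f i) \<noteq> v (f j)" using assms(3)[of i j] i jJ by (auto simp: J_def)
        then show ?thesis using jm[of i] i False by (auto simp: J_def val_ge_def)
      qed simp
    qed (use jJ in \<open>auto simp: J_def\<close>)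
    then have "k \<le> v (f j)" using L by (auto simp: val_ge_def)
    then show ?thesis using jm by (force simp: val_ge_def J_def)
  qed simp
next
  assume "\<forall>i\<in>I. val_ge v k (f i)"
  then show "val_ge v k (sum f I)" using assms(2) by (auto intro!: vge_sum)
qed

text \<open>Representatives are kept as elements of the field instead of classes in a quotient ring,
  so that they can serve directly as coefficients and arguments of polynomials.\<close>

definition complete_system :: "nat \<Rightarrow> 'a set \<Rightarrow> bool" where
  "complete_system N U \<longleftrightarrow> U \<subseteq> {x\<in>F. val_ge v 0 x} \<and>
     (\<forall>x\<in>F. val_ge v 0 x \<longrightarrow> (\<exists>!u. u \<in> U \<and> val_ge v (int N) (x - u)))"

lemma complete_systemD:
  assumes "complete_system N U"
  shows "u \<in> U \<Longrightarrow> u \<in> F" "u \<in> U \<Longrightarrow> val_ge v 0 u"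
    and "x \<in> F \<Longrightarrow> val_ge v 0 x \<Longrightarrow> \<exists>u\<in>U. val_ge v (int N) (x - u)"
    and "a \<in> U \<Longrightarrow> b \<in> U \<Longrightarrow> val_ge v (int N) (a - b) \<Longrightarrow> a = b"
proof -
  note [unfolded complete_system_def] = assms
  note * = this
  show "u \<in> U \<Longrightarrow> u \<in> F" "u \<in> U \<Longrightarrow> val_ge v 0 u" using * by blast+
  show "x \<in> F \<Longrightarrow> val_ge v 0 x \<Longrightarrow> \<exists>u\<in>U. val_ge v (int N) (x - u)" using * by blast
  show "a \<in> U \<Longrightarrow> b \<in> U \<Longrightarrow> val_ge v (int N) (a - b) \<Longrightarrow> a = b"
  proof -
    assume a: "a \<in> U" "b \<in> U" "val_ge v (int N) (a - b)"
    have "\<exists>!u. u \<in> U \<and> val_ge v (int N) (a - u)" using * a(1) by blast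
    moreover have "val_ge v (int N) (a - a)" by simp
    ultimately show "a = b" using a by blast
  qed
qed

lemma complete_systemI:
  assumes "\<And>u. u \<in> U \<Longrightarrow> u \<in> F \<and> val_ge v 0 u"
    and "\<And>x. x \<in> F \<Longrightarrow> val_ge v 0 x \<Longrightarrow> \<exists>u\<in>U. val_ge v (int N) (x - u)"
    and "\<And>a b. a \<in> U \<Longrightarrow> b \<in> U \<Longrightarrow> val_ge v (int N) (a - b) \<Longrightarrow> a = b"
  shows "complete_system N U"
  unfolding complete_system_def
proof (intro conjI ballI impI)
  fix x assume x: "x \<in> F" "val_ge v 0 x"
  obtain u where u: "u \<in> U" "val_ge v (int N) (x - u)" using assms(2)[OF x] by blast
  show "\<exists>!u. u \<in> U \<and> val_ge v (int N) (x - u)"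
  proof (rule ex1I[of _ u])
    fix y assume y: "y \<in> U \<and> val_ge v (int N) (x - y)"
    have "val_ge v (int N) ((x - u) - (x - y))"
      by (rule vge_diff) (use assms(1) x u y in \<open>auto intro: mem_intros\<close>)
    then show "y = u" using assms(3)[of y u] y u by simp
  qed (use u in simp)
qed (use assms(1) in blast)

text \<open>Replacing each element of \<open>U\<close> by its representative in \<open>V\<close> is
  injective. Used in both directions, this shows that the size of a complete system depends on
  \<open>N\<close> alone.\<close>

lemma complete_system_inj_card:
  assumes "complete_system N U" "complete_system N V" "finite V"
  shows "finite U \<and> card U \<le> card V"
proof -
  define f where "f u = (SOME x. x \<in> V \<and> val_ge v (int N) (u - x))" for u
  have f: "f u \<in> V \<and> val_ge v (int N) (u - f u)" if "u \<in> U" for u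
    unfolding f_def
    by (rule someI_ex) (use complete_systemD(3)[OF assms(2)] complete_systemD(1,2)[OF assms(1) that] in blast)
  have inj: "inj_on f U"
  proof (rule inj_onI)
    fix a b assume ab: "a \<in> U" "b \<in> U" "f a = f b"
    have "val_ge v (int N) ((a - f a) - (b - f b))"
      by (rule vge_diff) (use f[OF ab(1)] f[OF ab(2)] ab complete_systemD(1)[OF assms(1)]
          complete_systemD(1)[OF assms(2)] in \<open>auto intro: mem_intros\<close>)
    then show "a = b" using complete_systemD(4)[OF assms(1)] ab by simp
  qed
  have "f ` U \<subseteq> V" using f by blast
  then show ?thesis using inj assms(3) by (meson inj_on_finite card_inj_on_le)
qed

text \<open>One step of the \<open>t\<close>-adic expansion: a residue modulo the power
  \<open>Suc N\<close> is a digit in \<open>R\<close> plus \<open>t\<close> times a residue modulo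
  the power \<open>N\<close>. The digit is recovered modulo \<open>t\<close>, the rest after
  division by \<open>t\<close>.\<close>

lemma complete_system_Suc:
  assumes R: "complete_system 1 R" and U: "complete_system N U" and t: "t \<in> F" "t \<noteq> 0" "v t = 1"
  shows "complete_system (Suc N) ((\<lambda>(r, u). r + t * u) ` (R \<times> U))"
    and "inj_on (\<lambda>(r, u). r + t * u) (R \<times> U)"
proof -
  note R1 = complete_systemD[OF R] and U1 = complete_systemD[OF U]
  have key: "r = r' \<and> u = u'" if *: "r \<in> R" "r' \<in> R" "u \<in> U" "u' \<in> U"
    "val_ge v (int (Suc N)) ((r + t * u) - (r' + t * u'))" for r r' u u'
  proof -
    have m: "r \<in> F" "r' \<in> F" "u \<in> F" "u' \<in> F" using * R1 U1 by auto
    have 1: "val_ge v (1 + 0) (t * (u - u'))"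
      by (intro vge_mult vge_diff) (use m t * U1 in \<open>auto intro: mem_intros simp: val_ge_def\<close>)
    have "val_ge v 1 (((r + t * u) - (r' + t * u')) - t * (u - u'))"
      by (rule vge_diff) (use m t 1 vge_mono[OF *(5), of 1] in \<open>auto intro: mem_intros\<close>)
    then have r: "r = r'" using R1(4)[of r r'] * by (simp add: algebra_simps)
    then have "val_ge v (int (Suc N)) (t * (u - u'))" using *(5) by (simp add: algebra_simps)
    then have "val_ge v (int N) (u - u')" using vge_mult_iff[of t "u - u'"] t m by (simp add: diff_mem)
    then show ?thesis using r U1(4) * by simp
  qed
  show "inj_on (\<lambda>(r, u). r + t * u) (R \<times> U)"
  proof (rule inj_onI, clarify)
    fix r u r' u' assume "r \<in> R" "r' \<in> R" "u \<in> U" "u' \<in> U" "r + t * u = r' + t * u'"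
    then show "r = r' \<and> u = u'" using key[of r r' u u'] by simp
  qed
  show "complete_system (Suc N) ((\<lambda>(r, u). r + t * u) ` (R \<times> U))"
  proof (rule complete_systemI)
    fix z assume "z \<in> (\<lambda>(r, u). r + t * u) ` (R \<times> U)"
    then obtain r u where "r \<in> R" "u \<in> U" "z = r + t * u" by auto
    then show "z \<in> F \<and> val_ge v 0 z" using R1 U1 t
      by (auto intro!: mem_intros vge_add vge_mult0 simp: val_ge_def[of v 0 t])
  next
    fix x assume x: "x \<in> F" "val_ge v 0 x"
    obtain r where r: "r \<in> R" "val_ge v 1 (x - r)" using R1(3)[OF x] by auto
    have rF: "r \<in> F" using r R1 by auto
    define y where "y = (x - r) / t"
    have y: "y \<in> F" "x = r + t * y" using x rF t by (auto simp: y_def intro: mem_intros)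
    then have "val_ge v 0 y" using r(2) vge_mult_iff[of t y 1] t by simp
    then obtain u where u: "u \<in> U" "val_ge v (int N) (y - u)" using U1(3) y by blast
    have "val_ge v (int (Suc N)) (t * (y - u))"
      using u vge_mult_iff[of t "y - u"] t y U1(1) by (simp add: diff_mem)
    then have "val_ge v (int (Suc N)) (x - (r + t * u))" using y by (simp add: algebra_simps)
    then show "\<exists>z\<in>(\<lambda>(r, u). r + t * u) ` (R \<times> U). val_ge v (int (Suc N)) (x - z)"
      using r u by force
  next
    fix a b assume "a \<in> (\<lambda>(r, u). r + t * u) ` (R \<times> U)" "b \<in> (\<lambda>(r, u). r + t * u) ` (R \<times> U)"
      "val_ge v (int (Suc N)) (a - b)"
    then show "a = b" using key by auto
  qed
qed

end

locale finite_valued_field = valued_field +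
  fixes R :: "'a set"
  assumes residues: "complete_system 1 R" and finite_residues: "finite R"
begin

lemma complete_system_ex: "\<exists>U. complete_system N U \<and> finite U \<and> card U = card R ^ N"
proof (induction N)
  case 0
  have "complete_system 0 {0}"
    by (rule complete_systemI) (auto simp: zero_mem)
  then show ?case by (intro exI[of _ "{0}"]) simp
next
  case (Suc N)
  then obtain U where U: "complete_system N U" "finite U" "card U = card R ^ N" by blast
  obtain t where t: "t \<in> F" "t \<noteq> 0" "v t = 1" using v_surj by blast
  note 1 = complete_system_Suc[OF residues U(1) t]
  show ?case
    by (rule exI[of _ "(\<lambda>(r, u). r + t * u) ` (R \<times> U)"])
       (use 1 U finite_residues in \<open>simp add: card_image card_cartesian_product\<close>)
qed

lemma complete_system_card:
  assumes "complete_system N U"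
  shows "finite U" "card U = card R ^ N"
proof -
  obtain V where V: "complete_system N V" "finite V" "card V = card R ^ N"
    using complete_system_ex by blast
  show "finite U" using complete_system_inj_card[OF assms V(1,2)] by blast
  then show "card U = card R ^ N"
    using complete_system_inj_card[OF assms V(1,2)] complete_system_inj_card[OF V(1) assms] V(3) by simp
qed

text \<open>Subtracting \<open>x\<close> and dividing by an element of valuation \<open>k\<close>
  turns the coset of \<open>x\<close> modulo the \<open>k\<close>-th power into a complete system
  modulo the power \<open>N - k\<close>.\<close>

lemma complete_system_coset_card:
  assumes U: "complete_system N U" and k: "k \<le> N" and x: "x \<in> F" "val_ge v 0 x"
  shows "card {u\<in>U. val_ge v (int k) (u - x)} = card R ^ (N - k)"
proof -
  obtain t where t: "t \<in> F" "t \<noteq> 0" "v t = int k" using v_surj by blast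
  note U1 = complete_systemD[OF U]
  let ?A = "{u\<in>U. val_ge v (int k) (u - x)}"
  define f where "f u = (u - x) / t" for u
  have fF: "f u \<in> F" if "u \<in> ?A" for u using that U1 x t by (auto simp: f_def intro: mem_intros)
  have fu: "u = x + t * f u" for u using t by (simp add: f_def)
  have inj: "inj_on f ?A" by (rule inj_onI) (metis fu)
  have "complete_system (N - k) (f ` ?A)"
  proof (rule complete_systemI)
    fix y assume "y \<in> f ` ?A"
    then obtain u where u: "u \<in> ?A" "y = f u" by blast
    have "val_ge v (int k) (t * f u)" using u(1) t by (auto simp: f_def)
    then show "y \<in> F \<and> val_ge v 0 y" using fF[OF u(1)] u vge_mult_iff[of t "f u"] t by simp
  next
    fix y assume y: "y \<in> F" "val_ge v 0 y"
    have m: "x + t * y \<in> F" "val_ge v 0 (x + t * y)"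
      using x y t by (auto intro!: mem_intros vge_add vge_mult0 simp: val_ge_def[of v 0 t])
    obtain u where u: "u \<in> U" "val_ge v (int N) ((x + t * y) - u)" using U1(3)[OF m] by blast
    have 1: "val_ge v (int k) (t * y)"
      using y t by (subst vge_mult_iff) auto
    have "val_ge v (int k) (t * y - ((x + t * y) - u))"
      by (rule vge_diff) (use 1 u k x y t U1 vge_mono[OF u(2), of "int k"] in \<open>auto intro: mem_intros\<close>)
    then have uA: "u \<in> ?A" using u by simp
    have "t * (y - f u) = (x + t * y) - u" using fu[of u] by (simp add: algebra_simps)
    then have "val_ge v (int N) (t * (y - f u))" using u by simp
    then have "val_ge v (int (N - k)) (y - f u)"
      using vge_mult_iff[of t "y - f u"] t y fF[OF uA] k by (simp add: diff_mem of_nat_diff)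
    then show "\<exists>z\<in>f ` ?A. val_ge v (int (N - k)) (y - z)" using uA by blast
  next
    fix a b assume "a \<in> f ` ?A" "b \<in> f ` ?A" and ge: "val_ge v (int (N - k)) (a - b)"
    then obtain c d where cd: "c \<in> ?A" "a = f c" "d \<in> ?A" "b = f d" by blast
    have "val_ge v (int N) (t * (f c - f d))"
      using ge cd vge_mult_iff[of t "f c - f d"] t fF k by (simp add: diff_mem of_nat_diff)
    moreover have "t * (f c - f d) = c - d"
    proof -
      have "(x + t * f c) - (x + t * f d) = c - d" by (simp only: fu[symmetric])
      then show ?thesis by (simp add: algebra_simps)
    qed
    ultimately have "c = d" using U1(4)[of c d] cd by simp
    then show "a = b" using cd by simp
  qed
  then show ?thesis using complete_system_card inj by (metis (lifting) card_image)
qed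

lemma complete_system_unif_card:
  assumes U: "complete_system N U" and N: "N \<ge> 2"
  shows "card {u\<in>U. u \<noteq> 0 \<and> v u = 1} = card R ^ (N - 1) - card R ^ (N - 2)"
proof -
  let ?A = "\<lambda>k. {u\<in>U. val_ge v (int k) (u - 0)}"
  have "{u\<in>U. u \<noteq> 0 \<and> v u = 1} = ?A 1 - ?A 2" by (auto simp: val_ge_def)
  moreover have "?A 2 \<subseteq> ?A 1" by (auto simp: val_ge_def)
  moreover have "finite (?A 2)" using complete_system_card(1)[OF U] by simp
  ultimately have "card {u\<in>U. u \<noteq> 0 \<and> v u = 1} = card (?A 1) - card (?A 2)"
    by (simp only: card_Diff_subset)
  also have "card (?A 1) = card R ^ (N - 1)"
    by (rule complete_system_coset_card[OF U]) (use N zero_mem in auto)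
  also have "card (?A 2) = card R ^ (N - 2)"
    by (rule complete_system_coset_card[OF U]) (use N zero_mem in auto)
  finally show ?thesis .
qed

lemma card_residues_ge_2: "card R \<ge> 2"
proof -
  obtain a where a: "a \<in> R" "val_ge v 1 (0 - a)"
    using complete_systemD(3)[OF residues, of 0] zero_mem by auto
  obtain b where b: "b \<in> R" "val_ge v 1 (1 - b)"
    using complete_systemD(3)[OF residues, of 1] one_mem vge_one by auto
  have "a \<noteq> b"
  proof
    assume "a = b"
    have "val_ge v 1 ((1 - b) - (0 - a))"
      by (rule vge_diff) (use a b complete_systemD(1)[OF residues] in \<open>auto intro: mem_intros\<close>)
    then show False using \<open>a = b\<close> by (simp add: val_ge_def v_one)
  qed
  then have "card {a, b} = 2" by simp
  moreover have "card {a, b} \<le> card R" using a b finite_residues by (intro card_mono) auto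
  ultimately show ?thesis by simp
qed

end

section \<open>Polynomials\<close>

text \<open>A nonzero element \<open>m\<close> of least degree in the ideal generated by
  \<open>g\<close> and \<open>h\<close> divides all of it. Were \<open>m\<close> not a unit, it
  would be associated to \<open>g\<close>, and \<open>g\<close> would divide
  \<open>h\<close>.\<close>

lemma irreducible_poly_bezout:
  fixes g h :: "'a::field poly"
  assumes g: "irreducible g" and nd: "\<not> g dvd h"
  shows "\<exists>a b. a * g + b * h = 1"
proof -
  define I where "I = {a * g + b * h | a b. True}"
  have "g \<noteq> 0" using g by auto
  moreover have "1 * g + 0 * h \<in> I" unfolding I_def by blast
  ultimately have "g \<in> I \<and> g \<noteq> 0" by simp
  from ex_has_least_nat[of "\<lambda>z. z \<in> I \<and> z \<noteq> 0", OF this, of degree]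
  obtain m where m: "m \<in> I" "m \<noteq> 0" "\<And>z. z \<in> I \<Longrightarrow> z \<noteq> 0 \<Longrightarrow> degree m \<le> degree z" by blast
  obtain a0 b0 where m0: "m = a0 * g + b0 * h" using m(1) unfolding I_def by blast
  have mdvd: "m dvd a * g + b * h" for a b
  proof -
    let ?z = "a * g + b * h"
    define d where "d = ?z div m"
    have "?z mod m = ?z - d * m" by (simp add: minus_div_mult_eq_mod d_def)
    also have "\<dots> = (a - d * a0) * g + (b - d * b0) * h"
      by (simp add: m0 algebra_simps)
    finally have "?z mod m \<in> I" unfolding I_def by blast
    then have "?z mod m = 0" using m(3) degree_mod_less[OF m(2), of ?z] by force
    then show ?thesis by auto
  qed
  have "m dvd g" using mdvd[of 1 0] by simp
  then obtain k where k: "g = m * k" by blast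
  have "m dvd h" using mdvd[of 0 1] by simp
  have "m dvd 1"
  proof (rule ccontr)
    assume "\<not> m dvd 1"
    then have "k dvd 1" using irreducibleD[OF g k] by blast
    then have "g dvd m" unfolding k by (metis dvd_triv_left mult_dvd_mono mult_1_right dvd_refl)
    then show False using \<open>m dvd h\<close> nd dvd_trans by blast
  qed
  then obtain c where "1 = m * c" by blast
  then have "(c * a0) * g + (c * b0) * h = 1" unfolding m0 by (simp add: algebra_simps)
  then show ?thesis by blast
qed

lemma separable_poly_factor:
  assumes "separable_poly (f * h)"
  shows "separable_poly h"
  unfolding separable_poly_def
proof (rule coprimeI)
  fix c assume c: "c dvd h" "c dvd pderiv h"
  have "c dvd f * h" using c by simp
  moreover have "c dvd pderiv (f * h)" using c by (simp add: pderiv_mult)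
  ultimately show "is_unit c"
    using assms unfolding separable_poly_def by (meson coprime_common_divisor)
qed

context separable_closure
begin

text \<open>Induction by splitting off a root \<open>x\<close>: the cofactor is again separable, and
  it does not vanish at \<open>x\<close>, since otherwise X - x would divide both \<open>h\<close>
  and its derivative. So each step contributes one new root.\<close>

lemma card_roots_separable:
  fixes h :: "'a poly"
  assumes "separable_poly h"
  shows "finite {x. poly h x = 0} \<and> card {x. poly h x = 0} = degree h"
  using assms
proof (induction "degree h" arbitrary: h)
  case 0
  have "h \<noteq> 0" using 0(2) by (auto simp: separable_poly_def)
  moreover obtain c where "h = [:c:]" using degree_eq_zeroE 0(1) by metis
  ultimately show ?case by auto
next
  case (Suc m)
  then obtain x where x: "poly h x = 0" using separably_closed[of h] by auto
  then obtain k where k: "h = [:- x, 1:] * k" using poly_eq_0_iff_dvd by blast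
  have sk: "separable_poly k" using Suc(3) separable_poly_factor unfolding k by blast
  have k0: "k \<noteq> 0" using Suc(2) k by auto
  then have dk: "degree k = m" using Suc(2) unfolding k by (subst (asm) degree_mult_eq) auto
  have kx: "poly k x \<noteq> 0"
  proof
    assume 0: "poly k x = 0"
    have "[:- x, 1:] dvd h" unfolding k by (rule dvd_triv_left)
    moreover have "[:- x, 1:] dvd pderiv h"
      by (subst poly_eq_0_iff_dvd[symmetric]) (simp add: k pderiv_mult 0 del: mult_pCons_left)
    ultimately have "is_unit [:- x, 1:]"
      using Suc(3) unfolding separable_poly_def by (meson coprime_common_divisor)
    then show False by (auto simp: is_unit_pCons_iff)
  qed
  have "{y. poly h y = 0} = insert x {y. poly k y = 0}" unfolding k by auto
  then show ?case using Suc(1)[OF dk[symmetric] sk] kx Suc(2) dk by simp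
qed

end

section \<open>Polynomials with coefficients in the valuation ring\<close>

context valued_field
begin

definition integral_poly :: "'a poly \<Rightarrow> bool" where
  "integral_poly p \<longleftrightarrow> (\<forall>i. coeff p i \<in> F \<and> val_ge v 0 (coeff p i))"

lemma integral_poly_pCons:
  "integral_poly (pCons a p) \<longleftrightarrow> a \<in> F \<and> val_ge v 0 a \<and> integral_poly p"
  unfolding integral_poly_def by (auto simp: coeff_pCons all_conj_distrib split: nat.splits)

lemma integral_poly_add: "integral_poly p \<Longrightarrow> integral_poly r \<Longrightarrow> integral_poly (p + r)"
  by (auto simp: integral_poly_def intro: mem_intros vge_add)

lemma integral_poly_mult: "integral_poly p \<Longrightarrow> integral_poly r \<Longrightarrow> integral_poly (p * r)"
  unfolding integral_poly_def coeff_mult by (auto intro!: sum_mem mem_intros vge_sum vge_mult0)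

lemma integral_poly_one: "integral_poly 1"
  by (auto simp: integral_poly_def one_mem zero_mem vge_one)

lemma integral_poly_zero: "integral_poly 0"
  by (simp add: integral_poly_def zero_mem)

lemma integral_poly_sum: "(\<And>i. i \<in> I \<Longrightarrow> integral_poly (f i)) \<Longrightarrow> integral_poly (sum f I)"
  by (induction I rule: infinite_finite_induct)
     (auto intro: integral_poly_add integral_poly_zero)

lemma integral_poly_prod: "(\<And>i. i \<in> I \<Longrightarrow> integral_poly (f i)) \<Longrightarrow> integral_poly (prod f I)"
  by (induction I rule: infinite_finite_induct) (auto intro: integral_poly_mult integral_poly_one)

lemma integral_poly_pderiv: "integral_poly p \<Longrightarrow> integral_poly (pderiv p)"
  unfolding integral_poly_def coeff_pderiv by (auto intro!: mem_intros vge_mult0 vge_of_nat simp del: of_nat_Suc)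

lemma poly_integral:
  "integral_poly p \<Longrightarrow> x \<in> F \<Longrightarrow> val_ge v 0 x \<Longrightarrow> poly p x \<in> F \<and> val_ge v 0 (poly p x)"
  by (induction p) (auto simp: integral_poly_pCons intro!: mem_intros vge_add vge_mult0)

text \<open>The induction follows Horner's scheme and builds the second-order remainder from
  integral quantities, never dividing by 2, so the expansion holds in every characteristic.\<close>

lemma poly_taylor:
  assumes "integral_poly p" "x \<in> F" "val_ge v 0 x" "h \<in> F" "val_ge v 0 h"
  shows "\<exists>r\<in>F. val_ge v 0 r \<and> poly p (x + h) = poly p x + h * poly (pderiv p) x + h\<^sup>2 * r"
  using assms(1)
proof (induction p)
  case 0
  show ?case using zero_mem by (intro bexI[of _ 0]) auto
next
  case (pCons a p)
  then have ip: "integral_poly p" by (simp add: integral_poly_pCons)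
  then obtain r where r: "r \<in> F" "val_ge v 0 r"
    "poly p (x + h) = poly p x + h * poly (pderiv p) x + h\<^sup>2 * r" using pCons by blast
  note d = poly_integral[OF integral_poly_pderiv[OF ip] assms(2,3)]
  show ?case
  proof (rule bexI[of _ "poly (pderiv p) x + (x + h) * r"], intro conjI)
    show "val_ge v 0 (poly (pderiv p) x + (x + h) * r)"
      using d r assms by (auto intro!: mem_intros vge_add vge_mult0)
    show "poly (pderiv p) x + (x + h) * r \<in> F" using d r assms by (auto intro!: mem_intros)
    show "poly (pCons a p) (x + h) = poly (pCons a p) x + h * poly (pderiv (pCons a p)) x
        + h\<^sup>2 * (poly (pderiv p) x + (x + h) * r)"
      by (simp only: poly_pCons pderiv_pCons poly_add r(3)) (simp add: algebra_simps power2_eq_square)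
  qed
qed

lemma poly_lipschitz:
  assumes "integral_poly p" "x \<in> F" "val_ge v 0 x" "y \<in> F" "val_ge v 0 y" "val_ge v k (y - x)"
  shows "val_ge v k (poly p y - poly p x)"
  using assms(1)
proof (induction p)
  case (pCons a p)
  then have ip: "integral_poly p" by (simp add: integral_poly_pCons)
  have eq: "poly (pCons a p) y - poly (pCons a p) x = poly p y * (y - x) + x * (poly p y - poly p x)"
    by (simp add: algebra_simps)
  show ?case unfolding eq
    using poly_integral[OF ip assms(2,3)] poly_integral[OF ip assms(4,5)] pCons ip assms
    by (auto intro!: mem_intros vge_add vge_mult0)
qed simp

end

section \<open>Totally ramified extensions and Eisenstein polynomials\<close>

sublocale local_field \<subseteq> W: valued_field UNIV w
  by unfold_locales (use normalised in auto)

context local_field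
begin

text \<open>The residue field is a bare set of classes; choosing one element from each class gives a
  complete system modulo the maximal ideal. From here on q enters as \<open>card R\<close>.\<close>

lemma residue_system:
  obtains R where "finite_valued_field UNIV w R" "card R = card (residue_field w)"
proof -
  define r where "r = {(x, y) \<in> val_ring w \<times> val_ring w. x - y \<in> max_ideal w}"
  have r: "equiv (val_ring w) r"
  proof (rule equivI)
    show "refl_on (val_ring w) r" by (auto simp: refl_on_def r_def max_ideal_def)
    show "sym r" by (rule symI) (auto simp: r_def max_ideal_def W.vge_diff_commute)
    show "trans r"
    proof (rule transI)
      fix x y z assume "(x, y) \<in> r" "(y, z) \<in> r"
      then show "(x, z) \<in> r" using W.vge_add[of "x - y" "y - z" 1] by (auto simp: r_def max_ideal_def)
    qed
    show "r \<subseteq> val_ring w \<times> val_ring w" by (auto simp: r_def)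
  qed
  have q: "residue_field w = val_ring w // r" by (simp add: residue_field_def r_def)
  define f where "f C = (SOME x. x \<in> C)" for C :: "'k set"
  have f: "f C \<in> C" if "C \<in> residue_field w" for C
    unfolding f_def by (rule someI_ex) (use in_quotient_imp_non_empty[OF r] that q in blast)
  have sub: "C \<subseteq> val_ring w" if "C \<in> residue_field w" for C
    using in_quotient_imp_subset[OF r] that q by blast
  have rel: "C = D" if "C \<in> residue_field w" "D \<in> residue_field w" "x \<in> C" "y \<in> D" "(x, y) \<in> r" for C D x y
    using quotient_eqI[OF r] that unfolding q by blast
  let ?R = "f ` residue_field w"
  have inj: "inj_on f (residue_field w)"
  proof (rule inj_onI)
    fix C D assume CD: "C \<in> residue_field w" "D \<in> residue_field w" "f C = f D"
    have "(f C, f C) \<in> r" using f[OF CD(1)] sub[OF CD(1)] by (auto simp: r_def max_ideal_def)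
    then show "C = D" using rel f CD by metis
  qed
  have "W.complete_system 1 ?R"
  proof (rule W.complete_systemI)
    fix u assume "u \<in> ?R"
    then show "u \<in> UNIV \<and> val_ge w 0 u" using f sub by (auto simp: val_ring_def)
  next
    fix x assume "val_ge w 0 x"
    then have x: "x \<in> val_ring w" by (simp add: val_ring_def)
    then have C: "r `` {x} \<in> residue_field w" unfolding q by (rule quotientI)
    then have "(x, f (r `` {x})) \<in> r" using f by blast
    then show "\<exists>u\<in>?R. val_ge w (int 1) (x - u)" using C by (auto simp: r_def max_ideal_def)
  next
    fix a b assume "a \<in> ?R" "b \<in> ?R" and ge: "val_ge w (int 1) (a - b)"
    then obtain C D where CD: "C \<in> residue_field w" "D \<in> residue_field w" "a = f C" "b = f D" by blast
    have "(f C, f D) \<in> r" using ge CD f sub by (fastforce simp: r_def max_ideal_def)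
    then show "a = b" using rel f CD by metis
  qed
  then have "finite_valued_field UNIV w ?R"
    by unfold_locales (use finite_residue_field in auto)
  moreover have "card ?R = card (residue_field w)" using inj by (rule card_image)
  ultimately show ?thesis using that by blast
qed

text \<open>By pigeonhole two integers agree in the finite residue field, so some positive integer
  lies in the maximal ideal. The least one, \<open>m\<close>, divides all others by division with
  remainder and is not 1; hence the gcd is a nonzero multiple of \<open>m\<close>. It gives n \<ge>
  2 for n = ep.\<close>

lemma residue_char_ge_2: "residue_char w \<ge> 2"
proof -
  define S where "S = {n. (of_nat n :: 'k) \<in> max_ideal w}"
  have S: "m \<in> S \<longleftrightarrow> val_ge w 1 (of_nat m)" for m by (simp add: S_def max_ideal_def)
  obtain R where "finite_valued_field UNIV w R" by (rule residue_system)
  then interpret R: finite_valued_field UNIV w R .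
  define h where "h m = (SOME r. r \<in> R \<and> val_ge w 1 (of_nat m - r))" for m :: nat
  have h: "h m \<in> R \<and> val_ge w 1 (of_nat m - h m)" for m
    unfolding h_def by (rule someI_ex) (use W.complete_systemD(3)[OF R.residues, of "of_nat m"] W.vge_of_nat in auto)
  have "\<not> inj h"
  proof
    assume "inj h"
    moreover have "range h \<subseteq> R" using h by blast
    ultimately show False using R.finite_residues infinite_UNIV_nat inj_on_finite by blast
  qed
  then obtain a b where ab: "a < b" "h a = h b" by (metis injI nat_neq_iff)
  have "val_ge w 1 ((of_nat b - h b) - (of_nat a - h a))"
    by (rule W.vge_diff) (use h in auto)
  then have "b - a \<in> S" using ab by (simp add: S of_nat_diff)
  then have "\<exists>m. m > 0 \<and> m \<in> S" using ab by (intro exI[of _ "b - a"]) auto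
  then obtain m where m: "m > 0" "m \<in> S" and least: "\<And>k. k < m \<Longrightarrow> \<not> (k > 0 \<and> k \<in> S)"
    using exists_least_iff[of "\<lambda>m. m > 0 \<and> m \<in> S"] by blast
  have "m dvd k" if "k \<in> S" for k
  proof -
    have "val_ge w 1 (of_nat (k div m) * of_nat m :: 'k)"
      using m(2) W.vge_of_nat by (intro W.vge_mult0) (auto simp: S)
    then have "val_ge w 1 ((of_nat k :: 'k) - of_nat (k div m) * of_nat m)"
      using that by (intro W.vge_diff) (auto simp: S)
    moreover have "(of_nat k :: 'k) - of_nat (k div m) * of_nat m = of_nat (k mod m)"
      by (metis add_diff_cancel_left' div_mult_mod_eq of_nat_add of_nat_mult)
    ultimately have "k mod m \<in> S" by (simp add: S)
    moreover have "k mod m < m" using m(1) by simp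
    ultimately have "k mod m = 0" using least[of "k mod m"] by simp
    then show ?thesis by (simp add: dvd_eq_mod_eq_0)
  qed
  then have "m dvd Gcd S" by (auto intro: Gcd_greatest)
  moreover have "m \<noteq> 1" using m(2) W.v_one by (auto simp: S val_ge_def)
  moreover have "Gcd S \<noteq> 0"
  proof
    assume "Gcd S = 0"
    then have "S \<subseteq> {0}" by (simp only: Gcd_0_iff)
    then show False using m by auto
  qed
  ultimately have "m \<le> Gcd S" "m \<ge> 2" using m(1) by (auto intro: dvd_imp_le simp del: Gcd_0_iff Gcd_eq_1_I)
  then show ?thesis by (simp add: residue_char_def S_def)
qed

end

section \<open>Monic and Eisenstein polynomials\<close>

definition monic_poly :: "nat \<Rightarrow> (nat \<Rightarrow> 'a::comm_ring_1) \<Rightarrow> 'a poly" where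
  "monic_poly n a = monom 1 n + (\<Sum>i<n. monom (a i) i)"

lemma coeff_monic_poly: "coeff (monic_poly n a) i = (if i < n then a i else if i = n then 1 else 0)"
proof -
  have "(\<Sum>j<n. coeff (monom (a j) j) i) = (\<Sum>j<n. if j = i then a i else 0)"
    by (rule sum.cong) auto
  then show ?thesis by (auto simp: monic_poly_def coeff_sum)
qed

lemma degree_monic_poly: "degree (monic_poly n a) = n"
  by (rule antisym[OF degree_le le_degree]) (auto simp: coeff_monic_poly)

lemma monic_poly_coeff: "degree g = n \<Longrightarrow> lead_coeff g = 1 \<Longrightarrow> g = monic_poly n (coeff g)"
  by (rule poly_eqI) (auto simp: coeff_monic_poly coeff_eq_0)

definition eisenstein :: "('k::field \<Rightarrow> int) \<Rightarrow> nat \<Rightarrow> 'k poly \<Rightarrow> bool" where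
  "eisenstein w n g \<longleftrightarrow> degree g = n \<and> lead_coeff g = 1 \<and> (\<forall>i<n. val_ge w 1 (coeff g i)) \<and>
     coeff g 0 \<noteq> 0 \<and> w (coeff g 0) = 1"

lemma eisensteinD:
  assumes "eisenstein w n g"
  shows "degree g = n" "lead_coeff g = 1" "coeff g n = 1" "coeff g 0 \<noteq> 0" "w (coeff g 0) = 1"
    and "i < n \<Longrightarrow> val_ge w 1 (coeff g i)"
  using assms by (auto simp: eisenstein_def)

lemma eisenstein_monic_poly: "eisenstein w n g \<Longrightarrow> monic_poly n (coeff g) = g"
  using monic_poly_coeff[of g n] eisensteinD(1,2)[of w n g] by simp

lemma poly_sum_lessThan:
  fixes p :: "'a::comm_semiring_1 poly"
  assumes "degree p < n"
  shows "poly p x = (\<Sum>i<n. coeff p i * x ^ i)"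
  unfolding poly_altdef
  by (rule sum.mono_neutral_left) (use assms in \<open>auto simp: coeff_eq_0\<close>)

text \<open>Digits to base \<open>n\<close>. In a totally ramified extension of degree
  \<open>n\<close> it means that nonzero terms c \<alpha>^i and c' \<alpha>^j with distinct i, j < n
  have distinct valuations n w(c) + i and n w(c') + j.\<close>

lemma int_digits_unique:
  fixes a b :: int and i j n :: nat
  assumes "i < n" "j < n" "int n * a + int i = int n * b + int j"
  shows "i = j \<and> a = b"
proof -
  have "int i = (int n * a + int i) mod int n" using assms(1) by simp
  also have "\<dots> = int j" unfolding assms(3) using assms(2) by simp
  finally show ?thesis using assms by simp
qed

context field_hom
begin

abbreviation evl :: "'a poly \<Rightarrow> 'b \<Rightarrow> 'b" where
  "evl p x \<equiv> poly (map_poly hom p) x"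

lemma evl_sum_lessThan: "degree p < n \<Longrightarrow> evl p x = (\<Sum>i<n. hom (coeff p i) * x ^ i)"
  using poly_sum_lessThan[of "map_poly hom p" n x] by simp

lemma evl_monic:
  "degree g = n \<Longrightarrow> lead_coeff g = 1 \<Longrightarrow> evl g x = x ^ n + (\<Sum>i<n. hom (coeff g i) * x ^ i)"
  using evl_sum_lessThan[of g "Suc n" x] by simp

lemma evl_pderiv:
  assumes "degree g = n" "n > 0"
  shows "evl (pderiv g) x = (\<Sum>i<n. hom (of_nat (Suc i) * coeff g (Suc i)) * x ^ i)"
  by (subst evl_sum_lessThan[of _ n])
     (use assms degree_pderiv_le[of g] in \<open>auto simp: coeff_pderiv simp del: of_nat_Suc\<close>)

end

text \<open>\<open>n\<close> occurs both as the degree of \<open>E\<close> and as the factor in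
  \<open>val_base\<close>: together these say that \<open>E\<close> is totally ramified, with a
  valuation \<open>v\<close> fixed.\<close>

locale ramified_ext = local_field w + field_hom \<iota>
  for w :: "'k::field \<Rightarrow> int" and \<iota> :: "'k \<Rightarrow> 'a::field" +
  fixes E :: "'a set" and v :: "'a \<Rightarrow> int" and n :: nat
  assumes inter: "intermediate_field \<iota> E" and deg: "ext_degree \<iota> E = n" and n_pos: "n > 0"
    and val: "normalised_valuation_on E v" and val_base: "x \<noteq> 0 \<Longrightarrow> v (\<iota> x) = int n * w x"
begin

lemma base_mem: "\<iota> x \<in> E"
  using inter unfolding intermediate_field_def by blast

sublocale V: valued_field E v
proof
  show "0 \<in> E" "1 \<in> E" using base_mem[of 0] base_mem[of 1] by simp_all
qed (use inter val in \<open>auto simp: intermediate_field_def\<close>)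

sublocale vs: vector_space "ext_scale \<iota>"
  by (rule vector_space_ext_scale)

lemma vge_base: "val_ge v (int n * k) (\<iota> x) \<longleftrightarrow> val_ge w k x"
  using n_pos by (cases "x = 0") (auto simp: val_ge_def val_base)

lemma vge_base0: "val_ge v 0 (\<iota> x) \<longleftrightarrow> val_ge w 0 x"
  using vge_base[of 0 x] by simp

lemma evl_mem: "x \<in> E \<Longrightarrow> evl p x \<in> E"
  by (subst evl_sum_lessThan[OF lessI]) (intro V.sum_mem V.mem_intros base_mem)

lemma integral_map_poly: "(\<And>i. val_ge w 0 (coeff p i)) \<Longrightarrow> V.integral_poly (map_poly \<iota> p)"
  by (auto simp: V.integral_poly_def base_mem vge_base0)

definition unif :: "'a \<Rightarrow> bool" where
  "unif \<alpha> \<longleftrightarrow> \<alpha> \<in> E \<and> \<alpha> \<noteq> 0 \<and> v \<alpha> = 1"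

lemma unif_ex: "\<exists>\<alpha>. unif \<alpha>"
  using V.v_surj[of 1] by (auto simp: unif_def)

lemma unif_vge0: "unif \<alpha> \<Longrightarrow> val_ge v 0 \<alpha>"
  by (auto simp: unif_def val_ge_def)

text \<open>A Newton polygon with a single slope. If \<open>v \<beta>\<close> were at most 0, the
  leading term would have smaller valuation than all others. So \<open>v \<beta>\<close> is
  positive, the constant term is the only lower term of valuation \<open>n\<close>, and comparison
  with the leading term gives n v(\<beta>) = n.\<close>

lemma eisenstein_root_unif:
  assumes g: "eisenstein w n g" and b: "\<beta> \<in> E" "evl g \<beta> = 0"
  shows "unif \<beta>"
proof -
  note G = g[unfolded eisenstein_def]
  let ?f = "\<lambda>i. \<iota> (coeff g i) * \<beta> ^ i"
  have eq: "\<beta> ^ n = - (\<Sum>i<n. ?f i)"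
    using evl_monic[OF conjunct1[OF G] conjunct1[OF conjunct2[OF G]], of \<beta>] b
    by (simp add: eq_neg_iff_add_eq_0)
  have fE: "?f i \<in> E" for i using b by (intro V.mem_intros base_mem)
  have c: "val_ge v (int n) (\<iota> (coeff g i))" if "i < n" for i
    using vge_base[of 1 "coeff g i"] G that by simp
  have b0: "\<beta> \<noteq> 0"
  proof
    assume "\<beta> = 0"
    then have "(\<Sum>i<n. ?f i) = (\<Sum>i<n. if i = 0 then \<iota> (coeff g 0) else 0)"
      by (intro sum.cong) auto
    then show False using eq \<open>\<beta> = 0\<close> n_pos G by (simp add: zero_power)
  qed
  have vb: "v \<beta> \<ge> 1"
  proof (rule ccontr)
    assume "\<not> v \<beta> \<ge> 1"
    then have le: "v \<beta> \<le> 0" by simp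
    have "val_ge v (int n * v \<beta> + 1) (?f i)" if i: "i < n" for i
    proof -
      have "val_ge v (int n + int i * v \<beta>) (?f i)"
        using b i by (intro V.vge_mult V.vge_power c V.mem_intros base_mem) (auto simp: val_ge_def)
      moreover have "int n * v \<beta> \<le> int i * v \<beta>" using i le by (intro mult_right_mono_neg) auto
      ultimately show ?thesis using n_pos by (elim V.vge_mono) linarith
    qed
    then have "val_ge v (int n * v \<beta> + 1) (\<Sum>i<n. ?f i)" using fE by (intro V.vge_sum) auto
    then have "val_ge v (int n * v \<beta> + 1) (\<beta> ^ n)"
      unfolding eq using fE by (subst V.vge_uminus) (auto intro: V.sum_mem)
    then show False using V.v_power[OF b(1) b0, of n] b0 by (simp add: val_ge_def)
  qed
  have v0: "v (?f 0) = int n" "?f 0 \<noteq> 0" using G val_base[of "coeff g 0"] by auto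
  have "(\<Sum>i<n. ?f i) \<noteq> 0 \<and> v (\<Sum>i<n. ?f i) = v (?f 0)"
  proof (rule V.v_sum_unique_min)
    fix i assume i: "i \<in> {..<n}" "i \<noteq> 0"
    have "val_ge v (int n + int i * 1) (?f i)"
      using b i vb by (intro V.vge_mult V.vge_power c V.mem_intros base_mem) (auto simp: val_ge_def)
    then show "val_ge v (v (?f 0) + 1) (?f i)" using i v0(1) by (elim V.vge_mono) simp
  qed (use n_pos fE v0 in auto)
  then have "v (\<beta> ^ n) = int n"
    unfolding eq v0 using fE by (subst V.v_uminus) (auto intro: V.sum_mem)
  then show ?thesis using V.v_power[OF b(1) b0, of n] b b0 n_pos by (simp add: unif_def)
qed

end

section \<open>Coordinates with respect to the powers of a uniformizer\<close>

locale uniformized_ext = ramified_ext w \<iota> E v n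
  for w :: "'k::field \<Rightarrow> int" and \<iota> :: "'k \<Rightarrow> 'a::field" and E v n +
  fixes \<alpha> :: 'a
  assumes unif: "unif \<alpha>"
begin

lemma unifD: "\<alpha> \<in> E" "\<alpha> \<noteq> 0" "v \<alpha> = 1"
  using unif by (auto simp: unif_def)

lemma term_mem: "\<iota> c * \<alpha> ^ i \<in> E"
  by (intro V.mem_intros base_mem unifD)

lemma lincomb_mem: "(\<Sum>i\<in>I. \<iota> (c i) * \<alpha> ^ i) \<in> E"
  by (intro V.sum_mem term_mem)

lemma v_term: "c \<noteq> 0 \<Longrightarrow> v (\<iota> c * \<alpha> ^ i) = int n * w c + int i"
  using unifD by (simp add: V.v_mult V.v_power base_mem V.power_mem val_base)

lemma vge_term: "val_ge v k (\<iota> c * \<alpha> ^ i) \<longleftrightarrow> c = 0 \<or> k \<le> int n * w c + int i"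
  using unifD by (cases "c = 0") (simp_all add: v_term val_ge_def)

text \<open>The central tool: by uniqueness of base-\<open>n\<close> digits no two nonzero summands
  have equal valuation, so nothing cancels and the valuation of an element of \<open>E\<close> is
  visible in its coordinates.\<close>

lemma vge_lincomb:
  "val_ge v k (\<Sum>i<n. \<iota> (c i) * \<alpha> ^ i) \<longleftrightarrow> (\<forall>i<n. c i = 0 \<or> k \<le> int n * w (c i) + int i)"
proof (subst V.vge_sum_distinct)
  fix i j assume ij: "i \<in> {..<n}" "j \<in> {..<n}" "\<iota> (c i) * \<alpha> ^ i \<noteq> 0" "\<iota> (c j) * \<alpha> ^ j \<noteq> 0"
    "v (\<iota> (c i) * \<alpha> ^ i) = v (\<iota> (c j) * \<alpha> ^ j)"
  then have "c i \<noteq> 0" "c j \<noteq> 0" by auto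
  then have "int n * w (c i) + int i = int n * w (c j) + int j" using ij(5) by (simp add: v_term)
  then show "i = j" using int_digits_unique[of i n j "w (c i)" "w (c j)"] ij(1,2) by simp
qed (auto simp: term_mem vge_term)

lemma lincomb_zero:
  assumes "(\<Sum>i<n. \<iota> (c i) * \<alpha> ^ i) = 0" "i < n"
  shows "c i = 0"
proof (rule ccontr)
  assume "c i \<noteq> 0"
  have "val_ge v (int n * w (c i) + int i + 1) (\<Sum>i<n. \<iota> (c i) * \<alpha> ^ i)"
    unfolding assms(1) by simp
  then show False unfolding vge_lincomb using assms(2) \<open>c i \<noteq> 0\<close> by force
qed

lemma inj_powers: "inj (\<lambda>i. \<alpha> ^ i)"
proof (rule injI)
  fix i j assume "\<alpha> ^ i = \<alpha> ^ j"
  then have "v (\<alpha> ^ i) = v (\<alpha> ^ j)" by simp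
  then show "i = j" using unifD by (simp add: V.v_power)
qed

definition powers :: "'a set" where "powers = (\<lambda>i. \<alpha> ^ i) ` {..<n}"

lemma finite_powers: "finite powers" "card powers = n"
  unfolding powers_def using inj_powers by (auto simp: card_image inj_on_def)

lemma sum_powers: "(\<Sum>x\<in>powers. h x) = (\<Sum>i<n. h (\<alpha> ^ i))"
  unfolding powers_def using inj_powers by (subst sum.reindex) (auto simp: inj_on_def)

lemma independent_powers: "vs.independent powers"
proof (rule vs.independent_if_scalars_zero)
  fix f x assume f: "(\<Sum>x\<in>powers. \<iota> (f x) * x) = 0" "x \<in> powers"
  from f(1) have "(\<Sum>i<n. \<iota> (f (\<alpha> ^ i)) * \<alpha> ^ i) = 0" by (simp only: sum_powers)
  then show "f x = 0"
    using lincomb_zero[of "\<lambda>i. f (\<alpha> ^ i)"] f(2) by (auto simp: powers_def)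
qed (rule finite_powers)

lemma powers_subset: "powers \<subseteq> E"
  unfolding powers_def using unifD by (auto intro: V.power_mem)

text \<open>The \<open>n\<close> powers are independent and \<open>n\<close> is the degree, so an
  element outside their span would give \<open>n + 1\<close> independent vectors.\<close>

lemma span_powers: "vs.span powers = E"
proof
  have "vs.subspace E"
    by (rule vs.subspaceI) (auto intro: V.mem_intros base_mem)
  then show "vs.span powers \<subseteq> E" using powers_subset by (rule vs.span_minimal[rotated])
  obtain B where B: "B \<subseteq> E" "vs.independent B" "E \<subseteq> vs.span B" "card B = vs.dim E"
    using vs.basis_exists by blast
  have cB: "card B = n" using B(4) deg by (simp add: ext_degree_def)
  \<comment> \<open>An infinite set has \<open>card\<close> 0, so the positive degree makes the
    basis finite.\<close>
  then have fB: "finite B" using n_pos by (intro card_ge_0_finite) simp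
  show "E \<subseteq> vs.span powers"
  proof (rule ccontr)
    assume "\<not> E \<subseteq> vs.span powers"
    then obtain x where x: "x \<in> E" "x \<notin> vs.span powers" by blast
    then have "vs.independent (insert x powers)" using independent_powers by (intro vs.independent_insertI)
    moreover have "insert x powers \<subseteq> vs.span B" using x powers_subset B by blast
    ultimately have "card (insert x powers) \<le> n" using vs.independent_span_bound[OF fB] cB by metis
    moreover have "x \<notin> powers" using x vs.span_superset by blast
    ultimately show False using finite_powers by simp
  qed
qed

definition power_list :: "'a list" where "power_list = map (\<lambda>i. \<alpha> ^ i) [0..<n]"

lemma set_power_list: "set power_list = powers"
  unfolding power_list_def powers_def by auto

lemma ext_basis_power_list: "ext_basis \<iota> E power_list"
  unfolding ext_basis_def set_power_list
  using span_powers independent_powers inj_powers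
  by (auto simp: power_list_def distinct_map inj_on_def)

definition crd :: "'a \<Rightarrow> nat \<Rightarrow> 'k" where
  "crd x i = vs.representation powers x (\<alpha> ^ i)"

lemma crd_sum:
  assumes "x \<in> E"
  shows "(\<Sum>i<n. \<iota> (crd x i) * \<alpha> ^ i) = x"
proof -
  have "(\<Sum>b\<in>powers. \<iota> (vs.representation powers x b) * b) = x"
    by (rule vs.sum_representation_eq[OF independent_powers _ finite_powers(1) subset_refl])
       (simp add: span_powers assms)
  then show ?thesis unfolding crd_def by (simp only: sum_powers)
qed

lemma crd_unique: "i < n \<Longrightarrow> crd (\<Sum>i<n. \<iota> (c i) * \<alpha> ^ i) i = c i"
proof -
  let ?x = "\<Sum>i<n. \<iota> (c i) * \<alpha> ^ i"
  assume i: "i < n"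
  have "(\<Sum>i<n. \<iota> (crd ?x i - c i) * \<alpha> ^ i) = 0"
    using crd_sum[OF lincomb_mem[of c "{..<n}"]] by (simp add: hom_distribs algebra_simps sum_subtractf)
  from lincomb_zero[OF this i] show ?thesis by simp
qed

lemma crd_scale: "x \<in> E \<Longrightarrow> crd (\<iota> c * x) i = c * crd x i"
  unfolding crd_def using vs.representation_scale[OF independent_powers, of x c] span_powers by simp

lemma crd_sum_distrib: "(\<And>j. j \<in> J \<Longrightarrow> f j \<in> E) \<Longrightarrow> crd (sum f J) i = (\<Sum>j\<in>J. crd (f j) i)"
  unfolding crd_def using vs.representation_sum[OF independent_powers, of J f] span_powers by simp

lemma crd_power: "i < n \<Longrightarrow> j < n \<Longrightarrow> crd (\<alpha> ^ i) j = (if i = j then 1 else 0)"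
proof -
  assume ij: "i < n" "j < n"
  have "(\<Sum>j<n. \<iota> (if i = j then 1 else 0) * \<alpha> ^ j) = (\<Sum>j<n. if i = j then \<alpha> ^ j else 0)"
    by (rule sum.cong) auto
  also have "\<dots> = \<alpha> ^ i" using ij by simp
  finally show ?thesis using crd_unique[of j "\<lambda>j. if i = j then 1 else 0"] ij by simp
qed

lemma vge_crd: "x \<in> E \<Longrightarrow> val_ge v k x \<longleftrightarrow> (\<forall>i<n. crd x i = 0 \<or> k \<le> int n * w (crd x i) + int i)"
  using vge_lincomb[of k "crd x"] crd_sum by simp

text \<open>The valuation ring of \<open>E\<close> is generated by \<alpha> over that of the base
  field: for 0 \<le> i < n, n a + i is nonnegative exactly when a is.\<close>

lemma vge0_crd: "x \<in> E \<Longrightarrow> val_ge v 0 x \<longleftrightarrow> (\<forall>i<n. val_ge w 0 (crd x i))"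
proof -
  have "0 \<le> int n * a + int i \<longleftrightarrow> 0 \<le> a" if "i < n" for a i
  proof
    assume "0 \<le> int n * a + int i"
    show "0 \<le> a"
    proof (rule ccontr)
      assume "\<not> 0 \<le> a"
      then have "int n * a \<le> int n * (-1)" by (intro mult_left_mono) auto
      then show False using that \<open>0 \<le> int n * a + int i\<close> by simp
    qed
  qed simp
  then show "x \<in> E \<Longrightarrow> ?thesis" by (simp only: vge_crd) (simp add: val_ge_def)
qed

text \<open>Every term has valuation at least \<open>n\<close>, which puts each \<open>c i\<close>
  into the maximal ideal, and then only the term of index 0 can attain \<open>n\<close>. This is
  where Eisenstein polynomials come from: first the minimal polynomial of \<alpha>, later all
  polynomials with a small value at \<alpha>.\<close>

lemma lincomb_val_n:
  assumes x: "x = (\<Sum>i<n. \<iota> (c i) * \<alpha> ^ i)" and v: "x \<noteq> 0" "v x = int n"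
  shows "i < n \<Longrightarrow> val_ge w 1 (c i)" and "c 0 \<noteq> 0" "w (c 0) = 1"
proof -
  have "val_ge v (int n) x" using v by (simp add: val_ge_def)
  then have A: "c i = 0 \<or> int n \<le> int n * w (c i) + int i" if "i < n" for i
    using vge_lincomb[of "int n" c] that by (simp add: x)
  have B: "c i = 0 \<or> w (c i) \<ge> 1" if "i < n" for i
  proof (rule ccontr)
    assume C: "\<not> ?thesis"
    then have "int n * w (c i) \<le> int n * 0" by (intro mult_left_mono) auto
    then show False using A[OF that] C that by simp
  qed
  then show "i < n \<Longrightarrow> val_ge w 1 (c i)" by (auto simp: val_ge_def)
  have "\<not> val_ge v (int n + 1) x" using v by (simp add: val_ge_def)
  then obtain i where i: "i < n" "c i \<noteq> 0" "int n * w (c i) + int i < int n + 1"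
    using vge_lincomb[of "int n + 1" c] x by force
  have "int n * 1 \<le> int n * w (c i)" using B[OF i(1)] i(2) by (intro mult_left_mono) auto
  then have "i = 0 \<and> int n * w (c i) = int n" using i(3) by linarith
  then show "c 0 \<noteq> 0" "w (c 0) = 1" using i n_pos by auto
qed

lemma crd_base: "i < n \<Longrightarrow> crd (\<iota> c) i = (if i = 0 then c else 0)"
  using crd_scale[of "\<alpha> ^ 0" c i] crd_power[of 0 i] n_pos V.one_mem by auto

lemma crd_diff: "x \<in> E \<Longrightarrow> y \<in> E \<Longrightarrow> crd (x - y) i = crd x i - crd y i"
  unfolding crd_def using vs.representation_diff[OF independent_powers] span_powers by simp

text \<open>Convergence is transported to the base field through the coordinates, where completeness
  supplies the limits.\<close>

lemma complete_E:
  assumes s: "\<And>k. s k \<in> E" and step: "\<And>k. val_ge v (int k) (s (Suc k) - s k)"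
  shows "\<exists>l\<in>E. \<forall>k. val_ge v (int k) (l - s k)"
proof -
  have C: "val_ge v (int k) (s m - s k)" if "k \<le> m" for k m
    using that
  proof (induction rule: dec_induct)
    case (step m)
    have "val_ge v (int k) ((s (Suc m) - s m) + (s m - s k))"
      using step s assms(2)[of m] by (intro V.vge_add V.diff_mem) (auto elim: V.vge_mono)
    then show ?case by simp
  qed simp
  have "val_Cauchy w (\<lambda>m. crd (s m) i)" if i: "i < n" for i
    unfolding val_Cauchy_def
  proof (intro allI)
    fix K :: int
    \<comment> \<open>The coordinate of index \<open>i\<close> loses at most \<open>i < n\<close> in
      the valuation estimate; the summand \<open>n\<close> absorbs it.\<close>
    define N where "N = nat (int n * K + int n)"
    have "val_ge w K (crd (s m) i - crd (s m') i)" if m: "m \<ge> N" "m' \<ge> N" for m m'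
    proof -
      have "val_ge v (int N) ((s m - s N) - (s m' - s N))"
        by (rule V.vge_diff) (use C m s V.diff_mem in auto)
      then have "val_ge v (int N) (s m - s m')" by simp
      then have "crd (s m - s m') i = 0 \<or> int N \<le> int n * w (crd (s m - s m') i) + int i"
        using vge_crd[of "s m - s m'"] s i V.diff_mem by blast
      then have "crd (s m - s m') i = 0 \<or> int n * K < int n * w (crd (s m - s m') i)"
        using i unfolding N_def by linarith
      then have "val_ge w K (crd (s m - s m') i)" using n_pos by (auto simp: val_ge_def)
      then show ?thesis using crd_diff s by simp
    qed
    then show "\<exists>N. \<forall>m\<ge>N. \<forall>m'\<ge>N. val_ge w K (crd (s m) i - crd (s m') i)" by blast
  qed
  then have "\<exists>l. val_tendsto w (\<lambda>m. crd (s m) i) l" if "i < n" for i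
    using complete that by blast
  then obtain L where L: "\<And>i. i < n \<Longrightarrow> val_tendsto w (\<lambda>m. crd (s m) i) (L i)" by metis
  define l where "l = (\<Sum>i<n. \<iota> (L i) * \<alpha> ^ i)"
  have lE: "l \<in> E" unfolding l_def by (rule lincomb_mem)
  have cl: "crd l i = L i" if "i < n" for i using crd_unique that by (simp add: l_def)
  have "val_ge v (int k) (l - s k)" for k
  proof -
    have "\<exists>N. \<forall>m\<ge>N. val_ge w (int k) (crd (s m) i - L i)" if "i < n" for i
      using L[OF that] unfolding val_tendsto_def by blast
    then obtain N where N: "\<And>i m. i < n \<Longrightarrow> m \<ge> N i \<Longrightarrow> val_ge w (int k) (crd (s m) i - L i)" by metis
    define m where "m = max k (\<Sum>i<n. N i)"
    have "N i \<le> m" if "i < n" for i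
      using member_le_sum[of i "{..<n}" N] that by (simp add: m_def)
    then have "val_ge w (int k) (crd (s m - l) i)" if "i < n" for i
      using N that cl s lE by (simp add: crd_diff)
    moreover have "int k \<le> int n * a + int i" if "int k \<le> a" for a i
    proof -
      have "1 * a \<le> int n * a" using n_pos that by (intro mult_right_mono) auto
      then show ?thesis using that by simp
    qed
    ultimately have "val_ge v (int k) (s m - l)"
      using vge_crd[of "s m - l"] s lE V.diff_mem by (auto simp: val_ge_def)
    moreover have "val_ge v (int k) (s m - s k)" using C by (simp add: m_def)
    ultimately have "val_ge v (int k) ((s m - s k) - (s m - l))"
      by (intro V.vge_diff[OF V.diff_mem V.diff_mem] s lE)
    then show ?thesis by simp
  qed
  then show ?thesis using lE by blast
qed

text \<open>As i < n, the bound n L for the valuation of the \<open>i\<close>-th term amounts to the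
  bound \<open>L\<close> for its coefficient, so precision \<open>L\<close> on coefficients is
  precision n L in \<open>E\<close>.\<close>

lemma complete_system_lincomb:
  assumes U: "W.complete_system L U"
  shows "V.complete_system (n * L) {\<Sum>i<n. \<iota> (a i) * \<alpha> ^ i | a. \<forall>i<n. a i \<in> U}" (is "V.complete_system _ ?S")
proof (rule V.complete_systemI)
  note U1 = W.complete_systemD[OF U]
  have iff: "int (n * L) \<le> int n * x + int i \<longleftrightarrow> int L \<le> x" if "i < n" for x i
  proof
    assume "int (n * L) \<le> int n * x + int i"
    then have "int n * int L < int n * (x + 1)" using that by (simp add: algebra_simps)
    then show "int L \<le> x" using n_pos by simp
  next
    assume "int L \<le> x"
    then have "int n * int L \<le> int n * x" by (intro mult_left_mono) auto
    then show "int (n * L) \<le> int n * x + int i" by simp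
  qed
  {
    fix u assume "u \<in> ?S"
    then obtain a where a: "u = (\<Sum>i<n. \<iota> (a i) * \<alpha> ^ i)" "\<And>i. i < n \<Longrightarrow> a i \<in> U" by blast
    have "val_ge v 0 u" unfolding a(1)
      by (intro V.vge_sum conjI term_mem V.vge_mult0 base_mem V.power_mem V.vge_power0 unifD unif_vge0[OF unif])
         (use a(2) U1(2) vge_base0 in auto)
    then show "u \<in> E \<and> val_ge v 0 u" using a lincomb_mem by simp
  }
  {
    fix x assume x: "x \<in> E" "val_ge v 0 x"
    then have "\<exists>u\<in>U. val_ge w (int L) (crd x i - u)" if "i < n" for i
      using vge0_crd[of x] U1(3) that by blast
    then obtain a where a: "\<And>i. i < n \<Longrightarrow> a i \<in> U \<and> val_ge w (int L) (crd x i - a i)" by metis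
    let ?u = "\<Sum>i<n. \<iota> (a i) * \<alpha> ^ i"
    have "crd (x - ?u) i = crd x i - a i" if "i < n" for i
      using crd_diff[OF x(1) lincomb_mem] crd_unique that by simp
    then have "val_ge v (int (n * L)) (x - ?u)"
      using a iff x lincomb_mem[of a "{..<n}"] by (subst vge_crd) (auto simp: val_ge_def intro: V.diff_mem)
    then show "\<exists>u\<in>?S. val_ge v (int (n * L)) (x - u)" using a by blast
  }
  {
    fix x y assume "x \<in> ?S" "y \<in> ?S" and ge: "val_ge v (int (n * L)) (x - y)"
    then obtain a b where a: "x = (\<Sum>i<n. \<iota> (a i) * \<alpha> ^ i)" "\<And>i. i < n \<Longrightarrow> a i \<in> U"
      and b: "y = (\<Sum>i<n. \<iota> (b i) * \<alpha> ^ i)" "\<And>i. i < n \<Longrightarrow> b i \<in> U" by blast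
    have "crd (x - y) i = a i - b i" if "i < n" for i
      using crd_diff[OF lincomb_mem lincomb_mem] crd_unique that by (simp add: a b)
    then have "val_ge w (int L) (a i - b i)" if "i < n" for i
      using ge iff[OF that] vge_crd[of "x - y"] lincomb_mem that V.diff_mem
      unfolding a(1) b(1) by (auto simp: val_ge_def)
    then have "a i = b i" if "i < n" for i using U1(4) a(2) b(2) that by blast
    then show "x = y" unfolding a(1) b(1) by (intro sum.cong) auto
  }
qed

lemma min_poly_ex: "\<exists>g. eisenstein w n g \<and> evl g \<alpha> = 0"
proof -
  let ?c = "\<lambda>i. - crd (\<alpha> ^ n) i"
  have nE: "\<alpha> ^ n \<in> E" using unifD by (intro V.power_mem)
  have vn: "v (\<alpha> ^ n) = int n" "\<alpha> ^ n \<noteq> 0" using unifD by (simp_all add: V.v_power)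
  note L = lincomb_val_n[OF crd_sum[OF nE, symmetric] vn(2,1)]
  have "eisenstein w n (monic_poly n ?c)"
    using L n_pos by (auto simp: eisenstein_def degree_monic_poly coeff_monic_poly W.vge_uminus W.v_uminus)
  moreover have "evl (monic_poly n ?c) \<alpha> = 0"
    by (subst evl_monic[of _ n])
       (simp_all add: degree_monic_poly coeff_monic_poly hom_distribs sum_negf crd_sum[OF nE])
  ultimately show ?thesis by blast
qed

lemma evl_eq_0_imp_0: "degree h < n \<Longrightarrow> evl h \<alpha> = 0 \<Longrightarrow> h = 0"
  using lincomb_zero[of "coeff h"] evl_sum_lessThan[of h n \<alpha>]
  by (intro poly_eqI) (metis coeff_0 coeff_eq_0 le_less_trans not_le)

end

section \<open>The discriminant\<close>

text \<open>Each f(k) occurs once for every j < k, hence k times; in \<open>sum_power_dual\<close>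
  this produces the factors of the derivative.\<close>

lemma sum_upper_triangle:
  fixes f :: "nat \<Rightarrow> 'a::comm_semiring_1"
  shows "(\<Sum>j<n. \<Sum>k\<in>{j<..n}. f k) = (\<Sum>i<n. of_nat (Suc i) * f (Suc i))"
proof (induction n)
  case (Suc n)
  have "(\<Sum>j<n. \<Sum>k\<in>{j<..Suc n}. f k) = (\<Sum>j<n. f (Suc n) + (\<Sum>k\<in>{j<..n}. f k))"
  proof (rule sum.cong)
    fix j assume "j \<in> {..<n}"
    then have "{j<..Suc n} = insert (Suc n) {j<..n}" by auto
    then show "(\<Sum>k\<in>{j<..Suc n}. f k) = f (Suc n) + (\<Sum>k\<in>{j<..n}. f k)" by simp
  qed simp
  moreover have "{n<..Suc n} = {Suc n}" by auto
  ultimately show ?case by (simp add: sum.distrib Suc algebra_simps)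
qed simp

lemma signof_cases: "signof p = (1::'a::ring_1) \<or> signof p = (- 1 :: 'a)"
  by (auto simp: sign_def)

section \<open>Determinants and characteristic polynomials over the valuation ring\<close>

context local_field
begin

lemma vge_det_0:
  assumes "A \<in> carrier_mat n n" "\<And>i j. i < n \<Longrightarrow> j < n \<Longrightarrow> val_ge w 0 (A $$ (i, j))"
  shows "val_ge w 0 (det A)"
proof -
  have prod: "val_ge w 0 (prod f I)" if "\<And>i. i \<in> I \<Longrightarrow> val_ge w 0 (f i)" for f :: "nat \<Rightarrow> 'k" and I
    using that by (induction I rule: infinite_finite_induct) (auto intro: W.vge_mult0 W.vge_one)
  show ?thesis unfolding det_def'[OF assms(1)]
  proof (rule W.vge_sum, rule conjI, simp, rule W.vge_mult0)
    fix p assume p: "p \<in> {p. p permutes {0..<n}}"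
    show "val_ge w 0 (signof p :: 'k)"
      using signof_cases[of p, where ?'a = 'k] by (auto simp: W.vge_uminus W.vge_one)
    show "val_ge w 0 (\<Prod>i = 0..<n. A $$ (i, p i))"
      using p by (intro prod assms(2)) (auto dest: permutes_in_image)
  qed auto
qed

lemma integral_char_poly:
  assumes A: "A \<in> carrier_mat n n" and ge: "\<And>i j. i < n \<Longrightarrow> j < n \<Longrightarrow> val_ge w 0 (A $$ (i, j))"
  shows "W.integral_poly (char_poly A)"
  unfolding char_poly_def det_def'[OF char_poly_matrix_closed[OF A]]
proof (intro W.integral_poly_sum W.integral_poly_mult W.integral_poly_prod)
  fix p assume p: "p \<in> {p. p permutes {0..<n}}"
  show "W.integral_poly (signof p)"
    using signof_cases[of p, where ?'a = "'k poly"] W.integral_poly_one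
    by (auto simp: W.integral_poly_def W.vge_uminus)
  fix i assume i: "i \<in> {0..<n}"
  then have "p i < n" using p by (auto dest: permutes_in_image)
  then show "W.integral_poly (char_poly_matrix A $$ (i, p i))"
    using i A ge[of i "p i"]
    by (auto simp: char_poly_matrix_def W.integral_poly_def W.vge_uminus W.vge_one
        W.vge_diff coeff_pCons split: nat.splits)
qed

text \<open>Exactly one term of the Leibniz expansion has minimal valuation.\<close>

lemma det_unique_min:
  fixes d :: int
  assumes A: "A \<in> carrier_mat n n" and n: "n > 0"
    and ge: "\<And>i j. i < n \<Longrightarrow> j < n \<Longrightarrow> A $$ (i, j) = 0 \<or>
      d + int i + int j \<le> int n * w (A $$ (i, j)) + (int n - 1)"
    and eq: "\<And>i j. i < n \<Longrightarrow> j < n \<Longrightarrow> int n dvd d + int i + int j + 1 \<Longrightarrow> A $$ (i, j) \<noteq> 0 \<and>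
      int n * w (A $$ (i, j)) + (int n - 1) = d + int i + int j"
  shows "det A \<noteq> 0 \<and> w (det A) = d"
proof -
  \<comment> \<open>In row \<open>i\<close> the hypotheses give equality in the column
    \<open>j\<close> with d + i + j + 1 divisible by \<open>n\<close>. The symmetry of this
    condition in \<open>i\<close> and \<open>j\<close> makes \<open>s\<close> an involution, and its
    Leibniz term is the minimal one.\<close>
  define s where "s i = (if i < n then nat ((- 1 - d - int i) mod int n) else i)" for i
  have s: "s i < n \<and> int (s i) = (- 1 - d - int i) mod int n" if "i < n" for i
    using that n by (simp add: s_def nat_less_iff)
  have s_iff: "j = s i \<longleftrightarrow> int n dvd d + int i + int j + 1" if "i < n" "j < n" for i j
  proof -
    have "j = s i \<longleftrightarrow> int j = (- 1 - d - int i) mod int n" using s[OF that(1)] by linarith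
    also have "\<dots> \<longleftrightarrow> int j mod int n = (- 1 - d - int i) mod int n" using that by simp
    also have "\<dots> \<longleftrightarrow> int n dvd int j - (- 1 - d - int i)" by (rule mod_eq_dvd_iff)
    also have "int j - (- 1 - d - int i) = d + int i + int j + 1" by simp
    finally show ?thesis .
  qed
  have ss: "s (s i) = i" if "i < n" for i
    using s_iff[of i "s i"] s_iff[of "s i" i] s[OF that] that by (simp add: algebra_simps)
  have s_perm: "s permutes {0..<n}"
  proof (rule bij_imp_permutes)
    show "bij_betw s {0..<n} {0..<n}"
      by (rule bij_betw_byWitness[of _ s]) (use s ss in auto)
  qed (simp add: s_def)
  let ?P = "{p. p permutes {0..<n}}"
  define t where "t p = signof p * (\<Prod>i = 0..<n. A $$ (i, p i))" for p
  have det: "det A = sum t ?P" unfolding t_def by (rule det_def'[OF A])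
  \<comment> \<open>\<open>e p i\<close> is the slack of the hypothesis \<open>ge\<close> at row
    \<open>i\<close>. Since the \<open>i\<close> and the \<open>p i\<close> both sum to n (n - 1) /
    2, the total slack is \<open>n\<close> times the excess of w(t p) over \<open>d\<close>.\<close>
  define e where "e p i = int n * w (A $$ (i, p i)) + (int n - 1) - (d + int i + int (p i))" for p i
  have key: "t p \<noteq> 0 \<and> (\<Sum>i = 0..<n. e p i) = int n * (w (t p) - d)"
    if p: "p permutes {0..<n}" and nz: "\<And>i. i < n \<Longrightarrow> A $$ (i, p i) \<noteq> 0" for p
  proof -
    have pr: "(\<Prod>i = 0..<n. A $$ (i, p i)) \<noteq> 0" using nz by simp
    have "w (t p) = w (\<Prod>i = 0..<n. A $$ (i, p i))"
      using signof_cases[of p, where ?'a = 'k] by (auto simp: t_def W.v_uminus)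
    also have "\<dots> = (\<Sum>i = 0..<n. w (A $$ (i, p i)))" using W.v_prod[of "{0..<n}" "\<lambda>i. A $$ (i, p i)"] nz by simp
    finally have wt: "w (t p) = (\<Sum>i = 0..<n. w (A $$ (i, p i)))" .
    have "(\<Sum>i = 0..<n. int (p i)) = (\<Sum>i = 0..<n. int i)"
      using sum.permute[OF p, of int] by (simp add: o_def)
    moreover have "2 * (\<Sum>i = 0..<n. int i) = int n * (int n - 1)"
      by (induction n) (auto simp: algebra_simps)
    ultimately have "(\<Sum>i = 0..<n. e p i) = int n * (w (t p) - d)"
      by (simp add: e_def sum.distrib sum_subtractf wt sum_distrib_left algebra_simps)
    then show ?thesis using pr signof_cases[of p, where ?'a = 'k] by (auto simp: t_def)
  qed
  have nz: "A $$ (i, s i) \<noteq> 0" "e s i = 0" if "i < n" for i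
    using eq[OF that, of "s i"] s_iff[OF that, of "s i"] s[OF that] by (auto simp: e_def)
  have ts: "t s \<noteq> 0" "w (t s) = d" using key[OF s_perm nz(1)] nz(2) n by auto
  have "sum t ?P \<noteq> 0 \<and> w (sum t ?P) = w (t s)"
  proof (rule W.v_sum_unique_min)
    fix p assume p: "p \<in> ?P" "p \<noteq> s"
    show "val_ge w (w (t s) + 1) (t p)"
    proof (cases "\<forall>i<n. A $$ (i, p i) \<noteq> 0")
      case True
      have pn: "p i < n" if "i < n" for i using p that by (auto dest: permutes_in_image)
      obtain i where i: "i < n" "p i \<noteq> s i"
      proof -
        have "\<exists>i. p i \<noteq> s i" using p(2) by blast
        moreover have "p i = s i" if "\<not> i < n" for i
          using p(1) s_perm that by (auto simp: permutes_def)
        ultimately show ?thesis using that by blast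
      qed
      have e0: "e p i \<ge> 0" if "i < n" for i
        using ge[OF that pn[OF that]] True that by (auto simp: e_def)
      have "e p i \<noteq> 0"
      proof
        assume "e p i = 0"
        then have "d + int i + int (p i) + 1 = int n * (w (A $$ (i, p i)) + 1)"
          by (simp add: e_def algebra_simps)
        then show False using s_iff[OF i(1) pn[OF i(1)]] i(2) by simp
      qed
      then have "(\<Sum>i = 0..<n. e p i) > 0" using e0 i(1) by (intro sum_pos2[of _ i]) (auto simp: less_le)
      then have "w (t p) > d" using key[of p] p True by (auto simp: zero_less_mult_iff)
      then show ?thesis by (simp add: val_ge_def ts)
    next
      case False
      then have "t p = 0" by (auto simp: t_def intro!: prod_zero)
      then show ?thesis by simp
    qed
  qed (use s_perm ts in \<open>auto simp: finite_permutations\<close>)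
  then show ?thesis using det ts by simp
qed

end

section \<open>Euler's dual basis, the trace form and the discriminant\<close>

locale generated_ext = uniformized_ext w \<iota> E v n \<alpha>
  for w :: "'k::field \<Rightarrow> int" and \<iota> :: "'k \<Rightarrow> 'a::field" and E v n \<alpha> +
  fixes g :: "'k poly"
  assumes g: "eisenstein w n g" and g_root: "evl g \<alpha> = 0"
begin

lemma gD: "degree g = n" "coeff g n = 1"
  using g by (auto simp: eisenstein_def)

text \<open>A twisted trace: by \<open>euler_trace_formula\<close>, \<open>lam y\<close> is the
  trace of y / g'(\<alpha>) whenever g'(\<alpha>) is nonzero. Being a coordinate, it is directly
  comparable with the valuation.\<close>

definition lam :: "'a \<Rightarrow> 'k" where "lam x = crd x (n - 1)"

text \<open>These are the coefficients of \<open>g(X) / (X - \<alpha>)\<close>; they form the basis dual to the powers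
  of \<open>\<alpha>\<close> with respect to the bilinear form \<open>lam (x * y)\<close>.\<close>

definition dual :: "nat \<Rightarrow> 'a" where
  "dual j = (\<Sum>k\<in>{j<..n}. \<iota> (coeff g k) * \<alpha> ^ (k - 1 - j))"

lemma dual_mem: "dual j \<in> E"
  unfolding dual_def by (intro V.sum_mem term_mem)

lemma lam_sum: "(\<And>j. j \<in> J \<Longrightarrow> f j \<in> E) \<Longrightarrow> lam (\<Sum>j\<in>J. \<iota> (c j) * f j) = (\<Sum>j\<in>J. c j * lam (f j))"
  unfolding lam_def by (subst crd_sum_distrib) (auto intro: V.mem_intros base_mem simp: crd_scale)

lemma lam_power: "i < n \<Longrightarrow> lam (\<alpha> ^ i) = (if i = n - 1 then 1 else 0)"
  unfolding lam_def using crd_power[of i "n - 1"] n_pos by simp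

lemma power_mem: "\<alpha> ^ i \<in> E"
  using unifD by (intro V.power_mem)

text \<open>For \<open>i \<le> j\<close> all exponents are below \<open>n\<close>, and
  \<open>n - 1\<close> is reached only by the leading coefficient with \<open>i = j\<close>. For
  \<open>i > j\<close> the equation g(\<alpha>) = 0 replaces the upper part of \<open>g\<close> by
  minus the lower part, and all exponents stay below \<open>n - 1\<close>.\<close>

lemma lam_dual:
  assumes "i < n" "j < n"
  shows "lam (\<alpha> ^ i * dual j) = (if i = j then 1 else 0)"
proof (cases "i \<le> j")
  case True
  have "\<alpha> ^ i * dual j = (\<Sum>k\<in>{j<..n}. \<iota> (coeff g k) * \<alpha> ^ (i + (k - 1 - j)))"
    unfolding dual_def sum_distrib_left by (rule sum.cong) (simp_all only: power_add mult_ac)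
  then have "lam (\<alpha> ^ i * dual j) = (\<Sum>k\<in>{j<..n}. coeff g k * lam (\<alpha> ^ (i + (k - 1 - j))))"
    by (simp only: lam_sum[OF power_mem])
  also have "\<dots> = (\<Sum>k\<in>{j<..n}. if k = n then (if i = j then 1 else 0) else 0)"
  proof (rule sum.cong)
    fix k assume k: "k \<in> {j<..n}"
    have "i + (k - 1 - j) < n" "i + (k - 1 - j) = n - 1 \<longleftrightarrow> k = n \<and> i = j"
      using k True assms by auto
    then show "coeff g k * lam (\<alpha> ^ (i + (k - 1 - j))) = (if k = n then (if i = j then 1 else 0) else 0)"
      by (simp add: lam_power gD)
  qed simp
  also have "\<dots> = (if i = j then 1 else 0)" using assms by simp
  finally show ?thesis .
next
  case False
  have "0 = (\<Sum>k\<le>n. \<iota> (coeff g k) * \<alpha> ^ k)"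
    using g_root evl_sum_lessThan[of g "Suc n" \<alpha>] gD by (simp add: lessThan_Suc_atMost)
  also have "\<dots> = (\<Sum>k\<le>j. \<iota> (coeff g k) * \<alpha> ^ k) + (\<Sum>k\<in>{j<..n}. \<iota> (coeff g k) * \<alpha> ^ k)"
  proof -
    have "{..n} = {..j} \<union> {j<..n}" using assms by auto
    then show ?thesis by (simp add: sum.union_disjoint[symmetric] ivl_disj_int)
  qed
  finally have rel: "(\<Sum>k\<in>{j<..n}. \<iota> (coeff g k) * \<alpha> ^ k) = (\<Sum>k\<le>j. \<iota> (- coeff g k) * \<alpha> ^ k)"
    by (simp add: hom_distribs sum_negf eq_neg_iff_add_eq_0 add.commute)
  have "\<alpha> ^ i * dual j = \<alpha> ^ (i - 1 - j) * (\<Sum>k\<in>{j<..n}. \<iota> (coeff g k) * \<alpha> ^ k)"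
    unfolding dual_def sum_distrib_left
  proof (rule sum.cong)
    fix k assume "k \<in> {j<..n}"
    then have "i + (k - 1 - j) = (i - 1 - j) + k" using False by auto
    then have "\<alpha> ^ i * \<alpha> ^ (k - 1 - j) = \<alpha> ^ (i - 1 - j) * \<alpha> ^ k" by (metis power_add)
    then show "\<alpha> ^ i * (\<iota> (coeff g k) * \<alpha> ^ (k - 1 - j)) = \<alpha> ^ (i - 1 - j) * (\<iota> (coeff g k) * \<alpha> ^ k)"
      by (metis mult.left_commute)
  qed simp
  also have "\<dots> = (\<Sum>k\<le>j. \<iota> (- coeff g k) * \<alpha> ^ (i - 1 - j + k))"
    unfolding rel sum_distrib_left by (simp add: power_add algebra_simps)
  finally have "lam (\<alpha> ^ i * dual j) = (\<Sum>k\<le>j. - coeff g k * lam (\<alpha> ^ (i - 1 - j + k)))"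
    by (simp only: lam_sum[OF power_mem])
  also have "\<dots> = 0"
  proof (rule sum.neutral, rule ballI)
    fix k assume "k \<in> {..j}"
    then have "i - 1 - j + k < n - 1" using False assms by auto
    then show "- coeff g k * lam (\<alpha> ^ (i - 1 - j + k)) = 0" using lam_power by simp
  qed
  finally show ?thesis using False by simp
qed

lemma crd_dual:
  assumes "x \<in> E" "j < n"
  shows "crd x j = lam (x * dual j)"
proof -
  have "x * dual j = (\<Sum>i<n. \<iota> (crd x i) * (\<alpha> ^ i * dual j))"
    by (subst crd_sum[OF assms(1), symmetric]) (simp add: sum_distrib_right mult.assoc)
  then have "lam (x * dual j) = (\<Sum>i<n. crd x i * lam (\<alpha> ^ i * dual j))"
    using lam_sum[of "{..<n}" "\<lambda>i. \<alpha> ^ i * dual j"] power_mem dual_mem V.mult_mem by simp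
  also have "\<dots> = (\<Sum>i<n. if i = j then crd x i else 0)"
    by (rule sum.cong) (use lam_dual assms in auto)
  finally show ?thesis using assms by simp
qed

definition different :: 'a where "different = evl (pderiv g) \<alpha>"

lemma different_mem: "different \<in> E"
  unfolding different_def using unifD by (intro evl_mem)

text \<open>A separable irreducible \<open>f\<close> vanishing at \<alpha> is a constant multiple of
  \<open>g\<close>, because its remainder modulo \<open>g\<close> vanishes at \<alpha> and has
  degree below \<open>n\<close>. For the same degree reason g'(\<alpha>) = 0 would give g' = 0, so
  \<open>f\<close> would be coprime to 0 and hence a unit.\<close>

lemma different_nonzero:
  assumes "separable_over \<iota> \<alpha>"
  shows "different \<noteq> 0"
proof
  assume D: "different = 0"
  interpret mp: map_poly_comm_ring_hom \<iota> ..
  obtain f where f: "irreducible f" "separable_poly f" "evl f \<alpha> = 0"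
    using assms unfolding separable_over_def by blast
  have g0: "g \<noteq> 0" using gD by auto
  have "evl f \<alpha> = evl (f div g * g + f mod g) \<alpha>" by simp
  also have "\<dots> = evl (f mod g) \<alpha>" using g_root by (simp only: hom_distribs poly_add poly_mult) simp
  finally have "f mod g = 0"
    using f(3) evl_eq_0_imp_0 degree_mod_less[OF g0, of f] gD n_pos by auto
  then have fg: "f = f div g * g" by (metis add.right_neutral div_mult_mod_eq)
  have "\<not> is_unit g" using gD n_pos g0 by (auto simp: is_unit_iff_degree)
  then have "is_unit (f div g)" using irreducibleD[OF f(1) fg] by blast
  then have "degree (f div g) = 0" by (auto simp: is_unit_iff_degree)
  then obtain c where c: "f div g = [:c:]" by (rule degree_eq_zeroE)
  have "degree (pderiv g) < n" using degree_pderiv_le[of g] gD n_pos by simp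
  then have "pderiv g = 0" using D evl_eq_0_imp_0 unfolding different_def by blast
  moreover have "f = smult c g" by (subst fg) (simp add: c)
  ultimately have "pderiv f = 0" by (simp add: pderiv_smult)
  then have "is_unit f" using f(2) by (simp add: separable_poly_def)
  then show False using f(1) by (simp add: irreducible_def)
qed

text \<open>The value of g(X) / (X - \<alpha>) at X = \<alpha> is g'(\<alpha>).\<close>

lemma sum_power_dual: "(\<Sum>j<n. \<alpha> ^ j * dual j) = different"
proof -
  have "(\<Sum>j<n. \<alpha> ^ j * dual j) = (\<Sum>j<n. \<Sum>k\<in>{j<..n}. \<iota> (coeff g k) * \<alpha> ^ (k - 1))"
    unfolding dual_def sum_distrib_left
  proof (intro sum.cong refl)
    fix j k assume "k \<in> {j<..n}"
    then have "k - 1 = j + (k - 1 - j)" by auto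
    then have "\<alpha> ^ (k - 1) = \<alpha> ^ j * \<alpha> ^ (k - 1 - j)" by (metis power_add)
    then show "\<alpha> ^ j * (\<iota> (coeff g k) * \<alpha> ^ (k - 1 - j)) = \<iota> (coeff g k) * \<alpha> ^ (k - 1)" by simp
  qed
  also have "\<dots> = different"
    unfolding sum_upper_triangle different_def evl_pderiv[OF gD(1) n_pos]
    by (simp add: hom_distribs mult.assoc del: of_nat_Suc)
  finally show ?thesis .
qed

text \<open>\<open>ext_trace\<close> uses an unspecified basis; exchanging the two sums is tr(AB) =
  tr(BA) and moves the computation to the powers of \<alpha>.\<close>

lemma ext_trace_coordinates:
  assumes x: "x \<in> E"
  shows "ext_trace \<iota> E x = (\<Sum>i<n. crd (x * \<alpha> ^ i) i)"
proof -
  define bs where "bs = (SOME bs. ext_basis \<iota> E bs)"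
  have bs: "ext_basis \<iota> E bs" unfolding bs_def using ext_basis_power_list by (rule someI)
  let ?B = "set bs" and ?rep = "vs.representation (set bs)"
  have B: "vs.independent ?B" "vs.span ?B = E" using bs by (auto simp: ext_basis_def)
  have BE: "b \<in> E" if "b \<in> ?B" for b using that vs.span_superset[of ?B] B(2) by auto
  have xE: "x * \<alpha> ^ i \<in> E" for i using x power_mem by (intro V.mult_mem)
  have "?rep (x * b) b = (\<Sum>i<n. ?rep (x * \<alpha> ^ i) b * crd b i)" if b: "b \<in> ?B" for b
  proof -
    have "x * b = (\<Sum>i<n. \<iota> (crd b i) * (x * \<alpha> ^ i))"
      by (subst crd_sum[OF BE[OF b], symmetric]) (simp add: sum_distrib_left mult.left_commute)
    also have "?rep \<dots> b = (\<Sum>i<n. ?rep (\<iota> (crd b i) * (x * \<alpha> ^ i)) b)"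
      by (subst vs.representation_sum[OF B(1)]) (use xE B(2) V.mult_mem base_mem in auto)
    also have "\<dots> = (\<Sum>i<n. ?rep (x * \<alpha> ^ i) b * crd b i)"
      using vs.representation_scale[OF B(1)] xE B(2) by (simp add: mult.commute)
    finally show ?thesis .
  qed
  then have "ext_trace \<iota> E x = (\<Sum>b\<in>?B. \<Sum>i<n. ?rep (x * \<alpha> ^ i) b * crd b i)"
    unfolding ext_trace_def bs_def[symmetric] Let_def by simp
  also have "\<dots> = (\<Sum>i<n. \<Sum>b\<in>?B. ?rep (x * \<alpha> ^ i) b * crd b i)" by (rule sum.swap)
  also have "\<dots> = (\<Sum>i<n. crd (\<Sum>b\<in>?B. \<iota> (?rep (x * \<alpha> ^ i) b) * b) i)"
    by (subst crd_sum_distrib) (auto simp: crd_scale BE intro: V.mult_mem base_mem)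
  also have "\<dots> = (\<Sum>i<n. crd (x * \<alpha> ^ i) i)"
    by (subst vs.sum_representation_eq[OF B(1)]) (use xE B(2) in auto)
  finally show ?thesis .
qed

lemma euler_trace_formula:
  assumes x: "x \<in> E"
  shows "ext_trace \<iota> E x = lam (x * different)"
proof -
  have "ext_trace \<iota> E x = (\<Sum>j<n. lam (x * (\<alpha> ^ j * dual j)))"
    using ext_trace_coordinates[OF x] crd_dual x power_mem by (simp add: V.mult_mem mult.assoc)
  also have "\<dots> = lam (\<Sum>j<n. x * (\<alpha> ^ j * dual j))"
    unfolding lam_def by (subst crd_sum_distrib) (use x power_mem dual_mem V.mult_mem in auto)
  finally show ?thesis by (simp add: sum_distrib_left[symmetric] sum_power_dual)
qed

text \<open>The term of the top coordinate has valuation congruent to -1 modulo \<open>n\<close>. So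
  it is the term of least valuation exactly when \<open>v z\<close> has that residue.\<close>

lemma lam_val:
  assumes z: "z \<in> E" "z \<noteq> 0"
  shows "lam z = 0 \<or> v z \<le> int n * w (lam z) + (int n - 1)"
    and "int n dvd v z + 1 \<Longrightarrow> lam z \<noteq> 0 \<and> int n * w (lam z) + (int n - 1) = v z"
proof -
  have all: "crd z i = 0 \<or> v z \<le> int n * w (crd z i) + int i" if "i < n" for i
    using vge_crd[OF z(1), of "v z"] that by (simp add: val_ge_def)
  then show "lam z = 0 \<or> v z \<le> int n * w (lam z) + (int n - 1)"
    using n_pos all[of "n - 1"] by (simp add: lam_def of_nat_diff)
  assume dv: "int n dvd v z + 1"
  have "\<not> val_ge v (v z + 1) z" using z by (simp add: val_ge_def)
  then obtain i where i: "i < n" "crd z i \<noteq> 0" "\<not> v z + 1 \<le> int n * w (crd z i) + int i"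
    using vge_crd[OF z(1)] by blast
  then have eq: "int n * w (crd z i) + int i = v z" using all[of i] by linarith
  obtain k where "v z + 1 = int n * k" using dv by blast
  then have "int n * w (crd z i) + int i = int n * (k - 1) + int (n - 1)"
    using eq n_pos by (simp add: algebra_simps of_nat_diff)
  then have "i = n - 1" using int_digits_unique[of i n "n - 1"] i(1) n_pos by simp
  then show "lam z \<noteq> 0 \<and> int n * w (lam z) + (int n - 1) = v z"
    using i eq n_pos by (simp add: lam_def of_nat_diff)
qed

text \<open>By Euler's formula the entries of the trace matrix are values of \<open>lam\<close> at
  elements of valuation v(g'(\<alpha>)) + i + j, and the two parts of \<open>lam_val\<close> are the
  two hypotheses of \<open>det_unique_min\<close>.\<close>

lemma basis_disc_power_list:
  assumes "different \<noteq> 0"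
  shows "basis_disc \<iota> E power_list \<noteq> 0 \<and> w (basis_disc \<iota> E power_list) = v different"
proof -
  let ?A = "mat n n (\<lambda>(i, j). lam (\<alpha> ^ (i + j) * different))"
  have "basis_disc \<iota> E power_list = det ?A"
    unfolding basis_disc_def
    by (rule arg_cong[where f = det], rule eq_matI)
       (auto simp: power_list_def euler_trace_formula power_mem V.mult_mem power_add)
  moreover have "det ?A \<noteq> 0 \<and> w (det ?A) = v different"
  proof (rule det_unique_min)
    fix i j assume ij: "i < n" "j < n"
    let ?z = "\<alpha> ^ (i + j) * different"
    have z: "?z \<in> E" "?z \<noteq> 0" using assms unifD power_mem different_mem V.mult_mem by auto
    have vz: "v ?z = v different + int i + int j"
      using assms unifD different_mem power_mem by (simp add: V.v_mult V.v_power)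
    show "?A $$ (i, j) = 0 \<or> v different + int i + int j \<le> int n * w (?A $$ (i, j)) + (int n - 1)"
      using lam_val(1)[OF z] ij by (simp add: vz)
    show "int n dvd v different + int i + int j + 1 \<Longrightarrow> ?A $$ (i, j) \<noteq> 0 \<and>
        int n * w (?A $$ (i, j)) + (int n - 1) = v different + int i + int j"
      using lam_val(2)[OF z] ij by (simp add: vz)
  qed (use n_pos in auto)
  ultimately show ?thesis by simp
qed

text \<open>In a monic integral equation for an element of negative valuation the leading term would
  dominate. Conversely, multiplication by \<open>x\<close> has an integral matrix in the powers of
  \<alpha>; the vector of these powers is an eigenvector for \<open>x\<close>, so \<open>x\<close>
  is a root of an integral characteristic polynomial.\<close>

lemma integers_of_eq: "integers_of \<iota> w E = {x \<in> E. val_ge v 0 x}"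
proof (intro subset_antisym subsetI)
  fix x assume "x \<in> integers_of \<iota> w E"
  then obtain f where x: "x \<in> E" and f: "lead_coeff f = 1" "\<And>i. coeff f i \<in> val_ring w" "evl f x = 0"
    unfolding integers_of_def by blast
  have "val_ge v 0 x"
  proof (rule ccontr)
    assume neg: "\<not> val_ge v 0 x"
    then have x0: "x \<noteq> 0" "v x < 0" by (auto simp: val_ge_def)
    let ?m = "degree f"
    have "val_ge v (int ?m * v x + 1) (\<Sum>i<?m. \<iota> (coeff f i) * x ^ i)"
    proof (rule V.vge_sum, rule conjI)
      fix i assume i: "i \<in> {..<?m}"
      show "\<iota> (coeff f i) * x ^ i \<in> E" using x by (intro V.mem_intros base_mem)
      have "val_ge v (int i * v x) (\<iota> (coeff f i) * x ^ i)"
        using x f(2)[of i] vge_base0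
        by (intro V.vge_mult0 V.vge_power base_mem V.power_mem) (auto simp: val_ge_def val_ring_def)
      moreover have "int ?m * v x \<le> (int i + 1) * v x"
        using i x0 by (intro mult_right_mono_neg) auto
      ultimately show "val_ge v (int ?m * v x + 1) (\<iota> (coeff f i) * x ^ i)"
        using x0 by (elim V.vge_mono) (auto simp: algebra_simps)
    qed
    moreover have "x ^ ?m = - (\<Sum>i<?m. \<iota> (coeff f i) * x ^ i)"
      using evl_monic[OF refl f(1), of x] f(3) by (simp add: eq_neg_iff_add_eq_0)
    ultimately have "val_ge v (int ?m * v x + 1) (x ^ ?m)"
      using x by (simp add: V.vge_uminus V.sum_mem V.mult_mem V.power_mem base_mem)
    then show False using x x0 by (simp add: val_ge_def V.v_power)
  qed
  then show "x \<in> {x \<in> E. val_ge v 0 x}" using x by simp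
next
  fix x assume "x \<in> {x \<in> E. val_ge v 0 x}"
  then have x: "x \<in> E" "val_ge v 0 x" by auto
  define M where "M = mat n n (\<lambda>(i, j). crd (x * \<alpha> ^ i) j)"
  have M: "M \<in> carrier_mat n n" by (simp add: M_def)
  have xE: "x * \<alpha> ^ i \<in> E" for i using x power_mem by (intro V.mult_mem)
  have "val_ge v 0 (x * \<alpha> ^ i)" for i
    using x unifD unif_vge0[OF unif] by (intro V.vge_mult0 V.vge_power0 power_mem)
  then have "val_ge w 0 (M $$ (i, j))" if "i < n" "j < n" for i j
    using vge0_crd[OF xE] that by (simp add: M_def)
  then have int: "W.integral_poly (char_poly M)" by (rule integral_char_poly[OF M])
  have M': "map_mat \<iota> M \<in> carrier_mat n n" using M by simp
  let ?b = "vec n (\<lambda>j. \<alpha> ^ j)"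
  have "eigenvector (map_mat \<iota> M) ?b x"
    unfolding eigenvector_def
  proof (intro conjI)
    show "?b \<in> carrier_vec (dim_row (map_mat \<iota> M))" using M by simp
    have "?b $ 0 \<noteq> 0\<^sub>v n $ 0" using n_pos by simp
    then show "?b \<noteq> 0\<^sub>v (dim_row (map_mat \<iota> M))" using M by auto
    show "map_mat \<iota> M *\<^sub>v ?b = x \<cdot>\<^sub>v ?b"
    proof (rule eq_vecI)
      fix i assume "i < dim_vec (x \<cdot>\<^sub>v ?b)"
      then have i: "i < n" by simp
      have "(map_mat \<iota> M *\<^sub>v ?b) $ i = (\<Sum>j = 0..<n. \<iota> (crd (x * \<alpha> ^ i) j) * \<alpha> ^ j)"
        using i by (simp add: M_def scalar_prod_def)
      also have "\<dots> = x * \<alpha> ^ i" using crd_sum[OF xE] by (simp add: atLeast0LessThan)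
      finally show "(map_mat \<iota> M *\<^sub>v ?b) $ i = (x \<cdot>\<^sub>v ?b) $ i" using i by simp
    qed (use M in simp)
  qed
  then have "eigenvalue (map_mat \<iota> M) x" unfolding eigenvalue_def by blast
  then have "poly (char_poly (map_mat \<iota> M)) x = 0" using eigenvalue_root_char_poly[OF M'] by simp
  then have "evl (char_poly M) x = 0" using char_poly_hom[OF M] by simp
  moreover have "lead_coeff (char_poly M) = 1" using degree_monic_char_poly[OF M] by simp
  ultimately show "x \<in> integers_of \<iota> w E"
    using x int unfolding integers_of_def W.integral_poly_def val_ring_def by auto
qed

text \<open>The matrix \<open>P\<close> expressing the basis in the powers of \<alpha> has integral
  entries, and the discriminant of the power basis gets multiplied by det(P)^2.\<close>

lemma vge_basis_disc:
  assumes xs: "ext_basis \<iota> E xs" "set xs \<subseteq> integers_of \<iota> w E" and dnz: "different \<noteq> 0"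
  shows "val_ge w (v different) (basis_disc \<iota> E xs)"
proof -
  have "vs.span (set xs) = E" "vs.independent (set xs)" using xs(1) by (auto simp: ext_basis_def)
  then have "card (set xs) = vs.dim E" using vs.dim_span_eq_card_independent by metis
  then have len: "length xs = n"
    using xs(1) deg by (simp add: ext_basis_def ext_degree_def distinct_card)
  have xE: "xs ! i \<in> E" "val_ge v 0 (xs ! i)" if "i < n" for i
    using subsetD[OF xs(2) nth_mem[of i xs]] that len unfolding integers_of_eq by auto
  define P where "P = mat n n (\<lambda>(i, j). crd (xs ! i) j)"
  define T where "T = mat n n (\<lambda>(i, j). lam (\<alpha> ^ i * \<alpha> ^ j * different))"
  have PT: "P \<in> carrier_mat n n" "T \<in> carrier_mat n n" by (auto simp: P_def T_def)
  have T: "det T = basis_disc \<iota> E power_list"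
    unfolding basis_disc_def T_def
    by (rule arg_cong[where f = det], rule eq_matI)
       (auto simp: power_list_def euler_trace_formula power_mem V.mult_mem)
  have "mat n n (\<lambda>(i, j). ext_trace \<iota> E (xs ! i * xs ! j)) = P * T * transpose_mat P"
  proof (rule eq_matI)
    fix i j assume "i < dim_row (P * T * transpose_mat P)" "j < dim_col (P * T * transpose_mat P)"
    then have ij: "i < n" "j < n" by (auto simp: P_def)
    define r where "r l = (\<Sum>k<n. \<iota> (crd (xs ! i) k) * (\<alpha> ^ k * \<alpha> ^ l * different))" for l
    have "xs ! i * xs ! j * different =
        (\<Sum>k<n. \<iota> (crd (xs ! i) k) * \<alpha> ^ k) * (\<Sum>l<n. \<iota> (crd (xs ! j) l) * \<alpha> ^ l) * different"
      using crd_sum xE ij by simp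
    also have "\<dots> = (\<Sum>l<n. \<iota> (crd (xs ! j) l) * r l)"
      by (simp add: r_def sum_distrib_left sum_distrib_right mult_ac)
    finally have "lam (xs ! i * xs ! j * different) = lam (\<Sum>l<n. \<iota> (crd (xs ! j) l) * r l)" by simp
    also have "\<dots> = (\<Sum>l<n. crd (xs ! j) l * lam (r l))"
      by (rule lam_sum) (auto simp: r_def intro!: V.sum_mem V.mult_mem base_mem power_mem different_mem)
    also have "\<dots> = (\<Sum>l<n. crd (xs ! j) l * (\<Sum>k<n. crd (xs ! i) k * lam (\<alpha> ^ k * \<alpha> ^ l * different)))"
      unfolding r_def
      by (intro sum.cong refl arg_cong2[where f = "(*)"] lam_sum)
         (auto intro!: V.mult_mem power_mem different_mem)
    also have "\<dots> = (P * T * transpose_mat P) $$ (i, j)"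
      using ij PT by (simp add: scalar_prod_def P_def T_def atLeast0LessThan mult.commute)
    finally show "mat n n (\<lambda>(i, j). ext_trace \<iota> E (xs ! i * xs ! j)) $$ (i, j) =
        (P * T * transpose_mat P) $$ (i, j)"
      using ij xE by (simp add: euler_trace_formula V.mult_mem)
  qed (auto simp: P_def)
  then have "basis_disc \<iota> E xs = det P * det P * basis_disc \<iota> E power_list"
    unfolding basis_disc_def[of _ _ xs] len T[symmetric]
    using PT det_mult[of "P * T" n "transpose_mat P"] det_mult[OF PT] det_transpose[OF PT(1)]
    by simp
  moreover have "val_ge w 0 (det P)"
    by (rule vge_det_0[OF PT(1)]) (use vge0_crd xE in \<open>auto simp: P_def\<close>)
  moreover have "val_ge w (v different) (basis_disc \<iota> E power_list)"
    using basis_disc_power_list[OF dnz] by (simp add: val_ge_def)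
  ultimately show ?thesis by (auto intro!: W.vge_mult0)
qed

text \<open>The infimum of valuations is a minimum, attained by the power basis, since all
  generators of the ideal have at least that valuation.\<close>

lemma ideal_val_discriminant:
  assumes dnz: "different \<noteq> 0"
  shows "ideal_val w (discriminant_ideal \<iota> w E) = v different"
proof -
  let ?D = "{basis_disc \<iota> E xs | xs. ext_basis \<iota> E xs \<and> set xs \<subseteq> integers_of \<iota> w E}"
  let ?\<delta> = "basis_disc \<iota> E power_list"
  have int: "set power_list \<subseteq> integers_of \<iota> w E"
    unfolding integers_of_eq set_power_list
    using powers_subset unifD unif_vge0[OF unif] by (auto simp: powers_def intro: V.vge_power0)
  have "?\<delta> \<in> ?D" using ext_basis_power_list int by blast
  then have "?\<delta> \<in> generated_ideal w ?D"
    unfolding generated_ideal_def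
    by (intro CollectI exI[of _ "{?\<delta>}"] exI[of _ "\<lambda>_. 1"]) (auto simp: val_ring_def W.vge_one)
  moreover have "val_ge w (v different) x" if gi: "x \<in> generated_ideal w ?D" for x
  proof -
    obtain T a where x: "x = (\<Sum>d\<in>T. a d * d)" "T \<subseteq> ?D" "a ` T \<subseteq> val_ring w"
      using gi unfolding generated_ideal_def mem_Collect_eq by (elim exE conjE) (rule that)
    show ?thesis unfolding x(1)
    proof (rule W.vge_sum, rule conjI, simp, rule W.vge_mult0)
      fix d assume d: "d \<in> T"
      show "val_ge w 0 (a d)" using x(3) d by (auto simp: val_ring_def)
      show "val_ge w (v different) d" using x(2) d vge_basis_disc[OF _ _ dnz] by blast
    qed auto
  qed
  ultimately show ?thesis
    unfolding ideal_val_def discriminant_ideal_def using basis_disc_power_list[OF dnz]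
    by (intro cInf_eq_minimum) (auto simp: val_ge_def image_iff intro!: bexI[of _ ?\<delta>])
qed

end

section \<open>Adjoining a root of an Eisenstein polynomial\<close>

definition adjoin :: "('k::field \<Rightarrow> 'a::field) \<Rightarrow> 'a \<Rightarrow> 'a set" where
  "adjoin \<iota> \<beta> = range (\<lambda>h. poly (map_poly \<iota> h) \<beta>)"

locale eisenstein_poly = local_field w for w :: "'k::field \<Rightarrow> int" +
  fixes n :: nat and g :: "'k poly"
  assumes n_pos: "n > 0" and g: "eisenstein w n g"
begin

lemma gD: "degree g = n" "coeff g n = 1" "g \<noteq> 0"
  and g_coeff: "i < n \<Longrightarrow> val_ge w 1 (coeff g i)"
  and g_coeff0: "coeff g 0 \<noteq> 0" "w (coeff g 0) = 1"
  using g n_pos by (auto simp: eisenstein_def)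

text \<open>\<open>cl k i\<close> is the ceiling of \<open>(k - i) / n\<close>.\<close>

definition cl :: "int \<Rightarrow> nat \<Rightarrow> int" where "cl k i = - ((int i - k) div int n)"

lemma cl_le_iff: "cl k i \<le> x \<longleftrightarrow> k \<le> int n * x + int i"
proof -
  define a where "a = int i - k"
  have a: "a = int n * (a div int n) + a mod int n" "0 \<le> a mod int n" "a mod int n < int n"
    using n_pos by simp_all
  have "- x \<le> a div int n \<longleftrightarrow> int n * (- x) \<le> a"
  proof
    assume "- x \<le> a div int n"
    then have "int n * (- x) \<le> int n * (a div int n)" by (intro mult_left_mono) auto
    then show "int n * (- x) \<le> a" using a by linarith
  next
    assume L: "int n * (- x) \<le> a"
    show "- x \<le> a div int n"
    proof (rule ccontr)
      assume "\<not> - x \<le> a div int n"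
      then have "int n * (a div int n + 1) \<le> int n * (- x)" by (intro mult_left_mono) auto
      then show False using L a by (simp add: algebra_simps)
    qed
  qed
  then show ?thesis unfolding cl_def a_def[symmetric] by (auto simp: a_def)
qed

lemma cl_Suc: "cl (k + 1) (Suc i) = cl k i"
  by (simp add: cl_def)

text \<open>Multiplying X^(n-1) by X and reducing modulo an Eisenstein polynomial brings in a factor
  from the maximal ideal; the ceiling jumps accordingly.\<close>

lemma cl_wrap: "cl (k + 1) 0 = cl k (n - 1) + 1"
proof -
  have "cl (k + 1) 0 \<le> x \<longleftrightarrow> cl k (n - 1) + 1 \<le> x" for x
  proof -
    have "cl k (n - 1) + 1 \<le> x \<longleftrightarrow> cl k (n - 1) \<le> x - 1" by linarith
    also have "\<dots> \<longleftrightarrow> cl (k + 1) 0 \<le> x"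
      unfolding cl_le_iff using n_pos by (simp add: of_nat_diff algebra_simps)
    finally show ?thesis by simp
  qed
  from this[of "cl (k + 1) 0"] this[of "cl k (n - 1) + 1"] show ?thesis by linarith
qed

lemma cl_le_0: "cl k i \<le> cl k 0"
  using cl_le_iff[of k 0 "cl k 0"] cl_le_iff[of k i "cl k 0"] by simp

text \<open>The expected valuation on \<open>K[X]/(g)\<close>: the class of \<open>X\<close> has valuation one.\<close>

definition vg :: "int \<Rightarrow> 'k poly \<Rightarrow> bool" where
  "vg k h \<longleftrightarrow> (\<forall>i<n. val_ge w (cl k i) (coeff (h mod g) i))"

lemma val_ge_cl: "val_ge w (cl k i) a \<longleftrightarrow> a = 0 \<or> k \<le> int n * w a + int i"
  by (simp add: val_ge_def cl_le_iff)

lemma degree_mod_g: "degree (h mod g) < n"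
  using degree_mod_less[OF gD(3), of h] gD(1) n_pos by auto

lemma vg_zero: "vg k 0"
  by (simp add: vg_def)

lemma vg_cong: "h mod g = h' mod g \<Longrightarrow> vg k h \<longleftrightarrow> vg k h'"
  by (simp add: vg_def)

lemma vg_mono: "vg k h \<Longrightarrow> l \<le> k \<Longrightarrow> vg l h"
  unfolding vg_def val_ge_cl by fastforce

lemma vg_add: "vg k h \<Longrightarrow> vg k h' \<Longrightarrow> vg k (h + h')"
  unfolding vg_def by (auto simp: poly_mod_add_left intro!: W.vge_add)

lemma vg_diff: "vg k h \<Longrightarrow> vg k h' \<Longrightarrow> vg k (h - h')"
  unfolding vg_def by (auto simp: poly_mod_diff_left intro!: W.vge_diff)

lemma vg_sum: "(\<And>i. i \<in> I \<Longrightarrow> vg k (f i)) \<Longrightarrow> vg k (sum f I)"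
  by (induction I rule: infinite_finite_induct) (auto simp: vg_zero vg_add)

lemma vg_smult: "c \<noteq> 0 \<Longrightarrow> vg (k + int n * w c) (smult c h) \<longleftrightarrow> vg k h"
proof -
  assume c: "c \<noteq> 0"
  have "val_ge w (cl (k + int n * w c) i) (c * a) \<longleftrightarrow> val_ge w (cl k i) a" for i a
    using c by (cases "a = 0") (auto simp: val_ge_cl W.v_mult algebra_simps)
  then show ?thesis by (simp add: vg_def mod_smult_left)
qed

text \<open>Multiplication by X shifts the coefficients and subtracts \<open>b\<close> times those
  of \<open>g\<close>, where \<open>b\<close> is the top coefficient. For \<open>g\<close>
  Eisenstein this correction is small enough, and \<open>w (coeff g 0) = 1\<close> recovers the
  bound on \<open>b\<close> from the new constant term, which gives the converse.\<close>

lemma vg_X: "vg (k + 1) (pCons 0 h) \<longleftrightarrow> vg k h"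
proof -
  define r where "r = h mod g"
  define b where "b = coeff r (n - 1)"
  have "pCons 0 h mod g = pCons 0 r - smult b g"
    using mod_pCons[OF gD(3), of 0 h] gD n_pos unfolding b_def r_def by (cases n) auto
  then have c0: "coeff (pCons 0 h mod g) 0 = - (b * coeff g 0)"
    and cS: "coeff (pCons 0 h mod g) (Suc i) = coeff r i - b * coeff g (Suc i)" for i
    by simp_all
  have b0: "val_ge w (cl (k + 1) 0) (b * coeff g 0) \<longleftrightarrow> val_ge w (cl k (n - 1)) b"
    unfolding cl_wrap using g_coeff0 by (subst mult.commute, subst W.vge_mult_iff) auto
  have bS: "val_ge w (cl k i) (b * coeff g (Suc i))" if "val_ge w (cl k (n - 1)) b" "Suc i < n" for i
  proof -
    have "val_ge w (cl k (n - 1) + 1) (b * coeff g (Suc i))"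
      using that g_coeff by (intro W.vge_mult) auto
    then show ?thesis using cl_le_0[of "k + 1" "Suc i"]
      by (elim W.vge_mono) (simp add: cl_Suc cl_wrap)
  qed
  show ?thesis
  proof
    assume L: "vg (k + 1) (pCons 0 h)"
    then have "val_ge w (cl (k + 1) 0) (- (b * coeff g 0))" using n_pos c0 by (force simp: vg_def)
    then have b: "val_ge w (cl k (n - 1)) b" using b0 by (simp add: W.vge_uminus)
    have "val_ge w (cl k i) (coeff r i)" if i: "i < n" for i
    proof (cases "i = n - 1")
      case True
      then show ?thesis using b by (simp add: b_def)
    next
      case False
      then have "Suc i < n" using i by simp
      then have "val_ge w (cl k i) (coeff r i - b * coeff g (Suc i))"
        using L cS[of i] cl_Suc[of k i] unfolding vg_def by metis
      from W.vge_add[OF _ _ this bS[OF b \<open>Suc i < n\<close>]] show ?thesis by simp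
    qed
    then show "vg k h" by (simp add: vg_def r_def)
  next
    assume R: "vg k h"
    then have r: "val_ge w (cl k i) (coeff r i)" if "i < n" for i using that by (simp add: vg_def r_def)
    then have b: "val_ge w (cl k (n - 1)) b" using n_pos by (simp add: b_def)
    show "vg (k + 1) (pCons 0 h)" unfolding vg_def
    proof (intro allI impI)
      fix i assume i: "i < n"
      show "val_ge w (cl (k + 1) i) (coeff (pCons 0 h mod g) i)"
      proof (cases i)
        case 0
        then show ?thesis using b b0 c0 by (simp add: W.vge_uminus)
      next
        case (Suc j)
        then show ?thesis using cS[of j] cl_Suc r[of j] bS[OF b, of j] i by (auto intro!: W.vge_diff)
      qed
    qed
  qed
qed

lemma vg_monom: "c \<noteq> 0 \<Longrightarrow> vg (k + int n * w c + int m) (monom c m * h) \<longleftrightarrow> vg k h"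
proof (induction m arbitrary: k)
  case 0
  then show ?case by (simp add: monom_0 vg_smult)
next
  case (Suc m)
  have "vg (k + int n * w c + int (Suc m)) (monom c (Suc m) * h) \<longleftrightarrow>
      vg ((k + int n * w c + int m) + 1) (pCons 0 (monom c m * h))"
    by (simp add: monom_Suc algebra_simps)
  then show ?case unfolding vg_X using Suc by simp
qed

lemma vg_one: "vg k 1 \<longleftrightarrow> k \<le> 0"
proof -
  have "(1 :: 'k poly) mod g = 1" using gD n_pos by (intro mod_poly_less) simp
  then show ?thesis using n_pos by (auto simp: vg_def val_ge_cl W.v_one)
qed

lemma vg_monom_iff: "c \<noteq> 0 \<Longrightarrow> vg k (monom c m) \<longleftrightarrow> k \<le> int n * w c + int m"
  using vg_monom[of c "k - int n * w c - int m" m 1] by (simp add: vg_one) linarith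

lemma vg_mult:
  assumes "vg a h" "vg b h'"
  shows "vg (a + b) (h * h')"
proof -
  define r where "r = h' mod g"
  have "r = (\<Sum>i<n. monom (coeff r i) i)"
    using poly_as_sum_of_monoms'[of r "n - 1"] degree_mod_g[of h'] n_pos
    by (cases n) (auto simp: r_def lessThan_Suc_atMost)
  then have "h * r = (\<Sum>i<n. monom (coeff r i) i * h)"
    by (metis (no_types) mult.commute sum_distrib_right)
  moreover have "vg (a + b) (\<Sum>i<n. monom (coeff r i) i * h)"
  proof (rule vg_sum)
    fix i assume i: "i \<in> {..<n}"
    show "vg (a + b) (monom (coeff r i) i * h)"
    proof (cases "coeff r i = 0")
      case False
      then have "b \<le> int n * w (coeff r i) + int i"
        using assms(2) i by (auto simp: vg_def val_ge_cl r_def)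
      moreover have "vg (a + int n * w (coeff r i) + int i) (monom (coeff r i) i * h)"
        using vg_monom[OF False] assms(1) by blast
      ultimately show ?thesis by (elim vg_mono) simp
    qed (simp add: vg_zero)
  qed
  ultimately have "vg (a + b) (h * r)" by simp
  moreover have "(h * r) mod g = (h * h') mod g" by (simp add: r_def mod_mult_right_eq)
  ultimately show ?thesis using vg_cong by blast
qed

text \<open>The terms of the remainder have valuations distinct modulo \<open>n\<close>, so the
  least one is attained by a single monomial.\<close>

lemma vg_leading:
  assumes "vg a h" "\<not> vg (a + 1) h"
  obtains c i where "c \<noteq> 0" "int n * w c + int i = a" "vg (a + 1) (h - monom c i)"
proof -
  define r where "r = h mod g"
  have ge: "coeff r j = 0 \<or> a \<le> int n * w (coeff r j) + int j" if "j < n" for j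
    using assms(1) that by (auto simp: vg_def val_ge_cl r_def)
  obtain i where i: "i < n" "coeff r i \<noteq> 0" "\<not> a + 1 \<le> int n * w (coeff r i) + int i"
    using assms(2) by (auto simp: vg_def val_ge_cl r_def)
  have eq: "int n * w (coeff r i) + int i = a" using ge[OF i(1)] i by linarith
  have "degree (monom (coeff r i) i) < degree g" using i gD by (simp add: degree_monom_eq)
  then have md: "(h - monom (coeff r i) i) mod g = r - monom (coeff r i) i"
    by (simp add: poly_mod_diff_left r_def mod_poly_less)
  have "vg (a + 1) (h - monom (coeff r i) i)"
    unfolding vg_def md val_ge_cl
  proof (intro allI impI)
    fix j assume j: "j < n"
    show "coeff (r - monom (coeff r i) i) j = 0 \<or>
        a + 1 \<le> int n * w (coeff (r - monom (coeff r i) i) j) + int j"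
    proof (cases "j = i \<or> coeff r j = 0")
      case False
      then have "int n * w (coeff r j) + int j \<noteq> int n * w (coeff r i) + int i"
        using int_digits_unique[of j n i] j i by blast
      then show ?thesis using ge[OF j] False eq by auto
    qed auto
  qed
  then show ?thesis using that[OF i(2) eq] by blast
qed

text \<open>The leading monomials multiply to a monomial of valuation exactly \<open>a + b\<close>,
  while all other contributions have larger valuation. This makes \<open>vp\<close> multiplicative
  and K[X]/(g) a domain.\<close>

lemma not_vg_mult:
  assumes "vg a h" "\<not> vg (a + 1) h" "vg b h'" "\<not> vg (b + 1) h'"
  shows "\<not> vg (a + b + 1) (h * h')"
proof
  assume L: "vg (a + b + 1) (h * h')"
  obtain c i where c: "c \<noteq> 0" "int n * w c + int i = a" "vg (a + 1) (h - monom c i)"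
    using vg_leading[OF assms(1,2)] .
  obtain d j where d: "d \<noteq> 0" "int n * w d + int j = b" "vg (b + 1) (h' - monom d j)"
    using vg_leading[OF assms(3,4)] .
  have "vg a (monom c i)" using vg_monom_iff c by simp
  from vg_mult[OF this d(3)] vg_mult[OF c(3) assms(3)]
  have "vg (a + b + 1) (monom c i * (h' - monom d j) + (h - monom c i) * h')"
    by (intro vg_add) (simp_all add: algebra_simps)
  from vg_diff[OF L this] have "vg (a + b + 1) (monom (c * d) (i + j))"
    by (simp add: algebra_simps mult_monom)
  then show False using vg_monom_iff[of "c * d"] c d by (simp add: W.v_mult algebra_simps)
qed

definition vp :: "'k poly \<Rightarrow> int" where "vp h = (THE a. vg a h \<and> \<not> vg (a + 1) h)"

lemma vp_unique:
  assumes "vg a h" "\<not> vg (a + 1) h"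
  shows "vp h = a"
  unfolding vp_def
proof (rule the_equality)
  fix b assume b: "vg b h \<and> \<not> vg (b + 1) h"
  have "\<not> a < b" "\<not> b < a" using vg_mono[of b h "a + 1"] vg_mono[of a h "b + 1"] assms b by auto
  then show "b = a" by simp
qed (use assms in simp)

lemma vp:
  assumes "h mod g \<noteq> 0"
  shows "vg (vp h) h \<and> \<not> vg (vp h + 1) h"
proof -
  define r where "r = h mod g"
  define J where "J = {i. i < n \<and> coeff r i \<noteq> 0}"
  have J: "finite J" "J \<noteq> {}"
    using leading_coeff_neq_0[OF assms] degree_mod_g[of h] by (auto simp: J_def r_def)
  define f where "f i = int n * w (coeff r i) + int i" for i
  define j where "j = arg_min_on f J"
  have j: "j \<in> J" "\<And>i. i \<in> J \<Longrightarrow> f j \<le> f i"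
    unfolding j_def using arg_min_if_finite(1)[OF J] arg_min_least[OF J] by auto
  have "vg (f j) h" "\<not> vg (f j + 1) h"
    using j by (auto simp: vg_def val_ge_cl J_def r_def[symmetric] f_def)
  then show ?thesis using vp_unique by metis
qed

lemma vg_iff: "h mod g \<noteq> 0 \<Longrightarrow> vg k h \<longleftrightarrow> k \<le> vp h"
  using vp[of h] vg_mono[of k h "vp h + 1"] vg_mono[of "vp h" h k] by force

lemma vg_all: "h mod g = 0 \<Longrightarrow> vg k h"
  by (simp add: vg_def)

lemma vp_mult:
  assumes "h mod g \<noteq> 0" "h' mod g \<noteq> 0"
  shows "h * h' mod g \<noteq> 0" "vp (h * h') = vp h + vp h'"
proof -
  have 1: "vg (vp h + vp h') (h * h')" "\<not> vg (vp h + vp h' + 1) (h * h')"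
    using vg_mult not_vg_mult vp[OF assms(1)] vp[OF assms(2)] by auto
  show "h * h' mod g \<noteq> 0" using 1(2) vg_all by metis
  show "vp (h * h') = vp h + vp h'" using vp_unique[OF 1] .
qed

lemma vp_monom:
  assumes "c \<noteq> 0"
  shows "vp (monom c i) = int n * w c + int i" "monom c i mod g \<noteq> 0"
proof -
  show "vp (monom c i) = int n * w c + int i" using vg_monom_iff[OF assms] by (intro vp_unique) auto
  show "monom c i mod g \<noteq> 0"
    using vg_monom_iff[OF assms, of "int n * w c + int i + 1" i] vg_all by force
qed

text \<open>Eisenstein's criterion from the valuation: proper factors have degree below
  \<open>n\<close>, hence nonzero remainders, and \<open>vp_mult\<close> forbids their product to
  vanish modulo \<open>g\<close>.\<close>

lemma irreducible_g: "irreducible g"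
proof (rule irreducibleI)
  show "\<not> is_unit g" using gD n_pos by (auto simp: is_unit_iff_degree)
  fix a b assume ab: "g = a * b"
  show "is_unit a \<or> is_unit b"
  proof (rule ccontr)
    assume "\<not> ?thesis"
    moreover have nz: "a \<noteq> 0" "b \<noteq> 0" using ab gD by auto
    ultimately have "degree a > 0" "degree b > 0" by (auto simp: is_unit_iff_degree)
    moreover have "degree g = degree a + degree b" unfolding ab using nz by (rule degree_mult_eq)
    ultimately have "a mod g = a" "b mod g = b" by (auto intro: mod_poly_less)
    then have "a * b mod g \<noteq> 0" using vp_mult(1)[of a b] nz by simp
    then show False using ab by simp
  qed
qed (use gD in simp)

end

section \<open>The valued field generated by a root\<close>

locale eisenstein_root = eisenstein_poly w n g + field_hom \<iota>
  for w :: "'k::field \<Rightarrow> int" and n g and \<iota> :: "'k \<Rightarrow> 'a::field" +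
  fixes \<beta> :: 'a
  assumes root: "evl g \<beta> = 0"
begin

sublocale mp: map_poly_comm_ring_hom \<iota> ..

lemma evl_hom:
  "evl (p + r) \<beta> = evl p \<beta> + evl r \<beta>" "evl (p - r) \<beta> = evl p \<beta> - evl r \<beta>"
  "evl (p * r) \<beta> = evl p \<beta> * evl r \<beta>" "evl (- p) \<beta> = - evl p \<beta>" "evl 1 \<beta> = 1" "evl 0 \<beta> = 0"
  by (simp_all add: hom_distribs)

lemma evl_eq_0_iff: "evl h \<beta> = 0 \<longleftrightarrow> h mod g = 0"
proof
  assume 0: "evl h \<beta> = 0"
  show "h mod g = 0"
  proof (rule ccontr)
    assume "h mod g \<noteq> 0"
    then have "\<not> g dvd h" by auto
    then obtain a b where "a * g + b * h = 1" using irreducible_poly_bezout[OF irreducible_g] by blast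
    then have "evl (a * g + b * h) \<beta> = evl 1 \<beta>" by simp
    then show False unfolding evl_hom using 0 root by simp
  qed
next
  assume "h mod g = 0"
  then have "h = h div g * g" by (metis add.right_neutral div_mult_mod_eq)
  then have "evl h \<beta> = evl (h div g) \<beta> * evl g \<beta>" by (metis evl_hom(3))
  then show "evl h \<beta> = 0" using root by simp
qed

lemma evl_eq_iff: "evl h \<beta> = evl h' \<beta> \<longleftrightarrow> h mod g = h' mod g"
  using evl_eq_0_iff[of "h - h'"] by (simp add: evl_hom poly_mod_diff_left)

definition val :: "'a \<Rightarrow> int" where "val x = vp (SOME h. evl h \<beta> = x)"

lemma val_evl: "val (evl h \<beta>) = vp h"
proof -
  define h' where "h' = (SOME h'. evl h' \<beta> = evl h \<beta>)"
  have "evl h' \<beta> = evl h \<beta>" unfolding h'_def by (rule someI) simp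
  then have "h' mod g = h mod g" by (simp add: evl_eq_iff)
  then have "vg k h' \<longleftrightarrow> vg k h" for k by (rule vg_cong)
  then have "vp h' = vp h" by (simp add: vp_def)
  then show ?thesis by (simp add: val_def h'_def)
qed

lemma evl_adjoin: "evl h \<beta> \<in> adjoin \<iota> \<beta>"
  by (simp add: adjoin_def)

lemma adjoinE: "x \<in> adjoin \<iota> \<beta> \<Longrightarrow> (\<And>h. x = evl h \<beta> \<Longrightarrow> thesis) \<Longrightarrow> thesis"
  unfolding adjoin_def by blast

lemma intermediate_adjoin: "intermediate_field \<iota> (adjoin \<iota> \<beta>)"
  unfolding intermediate_field_def
proof (intro conjI subsetI ballI)
  fix x assume "x \<in> range \<iota>"
  then obtain c where "x = \<iota> c" by blast
  then have "x = evl (monom c 0) \<beta>" by (simp add: poly_monom)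
  then show "x \<in> adjoin \<iota> \<beta>" using evl_adjoin[of "monom c 0"] by simp
next
  fix x y assume "x \<in> adjoin \<iota> \<beta>" "y \<in> adjoin \<iota> \<beta>"
  then obtain h h' where "x = evl h \<beta>" "y = evl h' \<beta>" by (elim adjoinE)
  then show "x + y \<in> adjoin \<iota> \<beta>" "x * y \<in> adjoin \<iota> \<beta>"
    using evl_adjoin[of "h + h'"] evl_adjoin[of "h * h'"] by (simp_all add: evl_hom)
next
  fix x assume "x \<in> adjoin \<iota> \<beta>"
  then obtain h where h: "x = evl h \<beta>" by (elim adjoinE)
  then show "- x \<in> adjoin \<iota> \<beta>" using evl_adjoin[of "- h"] by (simp add: evl_hom)
  show "inverse x \<in> adjoin \<iota> \<beta>"
  proof (cases "x = 0")
    case True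
    then show ?thesis using evl_adjoin[of 0] by (simp add: evl_hom)
  next
    case False
    then have "\<not> g dvd h" using evl_eq_0_iff[of h] h by auto
    then obtain a b where "a * g + b * h = 1" using irreducible_poly_bezout[OF irreducible_g] by blast
    then have "evl (a * g + b * h) \<beta> = evl 1 \<beta>" by simp
    then have "evl b \<beta> * x = 1" unfolding evl_hom using root h by simp
    then have "inverse x = evl b \<beta>" by (metis inverse_unique mult.commute)
    then show ?thesis using evl_adjoin by simp
  qed
qed

lemma normalised_val: "normalised_valuation_on (adjoin \<iota> \<beta>) val"
  unfolding normalised_valuation_on_def
proof (intro conjI ballI impI)
  fix x y assume xy: "x \<in> adjoin \<iota> \<beta> - {0}" "y \<in> adjoin \<iota> \<beta> - {0}"
  then obtain h h' where h: "x = evl h \<beta>" "y = evl h' \<beta>" by (elim DiffE adjoinE)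
  then have nz: "h mod g \<noteq> 0" "h' mod g \<noteq> 0" using xy evl_eq_0_iff by auto
  show "val (x * y) = val x + val y"
    unfolding h evl_hom(3)[symmetric] val_evl using vp_mult(2)[OF nz] .
  assume "x + y \<noteq> 0"
  then have "(h + h') mod g \<noteq> 0" using h evl_eq_0_iff[of "h + h'"] by (simp add: evl_hom)
  moreover have "vg (min (vp h) (vp h')) (h + h')"
    using vg_iff nz by (intro vg_add) auto
  ultimately have "min (vp h) (vp h') \<le> vp (h + h')" using vg_iff by blast
  then show "min (val x) (val y) \<le> val (x + y)"
    unfolding h evl_hom(1)[symmetric] val_evl .
next
  show "val ` (adjoin \<iota> \<beta> - {0}) = UNIV"
  proof (intro equalityI subsetI UNIV_I)
    fix k :: int
    \<comment> \<open>Division of \<open>k\<close> by \<open>n\<close> with remainder: the quotient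
      is the valuation of the coefficient, the remainder the exponent of the monomial.\<close>
    obtain c where c: "c \<noteq> 0" "w c = k div int n" using W.v_surj by blast
    define i where "i = nat (k mod int n)"
    have i: "int i = k mod int n" using n_pos by (simp add: i_def)
    have "val (evl (monom c i) \<beta>) = int n * (k div int n) + k mod int n"
      unfolding val_evl vp_monom(1)[OF c(1)] c(2) i ..
    then have "k = val (evl (monom c i) \<beta>)" by simp
    moreover have "evl (monom c i) \<beta> \<noteq> 0" using vp_monom(2)[OF c(1)] evl_eq_0_iff by blast
    ultimately show "k \<in> val ` (adjoin \<iota> \<beta> - {0})" by (intro image_eqI[of _ _ "evl (monom c i) \<beta>"] DiffI evl_adjoin) simp_all
  qed
qed

lemma val_base: "x \<noteq> 0 \<Longrightarrow> val (\<iota> x) = int n * w x"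
  using val_evl[of "[:x:]"] vp_monom(1)[of x 0] by (simp add: monom_0)

sublocale vs: vector_space "ext_scale \<iota>"
  by (rule vector_space_ext_scale)

lemma ext_degree_adjoin: "ext_degree \<iota> (adjoin \<iota> \<beta>) = n"
proof -
  have lin: "(\<Sum>i<n. \<iota> (c i) * \<beta> ^ i) = evl (\<Sum>i<n. monom (c i) i) \<beta>" for c
    by (simp add: hom_distribs poly_sum poly_monom)
  have coeff: "coeff (\<Sum>i<n. monom (c i) i) j = (if j < n then c j else 0)" for c :: "nat \<Rightarrow> 'k" and j
  proof -
    have "(\<Sum>i<n. coeff (monom (c i) i) j) = (\<Sum>i<n. if i = j then c j else 0)"
      by (rule sum.cong) auto
    then show ?thesis by (simp add: coeff_sum)
  qed
  have zero: "c j = 0" if "(\<Sum>i<n. \<iota> (c i) * \<beta> ^ i) = 0" "j < n" for c j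
  proof -
    let ?h = "\<Sum>i<n. monom (c i) i"
    have "degree ?h < n" using coeff[of c] n_pos
      by (intro le_less_trans[OF degree_le[of "n - 1"]]) auto
    then have "?h mod g = ?h" using gD by (intro mod_poly_less) simp
    moreover have "?h mod g = 0" using that(1) evl_eq_0_iff by (simp add: lin)
    ultimately show ?thesis using coeff[of c j] that(2) by simp
  qed
  let ?P = "(\<lambda>i. \<beta> ^ i) ` {..<n}"
  have inj: "inj_on (\<lambda>i. \<beta> ^ i) {..<n}"
  proof (rule inj_onI)
    fix i j assume ij: "i \<in> {..<n}" "j \<in> {..<n}" "\<beta> ^ i = \<beta> ^ j"
    have "val (\<beta> ^ i) = int i" for i using val_evl[of "monom 1 i"] vp_monom(1)[of 1 i]
      by (simp add: poly_monom W.v_one)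
    then have "int i = int j" using ij(3) by metis
    then show "i = j" by simp
  qed
  have "vs.independent ?P"
  proof (rule vs.independent_if_scalars_zero)
    fix f x assume f: "(\<Sum>x\<in>?P. \<iota> (f x) * x) = 0" "x \<in> ?P"
    have "(\<Sum>i<n. \<iota> (f (\<beta> ^ i)) * \<beta> ^ i) = 0" using f(1) by (simp add: sum.reindex[OF inj])
    then show "f x = 0" using zero[of "\<lambda>i. f (\<beta> ^ i)"] f(2) by auto
  qed simp
  moreover have "vs.span ?P = adjoin \<iota> \<beta>"
  proof
    have I: "x + y \<in> adjoin \<iota> \<beta>" "x * y \<in> adjoin \<iota> \<beta>" "\<iota> c \<in> adjoin \<iota> \<beta>"
      if "x \<in> adjoin \<iota> \<beta>" "y \<in> adjoin \<iota> \<beta>" for x y c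
      using intermediate_adjoin that unfolding intermediate_field_def by blast+
    have "0 \<in> adjoin \<iota> \<beta>" using evl_adjoin[of 0] by simp
    then have "vs.subspace (adjoin \<iota> \<beta>)" using I by (intro vs.subspaceI) blast+
    moreover have "?P \<subseteq> adjoin \<iota> \<beta>"
      using evl_adjoin[of "monom 1 i" for i] by (auto simp: poly_monom)
    ultimately show "vs.span ?P \<subseteq> adjoin \<iota> \<beta>" by (intro vs.span_minimal)
    show "adjoin \<iota> \<beta> \<subseteq> vs.span ?P"
    proof
      fix x assume "x \<in> adjoin \<iota> \<beta>"
      then obtain h where "x = evl h \<beta>" by (elim adjoinE)
      then have "x = evl (h mod g) \<beta>" using evl_eq_iff[of h "h mod g"] by simp
      then have "x = (\<Sum>i<n. \<iota> (coeff (h mod g) i) * \<beta> ^ i)"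
        using evl_sum_lessThan[OF degree_mod_g] by simp
      also have "\<dots> \<in> vs.span ?P"
        by (intro vs.span_sum vs.span_scale vs.span_base) auto
      finally show "x \<in> vs.span ?P" .
    qed
  qed
  ultimately have "vs.dim (adjoin \<iota> \<beta>) = card ?P" using vs.dim_span_eq_card_independent by metis
  then show ?thesis using inj by (simp add: ext_degree_def card_image)
qed

lemma totally_ramified_adjoin: "totally_ramified \<iota> w (adjoin \<iota> \<beta>)"
  unfolding totally_ramified_def has_ramification_index_def ext_degree_adjoin
  using intermediate_adjoin n_pos normalised_val val_base by blast

lemma root_adjoin: "\<beta> \<in> adjoin \<iota> \<beta>"
  using evl_adjoin[of "monom 1 1"] by (simp add: poly_monom)

end

section \<open>Hensel's lemma\<close>

locale local_field_residues = local_field w for w :: "'k::field \<Rightarrow> int" +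
  fixes R :: "'k set"
  assumes residues_base: "W.complete_system 1 R" and finite_residues_base: "finite R"
begin

sublocale WR: finite_valued_field UNIV w R
  by unfold_locales (rule residues_base finite_residues_base)+

end

locale mass_ext = ramified_ext w \<iota> E v n + separable_closure \<iota> + local_field_residues w R
  for w :: "'k::field \<Rightarrow> int" and \<iota> :: "'k \<Rightarrow> 'a::field" and E v n R
begin

text \<open>An integer of \<open>E\<close> is determined modulo \<alpha> by its coordinate of index
  0, so the residue field does not grow and both fields have the same q.\<close>

lemma residues_ext: "V.complete_system 1 (\<iota> ` R)"
proof -
  obtain \<alpha> where "unif \<alpha>" using unif_ex by blast
  then interpret U: uniformized_ext w \<iota> E v n \<alpha> by unfold_locales
  note R1 = W.complete_systemD[OF residues_base]
  show ?thesis
  proof (rule V.complete_systemI)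
    fix u assume "u \<in> \<iota> ` R"
    then show "u \<in> E \<and> val_ge v 0 u" using R1(2) base_mem vge_base0 by auto
  next
    fix x assume x: "x \<in> E" "val_ge v 0 x"
    then have c: "\<And>i. i < n \<Longrightarrow> val_ge w 0 (U.crd x i)" using U.vge0_crd by blast
    then obtain r where r: "r \<in> R" "val_ge w 1 (U.crd x 0 - r)" using R1(3)[of "U.crd x 0"] n_pos by auto
    have "U.crd (x - \<iota> r) i = 0 \<or> 1 \<le> int n * w (U.crd (x - \<iota> r) i) + int i" if i: "i < n" for i
    proof (cases "i = 0")
      case True
      then show ?thesis using r(2) i x n_pos mult_mono[of 1 "int n" 1 "w (U.crd x 0 - r)"]
        by (auto simp: U.crd_diff base_mem U.crd_base val_ge_def)
    next
      case False
      have "U.crd x i = 0 \<or> 0 \<le> int n * w (U.crd x i)" using c[OF i] by (auto simp: val_ge_def)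
      moreover have "1 \<le> int i" using False by simp
      moreover have "U.crd (x - \<iota> r) i = U.crd x i" using False i x by (simp add: U.crd_diff base_mem U.crd_base)
      ultimately show ?thesis by (simp only:) linarith
    qed
    then have "val_ge v 1 (x - \<iota> r)" using U.vge_crd x base_mem V.diff_mem by simp
    then show "\<exists>u\<in>\<iota> ` R. val_ge v (int 1) (x - u)" using r by auto
  next
    fix a b assume "a \<in> \<iota> ` R" "b \<in> \<iota> ` R" and ge: "val_ge v (int 1) (a - b)"
    then obtain r r' where r: "r \<in> R" "r' \<in> R" "a = \<iota> r" "b = \<iota> r'" by blast
    have "val_ge v 1 (\<iota> (r - r'))" using ge by (simp add: r hom_distribs)
    then have "r - r' = 0 \<or> 0 < int n * w (r - r')"
      using val_base[of "r - r'"] unfolding val_ge_def by force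
    then have "val_ge w 1 (r - r')" by (auto simp: val_ge_def zero_less_mult_iff)
    then show "a = b" using R1(4)[of r r'] r by simp
  qed
qed

sublocale VR: finite_valued_field E v "\<iota> ` R"
  by unfold_locales (use residues_ext finite_residues_base in auto)

lemma card_residues_ext: "card (\<iota> ` R) = card R"
  by (rule card_image) (auto intro: inj_onI)

definition disc_val :: int where "disc_val = ideal_val w (discriminant_ideal \<iota> w E)"

text \<open>\<open>disc_val\<close> involves neither \<alpha> nor \<open>g\<close>, so all
  uniformizers of \<open>E\<close> give g'(\<alpha>) the same valuation. The count relies on this
  uniformity.\<close>

lemma different_val:
  assumes "unif \<alpha>" "eisenstein w n g" "evl g \<alpha> = 0"
  shows "evl (pderiv g) \<alpha> \<noteq> 0" "v (evl (pderiv g) \<alpha>) = disc_val"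
proof -
  interpret U: generated_ext w \<iota> E v n \<alpha> g by unfold_locales (use assms in auto)
  have 1: "U.different \<noteq> 0" using U.different_nonzero separable by blast
  then show "evl (pderiv g) \<alpha> \<noteq> 0" by (simp add: U.different_def)
  show "v (evl (pderiv g) \<alpha>) = disc_val"
    using U.ideal_val_discriminant[OF 1] by (simp add: disc_val_def U.different_def)
qed

lemma integral_eisenstein: "eisenstein w n g \<Longrightarrow> V.integral_poly (map_poly \<iota> g)"
proof (rule integral_map_poly)
  fix i assume g: "eisenstein w n g"
  show "val_ge w 0 (coeff g i)"
  proof (cases "i < n")
    case True
    then have "val_ge w 1 (coeff g i)" using g by (auto simp: eisenstein_def)
    then show ?thesis by (rule W.vge_mono) simp
  next
    case False
    then show ?thesis using g W.vge_one by (cases "i = n") (auto simp: eisenstein_def coeff_eq_0)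
  qed
qed

lemma disc_val_nonneg: "disc_val \<ge> 0"
proof -
  obtain \<alpha> where a: "unif \<alpha>" using unif_ex by blast
  then interpret U: uniformized_ext w \<iota> E v n \<alpha> by unfold_locales
  obtain g where g: "eisenstein w n g" "evl g \<alpha> = 0" using U.min_poly_ex by blast
  have "val_ge v 0 (poly (pderiv (map_poly \<iota> g)) \<alpha>)"
    using V.poly_integral[OF V.integral_poly_pderiv[OF integral_eisenstein[OF g(1)]]] U.unifD
      unif_vge0[OF a] by blast
  then show ?thesis using different_val[OF a g] by (auto simp: hom_distribs val_ge_def)
qed

text \<open>Newton iteration. As s > d, a correction of valuation \<open>s\<close> or more preserves
  the valuation \<open>d\<close> of the derivative, and the quadratic remainder has valuation at
  least 2 (s + k) \<ge> d + s + k + 1, so each step gains at least one order.\<close>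

lemma hensel:
  fixes d s :: nat
  assumes p: "V.integral_poly p" and x: "x \<in> E" "val_ge v 0 x"
    and d: "poly (pderiv p) x \<noteq> 0" "v (poly (pderiv p) x) = int d"
    and ge: "val_ge v (int (d + s)) (poly p x)" and ds: "d < s"
  shows "\<exists>y\<in>E. val_ge v (int s) (y - x) \<and> poly p y = 0"
proof -
  obtain \<alpha> where "unif \<alpha>" using unif_ex by blast
  then interpret U: uniformized_ext w \<iota> E v n \<alpha> by unfold_locales
  note ip = V.integral_poly_pderiv[OF p]
  define nx where "nx y = y - poly p y / poly (pderiv p) y" for y
  define I where "I y k \<longleftrightarrow> y \<in> E \<and> val_ge v 0 y \<and> poly (pderiv p) y \<noteq> 0 \<and>
    v (poly (pderiv p) y) = int d \<and> val_ge v (int (d + s + k)) (poly p y)" for y k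
  have step: "I (nx y) (Suc k) \<and> val_ge v (int (s + k)) (nx y - y)" if "I y k" for y k
  proof -
    let ?D = "poly (pderiv p) y" and ?h = "- (poly p y / poly (pderiv p) y)"
    have y: "y \<in> E" "val_ge v 0 y" "?D \<noteq> 0" "v ?D = int d" "val_ge v (int (d + s + k)) (poly p y)"
      using that by (auto simp: I_def)
    note yi = V.poly_integral[OF p y(1,2)] V.poly_integral[OF ip y(1,2)]
    have hE: "?h \<in> E" using yi by (intro V.mem_intros) auto
    have "val_ge v (int (d + s + k)) (?D * ?h)" using y yi by (simp add: V.vge_uminus)
    then have h: "val_ge v (int (s + k)) ?h"
      using V.vge_mult_iff[of ?D ?h "int (d + s + k)"] yi hE y by simp
    then have h0: "val_ge v 0 ?h" by (rule V.vge_mono) simp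
    have z: "nx y = y + ?h" by (simp add: nx_def)
    have zE: "nx y \<in> E" "val_ge v 0 (nx y)" unfolding z
      using V.add_mem[OF y(1) hE] V.vge_add[OF y(1) hE y(2) h0] by blast+
    obtain r where r: "r \<in> E" "val_ge v 0 r" "poly p (y + ?h) = poly p y + ?h * ?D + ?h\<^sup>2 * r"
      using V.poly_taylor[OF p y(1,2) hE h0] by blast
    have "poly p (nx y) = ?h * (?h * r)" using y(3) r(3) unfolding z by (simp add: power2_eq_square)
    moreover have "val_ge v (int (s + k) + (int (s + k) + 0)) (?h * (?h * r))"
      using h hE r by (intro V.vge_mult V.mult_mem)
    ultimately have pz: "val_ge v (int (d + s + Suc k)) (poly p (nx y))"
      using ds by (auto elim: V.vge_mono)
    have "val_ge v (int (s + k)) (nx y - y)" using h by (simp add: z)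
    moreover have "poly (pderiv p) (nx y) \<noteq> 0 \<and> v (poly (pderiv p) (nx y)) = v ?D"
    proof (rule V.v_perturb)
      show "val_ge v (v ?D + 1) (poly (pderiv p) (nx y) - ?D)"
        using V.poly_lipschitz[OF ip y(1,2) zE, of "int (s + k)"] calculation ds y(4)
        by (auto elim: V.vge_mono)
    qed (use y yi V.poly_integral[OF ip zE] in auto)
    ultimately show ?thesis using zE pz y(4) by (simp add: I_def)
  qed
  define X where "X k = (nx ^^ k) x" for k
  have I: "I (X k) k" for k
    by (induction k) (use step x d ge in \<open>auto simp: X_def I_def[of x]\<close>)
  have XS: "val_ge v (int (s + k)) (X (Suc k) - X k)" for k
    using step[OF I[of k]] by (simp add: X_def)
  have XE: "X k \<in> E" "val_ge v 0 (X k)" for k using I by (auto simp: I_def)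
  obtain l where l: "l \<in> E" "\<And>k. val_ge v (int k) (l - X k)"
    using U.complete_E[of X] XE XS V.vge_mono by (metis (no_types, lifting) le_add2 of_nat_le_iff)
  have X0: "val_ge v (int s) (X k - x)" for k
  proof (induction k)
    case (Suc k)
    have "val_ge v (int s) ((X (Suc k) - X k) + (X k - x))"
      using Suc XE x XS[of k] by (intro V.vge_add V.diff_mem) (auto elim: V.vge_mono)
    then show ?case by simp
  qed (simp add: X_def)
  have lx: "val_ge v (int s) (l - x)"
  proof -
    have "val_ge v (int s) ((l - X s) + (X s - x))"
      using l XE x X0 by (intro V.vge_add V.diff_mem) auto
    then show ?thesis by simp
  qed
  have l0: "val_ge v 0 l"
    using V.vge_add[of "l - X 0" "X 0" 0] l(2)[of 0] XE l(1) by (simp add: V.diff_mem)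
  have "poly p l = 0"
  proof (rule V.vge_all_imp_0)
    fix k
    have "val_ge v (int k) (poly p l - poly p (X k))"
      using V.poly_lipschitz[OF p XE l(1) l0 l(2)] .
    moreover have "val_ge v (int k) (poly p (X k))" using I[of k] by (auto simp: I_def elim: V.vge_mono)
    ultimately have "val_ge v (int k) ((poly p l - poly p (X k)) + poly p (X k))"
      using V.poly_integral[OF p] XE l(1) l0 by (intro V.vge_add V.diff_mem) auto
    then show "val_ge v (int k) (poly p l)" by simp
  qed
  then show ?thesis using l lx by blast
qed

end

section \<open>Counting Eisenstein polynomials and their roots\<close>

definition monic_polys :: "nat \<Rightarrow> (nat \<Rightarrow> 'a::comm_ring_1 set) \<Rightarrow> 'a poly set" where
  "monic_polys n A = {g. degree g = n \<and> lead_coeff g = 1 \<and> (\<forall>i<n. coeff g i \<in> A i)}"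

lemma bij_betw_monic_poly: "bij_betw (monic_poly n) (PiE {..<n} A) (monic_polys n A)"
  unfolding bij_betw_def
proof
  show "inj_on (monic_poly n) (PiE {..<n} A)"
  proof (rule inj_onI)
    fix a b assume ab: "a \<in> PiE {..<n} A" "b \<in> PiE {..<n} A" "monic_poly n a = monic_poly n b"
    show "a = b"
    proof (rule PiE_ext[OF ab(1,2)])
      fix i assume "i \<in> {..<n}"
      then show "a i = b i" using arg_cong[OF ab(3), of "\<lambda>p. coeff p i"] by (simp add: coeff_monic_poly)
    qed
  qed
  show "monic_poly n ` PiE {..<n} A = monic_polys n A"
  proof
    show "monic_poly n ` PiE {..<n} A \<subseteq> monic_polys n A"
    proof (rule image_subsetI)
      fix a assume "a \<in> PiE {..<n} A"
      then have "a i \<in> A i" if "i < n" for i using PiE_mem that by (metis lessThan_iff)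
      then show "monic_poly n a \<in> monic_polys n A"
        by (simp add: monic_polys_def degree_monic_poly coeff_monic_poly)
    qed
    show "monic_polys n A \<subseteq> monic_poly n ` PiE {..<n} A"
    proof
      fix g assume g: "g \<in> monic_polys n A"
      have "g = monic_poly n (restrict (coeff g) {..<n})"
        using g by (intro poly_eqI) (auto simp: monic_polys_def coeff_monic_poly coeff_eq_0)
      moreover have "restrict (coeff g) {..<n} \<in> PiE {..<n} A" using g by (auto simp: monic_polys_def)
      ultimately show "g \<in> monic_poly n ` PiE {..<n} A" by blast
    qed
  qed
qed

lemma card_monic_polys: "card (monic_polys n A) = (\<Prod>i<n. card (A i))"
  using bij_betw_same_card[OF bij_betw_monic_poly[of n A]] by (simp add: card_PiE)

lemma finite_monic_polys: "(\<And>i. i < n \<Longrightarrow> finite (A i)) \<Longrightarrow> finite (monic_polys n A)"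
  using bij_betw_finite[OF bij_betw_monic_poly[of n A]] by (auto intro: finite_PiE)

lemma monic_polys_restrict:
  assumes "j < n"
  shows "{g \<in> monic_polys n A. coeff g j \<in> B} = monic_polys n (A(j := A j \<inter> B))"
proof -
  have "(\<forall>i<n. c i \<in> (A(j := A j \<inter> B)) i) \<longleftrightarrow> (\<forall>i<n. c i \<in> A i) \<and> c j \<in> B" for c
    using assms unfolding fun_upd_apply by (metis IntE IntI)
  then show ?thesis unfolding monic_polys_def by blast
qed

lemma sum_card_swap:
  assumes "finite S" "finite T"
  shows "(\<Sum>y\<in>T. card {x\<in>S. P x y}) = (\<Sum>x\<in>S. card {y\<in>T. P x y})"
proof -
  have "(\<Sum>y\<in>T. card {x\<in>S. P x y}) = (\<Sum>y\<in>T. \<Sum>x\<in>S. if P x y then 1 else 0)"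
    unfolding card_eq_sum by (simp only: sum.inter_filter[OF assms(1)])
  also have "\<dots> = (\<Sum>x\<in>S. \<Sum>y\<in>T. if P x y then 1 else 0)" by (rule sum.swap)
  also have "\<dots> = (\<Sum>x\<in>S. card {y\<in>T. P x y})"
    unfolding card_eq_sum by (simp only: sum.inter_filter[OF assms(2)])
  finally show ?thesis .
qed

text \<open>For a complete system \<open>U\<close> of precision at least 2 this contains one
  polynomial from each congruence class of Eisenstein polynomials.\<close>

definition eis_polys :: "('k::field \<Rightarrow> int) \<Rightarrow> nat \<Rightarrow> 'k set \<Rightarrow> 'k poly set" where
  "eis_polys w n U = {g. eisenstein w n g \<and> (\<forall>i<n. coeff g i \<in> U)}"

context local_field_residues
begin

lemma card_complete_system_ge:
  assumes "W.complete_system L U"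
  shows "k \<le> L \<Longrightarrow> card {u\<in>U. val_ge w (int k) u} = card R ^ (L - k)"
    and "finite U"
  using WR.complete_system_coset_card[OF assms, of k 0] WR.complete_system_card[OF assms] by auto

lemma eis_polys_eq:
  assumes "n > 0"
  shows "eis_polys w n U =
    monic_polys n ((\<lambda>_. {u\<in>U. val_ge w 1 u})(0 := {u\<in>U. u \<noteq> 0 \<and> w u = 1}))" (is "_ = monic_polys n ?A")
proof (rule Set.set_eqI)
  fix g
  show "g \<in> eis_polys w n U \<longleftrightarrow> g \<in> monic_polys n ?A"
  proof
    assume L: "g \<in> eis_polys w n U"
    have "coeff g i \<in> ?A i" if "i < n" for i
      using L that by (cases "i = 0") (auto simp: eis_polys_def eisenstein_def)
    then show "g \<in> monic_polys n ?A"
      using L unfolding eis_polys_def eisenstein_def monic_polys_def by blast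
  next
    assume R: "g \<in> monic_polys n ?A"
    then have A: "coeff g i \<in> ?A i" if "i < n" for i using that unfolding monic_polys_def by blast
    have "coeff g i \<in> U \<and> val_ge w 1 (coeff g i)" if "i < n" for i
      using A[OF that] by (cases "i = 0") (auto simp: val_ge_def)
    moreover have "coeff g 0 \<noteq> 0 \<and> w (coeff g 0) = 1" using A[OF assms] by simp
    ultimately show "g \<in> eis_polys w n U"
      using R unfolding eis_polys_def eisenstein_def monic_polys_def by blast
  qed
qed

lemma finite_eis_polys:
  assumes "n > 0" "W.complete_system L U"
  shows "finite (eis_polys w n U)"
  unfolding eis_polys_eq[OF assms(1)]
  by (rule finite_monic_polys) (use card_complete_system_ge(2)[OF assms(2)] in auto)

lemma card_eis_polys:
  assumes "n > 0" "W.complete_system L U" "L \<ge> 2"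
  shows "card (eis_polys w n U) = (card R ^ (L - 1) - card R ^ (L - 2)) * (card R ^ (L - 1)) ^ (n - 1)"
proof -
  obtain m where m: "n = Suc m" using assms(1) by (cases n) auto
  show ?thesis
    unfolding eis_polys_eq[OF assms(1)] card_monic_polys unfolding m prod.lessThan_Suc_shift
    using WR.complete_system_unif_card[OF assms(2,3)] card_complete_system_ge(1)[OF assms(2), of 1] assms(3)
    by simp
qed

text \<open>The coefficients vary independently, and among the representatives in the maximal ideal
  a proportion q^(-M) has valuation above \<open>M\<close>. With \<open>n \<ge> 2\<close> the linear
  coefficient is neither the constant nor the leading one.\<close>

lemma card_eis_polys_tail:
  assumes "n \<ge> 2" "W.complete_system L U" "Suc M \<le> L" "L \<ge> 2"
  shows "card {g \<in> eis_polys w n U. val_ge w (int (Suc M)) (coeff g 1)} * card R ^ M = card (eis_polys w n U)"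
proof -
  obtain m where m: "n = Suc (Suc m)" using assms(1) by (metis add_2_eq_Suc le_Suc_ex)
  have n0: "n > 0" using assms by simp
  let ?V = "{u\<in>U. val_ge w 1 u}" and ?B = "{u. val_ge w (int (Suc M)) u}"
  have VB: "?V \<inter> ?B = {u\<in>U. val_ge w (int (Suc M)) u}"
    by (auto elim: W.vge_mono)
  have tail: "{g \<in> eis_polys w n U. val_ge w (int (Suc M)) (coeff g 1)} =
      monic_polys n ((\<lambda>_. ?V)(0 := {u\<in>U. u \<noteq> 0 \<and> w u = 1}, 1 := ?V \<inter> ?B))"
    using monic_polys_restrict[of 1 n "(\<lambda>_. ?V)(0 := {u\<in>U. u \<noteq> 0 \<and> w u = 1})" ?B] m
    unfolding eis_polys_eq[OF n0] by simp
  have "card {g \<in> eis_polys w n U. val_ge w (int (Suc M)) (coeff g 1)} =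
      (card R ^ (L - 1) - card R ^ (L - 2)) * (card R ^ (L - Suc M) * (card R ^ (L - 1)) ^ m)"
    unfolding tail VB card_monic_polys unfolding m prod.lessThan_Suc_shift
    using WR.complete_system_unif_card[OF assms(2,4)] card_complete_system_ge(1)[OF assms(2), of 1]
      card_complete_system_ge(1)[OF assms(2,3)] assms(4)
    by simp
  moreover have "card R ^ (L - Suc M) * card R ^ M = card R ^ (L - 1)"
    using assms(3) by (simp add: power_add[symmetric])
  ultimately show ?thesis
    unfolding card_eis_polys[OF n0 assms(2,4)] unfolding m by (simp add: mult_ac)
qed

end

section \<open>Pairs of a uniformizer and an Eisenstein polynomial\<close>

context mass_ext
begin

text \<open>The lower part of g(\<alpha>) runs through the coset of -\<alpha>^n modulo the
  \<open>k\<close>-th power, within a complete system of precision n L. As k > n, every member of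
  that coset has valuation exactly \<open>n\<close>, so by \<open>lincomb_val_n\<close> its
  coefficients are those of an Eisenstein polynomial.\<close>

lemma card_eis_polys_near:
  assumes \<alpha>: "unif \<alpha>" and U: "W.complete_system L U" and k: "n < k" "k \<le> n * L"
  shows "card {g \<in> eis_polys w n U. val_ge v (int k) (evl g \<alpha>)} = card R ^ (n * L - k)"
proof -
  interpret A: uniformized_ext w \<iota> E v n \<alpha> using \<alpha> by unfold_locales
  let ?s = "\<lambda>a. \<Sum>i<n. \<iota> (a i) * \<alpha> ^ i"
  let ?S = "{?s a | a. \<forall>i<n. a i \<in> U}"
  let ?G = "{g \<in> eis_polys w n U. val_ge v (int k) (evl g \<alpha>)}"
  let ?B = "{u \<in> ?S. val_ge v (int k) (u - (- (\<alpha> ^ n)))}"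
  have nE: "\<alpha> ^ n \<in> E" "val_ge v 0 (\<alpha> ^ n)" "\<alpha> ^ n \<noteq> 0" "v (\<alpha> ^ n) = int n"
    using A.unifD by (simp_all add: V.power_mem V.v_power val_ge_def)
  have ev: "evl g \<alpha> = ?s (coeff g) - (- (\<alpha> ^ n))" if "eisenstein w n g" for g
    using evl_monic[of g n \<alpha>] that by (auto simp: eisenstein_def)
  have "bij_betw (\<lambda>g. ?s (coeff g)) ?G ?B"
    unfolding bij_betw_def
  proof
    show "inj_on (\<lambda>g. ?s (coeff g)) ?G"
    proof (rule inj_onI)
      fix g h assume gh: "g \<in> ?G" "h \<in> ?G" "?s (coeff g) = ?s (coeff h)"
      then have "coeff g i = coeff h i" if "i < n" for i
        using A.crd_unique[OF that, of "coeff g"] A.crd_unique[OF that, of "coeff h"] by simp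
      then have "monic_poly n (coeff g) = monic_poly n (coeff h)"
        by (intro poly_eqI) (auto simp: coeff_monic_poly)
      moreover have "monic_poly n (coeff g) = g" "monic_poly n (coeff h) = h"
        using gh eisenstein_monic_poly by (auto simp: eis_polys_def)
      ultimately show "g = h" by simp
    qed
    show "(\<lambda>g. ?s (coeff g)) ` ?G = ?B"
    proof
      show "(\<lambda>g. ?s (coeff g)) ` ?G \<subseteq> ?B"
      proof
        fix u assume "u \<in> (\<lambda>g. ?s (coeff g)) ` ?G"
        then obtain g where g: "g \<in> ?G" "u = ?s (coeff g)" by blast
        then have "eisenstein w n g" "\<forall>i<n. coeff g i \<in> U" "val_ge v (int k) (evl g \<alpha>)"
          by (auto simp: eis_polys_def)
        then have c: "?s (coeff g) \<in> ?S" "val_ge v (int k) (?s (coeff g) - (- (\<alpha> ^ n)))"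
          using ev[of g] by (auto simp del: diff_minus_eq_add)
        show "u \<in> ?B" unfolding g(2) by (rule CollectI, rule conjI, fact c(1), fact c(2))
      qed
      show "?B \<subseteq> (\<lambda>g. ?s (coeff g)) ` ?G"
      proof
        fix u assume "u \<in> ?B"
        then obtain a where a: "u = ?s a" "\<forall>i<n. a i \<in> U" "val_ge v (int k) (u - (- (\<alpha> ^ n)))" by blast
        have uE: "u \<in> E" unfolding a(1) by (rule A.lincomb_mem)
        have "u \<noteq> 0 \<and> v u = v (- (\<alpha> ^ n))"
        proof (rule V.v_perturb)
          show "val_ge v (v (- (\<alpha> ^ n)) + 1) (u - (- (\<alpha> ^ n)))"
            using a(3) k(1) nE by (elim V.vge_mono) (simp add: V.v_uminus)
        qed (use nE uE in \<open>auto intro: V.uminus_mem\<close>)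
        then have u: "u \<noteq> 0" "v u = int n" using nE by (simp_all add: V.v_uminus)
        note L = A.lincomb_val_n[OF a(1) u]
        let ?g = "monic_poly n a"
        have "eisenstein w n ?g"
          using L n_pos by (auto simp: eisenstein_def degree_monic_poly coeff_monic_poly)
        moreover have s: "?s (coeff ?g) = u" unfolding a(1) by (intro sum.cong) (auto simp: coeff_monic_poly)
        ultimately have "?g \<in> ?G" using a ev[of ?g] by (auto simp: eis_polys_def coeff_monic_poly)
        then show "u \<in> (\<lambda>g. ?s (coeff g)) ` ?G" using s by blast
      qed
    qed
  qed
  then have "card ?G = card ?B" by (rule bij_betw_same_card)
  also have "\<dots> = card (\<iota> ` R) ^ (n * L - k)"
    by (rule VR.complete_system_coset_card[OF A.complete_system_lincomb[OF U] k(2)])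
       (use nE in \<open>auto simp: V.vge_uminus intro: V.uminus_mem\<close>)
  finally show ?thesis by (simp add: card_residues_ext)
qed

text \<open>If \<open>g(\<alpha>)\<close> is small then \<open>g'(\<alpha>)\<close> has the same valuation as \<open>f'(\<alpha>)\<close>, \<open>f\<close> being the minimal
  polynomial of \<open>\<alpha>\<close>; hence Hensel's lemma applies to \<open>g\<close> at \<open>\<alpha>\<close>.\<close>

lemma near_root_derivative:
  assumes \<alpha>: "unif \<alpha>" and g: "eisenstein w n g" and ge: "val_ge v (disc_val + 2) (evl g \<alpha>)"
  shows "evl (pderiv g) \<alpha> \<noteq> 0 \<and> v (evl (pderiv g) \<alpha>) = disc_val"
proof -
  interpret A: uniformized_ext w \<iota> E v n \<alpha> using \<alpha> by unfold_locales
  obtain f where f: "eisenstein w n f" "evl f \<alpha> = 0" using A.min_poly_ex by blast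
  note D = different_val[OF \<alpha> f]
  let ?a = "\<lambda>i. coeff g i - coeff f i"
  have "evl g \<alpha> - evl f \<alpha> = (\<Sum>i<n. \<iota> (?a i) * \<alpha> ^ i)"
    by (simp add: evl_monic[OF eisensteinD(1,2)[OF g]] evl_monic[OF eisensteinD(1,2)[OF f(1)]]
        hom_distribs algebra_simps sum_subtractf)
  then have "val_ge v (disc_val + 2) (\<Sum>i<n. \<iota> (?a i) * \<alpha> ^ i)" using ge f(2) by simp
  then have ai: "val_ge v (disc_val + 2) (\<iota> (?a i) * \<alpha> ^ i)" if "i < n" for i
    using A.vge_lincomb[of "disc_val + 2" ?a] A.vge_term[of "disc_val + 2" "?a i" i] that by auto
  have "evl (pderiv g) \<alpha> - evl (pderiv f) \<alpha> = (\<Sum>i<n. \<iota> (of_nat (Suc i) * ?a (Suc i)) * \<alpha> ^ i)"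
    unfolding evl_pderiv[OF eisensteinD(1)[OF g] n_pos] evl_pderiv[OF eisensteinD(1)[OF f(1)] n_pos]
    by (simp add: hom_distribs algebra_simps sum_subtractf del: of_nat_Suc)
  moreover have "val_ge v (disc_val + 1) (\<iota> (of_nat (Suc i) * ?a (Suc i)) * \<alpha> ^ i)" if i: "i < n" for i
  proof (cases "Suc i = n")
    case True
    then show ?thesis using eisensteinD(3)[OF g] eisensteinD(3)[OF f(1)] by (simp del: of_nat_Suc)
  next
    case False
    then have "val_ge v (disc_val + 2) (\<iota> (?a (Suc i)) * \<alpha> ^ Suc i)" using i by (intro ai) simp
    \<comment> \<open>Passing from \<alpha>^(i+1) to \<alpha>^i costs one unit. So the bound
      \<open>disc_val + 2\<close> on the values leaves \<open>disc_val + 1\<close> for the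
      derivatives, just above the valuation of f'(\<alpha>).\<close>
    then have "val_ge v (disc_val + 1) (\<iota> (?a (Suc i)) * \<alpha> ^ i)" unfolding A.vge_term by auto
    then have "val_ge v (disc_val + 1) (\<iota> (of_nat (Suc i)) * (\<iota> (?a (Suc i)) * \<alpha> ^ i))"
      using W.vge_of_nat[of "Suc i"] by (intro V.vge_mult0[OF base_mem A.term_mem]) (simp_all only: vge_base0)
    then show ?thesis by (simp add: hom_distribs mult.assoc del: of_nat_Suc)
  qed
  ultimately have "val_ge v (disc_val + 1) (evl (pderiv g) \<alpha> - evl (pderiv f) \<alpha>)"
    using A.term_mem by (simp only:) (intro V.vge_sum conjI; simp del: of_nat_Suc)
  then show ?thesis
    using V.v_perturb[of "evl (pderiv f) \<alpha>" "evl (pderiv g) \<alpha>"] D evl_mem A.unifD by simp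
qed

text \<open>A root is sent to its representative modulo the \<open>s\<close>-th power, again a
  uniformizer as \<open>2 \<le> s\<close>. By Taylor expansion at \<beta>, two roots congruent to
  that precision would force v(g'(\<beta>)) \<ge> s > d, and the representative has v(g(\<alpha>))
  \<ge> d + s; Hensel's lemma gives surjectivity.\<close>

lemma card_roots_eq:
  fixes d s :: nat
  assumes g: "eisenstein w n g" and d: "disc_val = int d" and s: "d < s" "2 \<le> s"
    and S: "V.complete_system s S"
  shows "card {\<beta>\<in>E. evl g \<beta> = 0} = card {\<alpha> \<in> {\<alpha> \<in> S. unif \<alpha>}. val_ge v (int (d + s)) (evl g \<alpha>)}"
    (is "card ?A = card ?B")
proof -
  let ?P = "map_poly \<iota> g"
  note ip = integral_eisenstein[OF g]
  have P': "pderiv ?P = map_poly \<iota> (pderiv g)" by (simp add: hom_distribs)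
  note S1 = V.complete_systemD[OF S]
  define f where "f \<beta> = (SOME \<alpha>. \<alpha> \<in> S \<and> val_ge v (int s) (\<beta> - \<alpha>))" for \<beta>
  have root: "unif \<beta>" "\<beta> \<in> E" "val_ge v 0 \<beta>" "evl (pderiv g) \<beta> \<noteq> 0" "v (evl (pderiv g) \<beta>) = int d"
    if "\<beta> \<in> ?A" for \<beta>
  proof -
    show u: "unif \<beta>" "\<beta> \<in> E" using eisenstein_root_unif[OF g] that by auto
    show "val_ge v 0 \<beta>" using unif_vge0[OF u(1)] .
    show "evl (pderiv g) \<beta> \<noteq> 0" "v (evl (pderiv g) \<beta>) = int d"
      using different_val[OF u(1) g] that d by auto
  qed
  have f: "f \<beta> \<in> S" "val_ge v (int s) (\<beta> - f \<beta>)" if "\<beta> \<in> ?A" for \<beta>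
  proof -
    have "\<exists>\<alpha>. \<alpha> \<in> S \<and> val_ge v (int s) (\<beta> - \<alpha>)" using S1(3)[OF root(2,3)[OF that]] by blast
    from someI_ex[OF this] show "f \<beta> \<in> S" "val_ge v (int s) (\<beta> - f \<beta>)" by (auto simp: f_def)
  qed
  have taylor: "\<exists>r\<in>E. val_ge v 0 r \<and> evl g y = (y - \<beta>) * (evl (pderiv g) \<beta> + (y - \<beta>) * r)"
    if "\<beta> \<in> ?A" "y \<in> E" "val_ge v 0 (y - \<beta>)" for \<beta> y
    using V.poly_taylor[OF ip root(2,3)[OF that(1)], of "y - \<beta>"] that root(2)[OF that(1)] P'
    by (auto simp: V.diff_mem algebra_simps power2_eq_square)
  have "bij_betw f ?A ?B"
    unfolding bij_betw_def
  proof
    show "inj_on f ?A"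
    proof (rule inj_onI)
      fix \<beta> \<gamma> assume bc: "\<beta> \<in> ?A" "\<gamma> \<in> ?A" "f \<beta> = f \<gamma>"
      have m: "\<beta> \<in> E" "\<gamma> \<in> E" "f \<gamma> \<in> E" using bc(1,2) S1(1)[OF f(1)[OF bc(2)]] by auto
      have "val_ge v (int s) ((\<gamma> - f \<gamma>) - (\<beta> - f \<gamma>))"
        by (rule V.vge_diff) (use f(2)[OF bc(1)] f(2)[OF bc(2)] bc(3) m V.diff_mem in auto)
      then have ge: "val_ge v (int s) (\<gamma> - \<beta>)" by simp
      then have "val_ge v 0 (\<gamma> - \<beta>)" by (rule V.vge_mono) simp
      then obtain r where r: "r \<in> E" "val_ge v 0 r"
        "evl g \<gamma> = (\<gamma> - \<beta>) * (evl (pderiv g) \<beta> + (\<gamma> - \<beta>) * r)" using taylor[OF bc(1) m(2)] by blast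
      show "\<beta> = \<gamma>"
      proof (rule ccontr)
        assume "\<beta> \<noteq> \<gamma>"
        then have eq: "evl (pderiv g) \<beta> = - ((\<gamma> - \<beta>) * r)" using r(3) bc(2) by (simp add: eq_neg_iff_add_eq_0)
        have "val_ge v (int s + 0) ((\<gamma> - \<beta>) * r)" using ge r m by (intro V.vge_mult V.diff_mem)
        then have "val_ge v (int s) (evl (pderiv g) \<beta>)"
          unfolding eq using r m by (simp add: V.vge_uminus V.mult_mem V.diff_mem)
        then show False using root(4,5)[OF bc(1)] s(1) by (simp add: val_ge_def)
      qed
    qed
    show "f ` ?A = ?B"
    proof
      show "f ` ?A \<subseteq> ?B"
      proof
        fix \<alpha> assume "\<alpha> \<in> f ` ?A"
        then obtain \<beta> where b: "\<beta> \<in> ?A" "\<alpha> = f \<beta>" by blast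
        have m: "\<beta> \<in> E" "\<alpha> \<in> E" using b S1(1)[OF f(1)[OF b(1)]] by auto
        have ge: "val_ge v (int s) (\<alpha> - \<beta>)" using f(2)[OF b(1)] b(2) m V.vge_diff_commute by blast
        have "\<alpha> \<noteq> 0 \<and> v \<alpha> = v \<beta>"
          by (rule V.v_perturb[OF m]) (use root(1)[OF b(1)] s(2) V.vge_mono[OF ge, of 2] in \<open>auto simp: unif_def\<close>)
        then have u: "unif \<alpha>" using root(1)[OF b(1)] m by (simp add: unif_def)
        have "val_ge v 0 (\<alpha> - \<beta>)" using ge by (rule V.vge_mono) simp
        then obtain r where r: "r \<in> E" "val_ge v 0 r"
          "evl g \<alpha> = (\<alpha> - \<beta>) * (evl (pderiv g) \<beta> + (\<alpha> - \<beta>) * r)" using taylor[OF b(1) m(2)] by blast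
        have "val_ge v (int s + 0) ((\<alpha> - \<beta>) * r)" using ge r m by (intro V.vge_mult V.diff_mem)
        then have "val_ge v (int d) ((\<alpha> - \<beta>) * r)" by (rule V.vge_mono) (use s in simp)
        moreover have "val_ge v (int d) (evl (pderiv g) \<beta>)" using root(5)[OF b(1)] by (simp add: val_ge_def)
        ultimately have "val_ge v (int d) (evl (pderiv g) \<beta> + (\<alpha> - \<beta>) * r)"
          using m r by (intro V.vge_add V.mult_mem V.diff_mem evl_mem)
        then have "val_ge v (int s + int d) (evl g \<alpha>)"
          unfolding r(3) using ge m r by (intro V.vge_mult V.add_mem V.mult_mem V.diff_mem evl_mem)
        then show "\<alpha> \<in> ?B" using u f(1)[OF b(1)] b(2) by (simp add: add.commute)
      qed
      show "?B \<subseteq> f ` ?A"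
      proof
        fix \<alpha> assume "\<alpha> \<in> ?B"
        then have a: "\<alpha> \<in> S" "unif \<alpha>" "val_ge v (int (d + s)) (evl g \<alpha>)" by auto
        have aE: "\<alpha> \<in> E" "val_ge v 0 \<alpha>" using a S1 by auto
        have "val_ge v (disc_val + 2) (evl g \<alpha>)" using a(3) by (rule V.vge_mono) (use d s in simp)
        note D = near_root_derivative[OF a(2) g this]
        obtain \<beta> where b: "\<beta> \<in> E" "val_ge v (int s) (\<beta> - \<alpha>)" "evl g \<beta> = 0"
          using hensel[OF ip aE _ _ a(3) s(1)] D d by (auto simp: P')
        then have bA: "\<beta> \<in> ?A" by simp
        have fE: "f \<beta> \<in> E" using f(1)[OF bA] S1(1) by simp
        have "val_ge v (int s) ((\<beta> - \<alpha>) - (\<beta> - f \<beta>))"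
          by (rule V.vge_diff) (use b aE fE f(2)[OF bA] V.diff_mem in auto)
        then have "f \<beta> = \<alpha>" using S1(4)[OF f(1)[OF bA] a(1)] by simp
        then show "\<alpha> \<in> f ` ?A" using bA by blast
      qed
    qed
  qed
  then show ?thesis by (rule bij_betw_same_card)
qed

lemma sum_card_roots:
  assumes U: "W.complete_system (2 * D + n + 2) U" and D: "disc_val \<le> int D"
  shows "(\<Sum>g\<in>eis_polys w n U. real (card {\<beta>\<in>E. evl g \<beta> = 0})) =
    real (card (eis_polys w n U)) * real (card R) powi (- disc_excess \<iota> w E)"
proof -
  define q where "q = card R"
  have q: "q \<ge> 2" unfolding q_def by (rule WR.card_residues_ge_2)
  define L where "L = 2 * D + n + 2"
  define d where "d = nat disc_val"
  have d: "disc_val = int d" "d \<le> D" using D disc_val_nonneg by (auto simp: d_def)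
  \<comment> \<open>This exceeds every d \<le> D and keeps d + s above \<open>n\<close>, while
    \<open>L\<close> was chosen to make d + s \<le> L \<le> n L.\<close>
  define s where "s = D + n + 2"
  have s: "d < s" "2 \<le> s" using d by (auto simp: s_def)
  have L2: "L \<ge> 2" by (simp add: L_def)
  have "1 * L \<le> n * L" using n_pos by (intro mult_right_mono) auto
  then have k: "n < d + s" "d + s \<le> n * L" using d by (auto simp: s_def L_def)
  obtain S where S: "V.complete_system s S" "finite S" using VR.complete_system_ex by blast
  let ?G = "eis_polys w n U" and ?S = "{\<alpha> \<in> S. unif \<alpha>}"
  have U': "W.complete_system L U" using U by (simp add: L_def)
  have fG: "finite ?G" using finite_eis_polys[OF n_pos U] .
  have "?S = {u\<in>S. u \<noteq> 0 \<and> v u = 1}" using V.complete_systemD(1)[OF S(1)] by (auto simp: unif_def)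
  then have cS: "card ?S = q ^ (s - 1) - q ^ (s - 2)"
    using VR.complete_system_unif_card[OF S(1) s(2)] by (simp add: card_residues_ext q_def)
  have "(\<Sum>g\<in>?G. card {\<beta>\<in>E. evl g \<beta> = 0}) = (\<Sum>g\<in>?G. card {\<alpha> \<in> ?S. val_ge v (int (d + s)) (evl g \<alpha>)})"
    using card_roots_eq[OF _ d(1) s S(1)] by (intro sum.cong) (auto simp: eis_polys_def)
  also have "\<dots> = (\<Sum>\<alpha>\<in>?S. card {g \<in> ?G. val_ge v (int (d + s)) (evl g \<alpha>)})"
    using S fG by (intro sum_card_swap) auto
  also have "\<dots> = (\<Sum>\<alpha>\<in>?S. q ^ (n * L - (d + s)))"
    using card_eis_polys_near[OF _ U' k] by (intro sum.cong) (auto simp: q_def)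
  also have "\<dots> = (q ^ (s - 1) - q ^ (s - 2)) * q ^ (n * L - (d + s))" by (simp add: cS)
  finally have sum: "(\<Sum>g\<in>?G. card {\<beta>\<in>E. evl g \<beta> = 0}) = (q ^ (s - 1) - q ^ (s - 2)) * q ^ (n * L - (d + s))" .
  have diff: "q ^ (m - 1) - q ^ (m - 2) = (q - 1) * q ^ (m - 2)" if "m \<ge> 2" for m
  proof -
    have "m - 1 = Suc (m - 2)" using that by simp
    then show ?thesis by (simp add: diff_mult_distrib)
  qed
  \<comment> \<open>Multiplied by q^d and q^(n-1) respectively, the number of pairs, divided by
    nothing else, and the number of polynomials become the same (q - 1) q^(nL-2); the auxiliary
    \<open>s\<close> cancels.\<close>
  have "(\<Sum>g\<in>?G. card {\<beta>\<in>E. evl g \<beta> = 0}) * q ^ d = (q - 1) * q ^ (s - 2 + (n * L - (d + s)) + d)"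
    unfolding sum diff[OF s(2)] by (simp add: power_add)
  also have "s - 2 + (n * L - (d + s)) + d = n * L - 2" using k s by simp
  finally have A: "(\<Sum>g\<in>?G. card {\<beta>\<in>E. evl g \<beta> = 0}) * q ^ d = (q - 1) * q ^ (n * L - 2)" .
  have "card ?G * q ^ (n - 1) = (q - 1) * q ^ (L - 2 + (L - 1) * (n - 1) + (n - 1))"
    unfolding card_eis_polys[OF n_pos U' L2] q_def[symmetric] diff[OF L2]
    by (simp add: power_add power_mult)
  also have "L - 2 + (L - 1) * (n - 1) + (n - 1) = n * L - 2"
  proof -
    define a b where "a = L - 2" and "b = n - 1"
    have "L = a + 2" "n = Suc b" using L2 n_pos by (auto simp: a_def b_def)
    then show ?thesis by (simp add: algebra_simps)
  qed
  finally have B: "card ?G * q ^ (n - 1) = (q - 1) * q ^ (n * L - 2)" .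
  have "real (\<Sum>g\<in>?G. card {\<beta>\<in>E. evl g \<beta> = 0}) * real q ^ d = real (card ?G) * real q ^ (n - 1)"
    using arg_cong[OF trans[OF A B[symmetric]], of real] by (simp only: of_nat_mult of_nat_power)
  then have "real (\<Sum>g\<in>?G. card {\<beta>\<in>E. evl g \<beta> = 0}) = real (card ?G) * (real q ^ (n - 1) / real q ^ d)"
    using q by (simp add: field_simps)
  moreover have "real q powi (- disc_excess \<iota> w E) = real q ^ (n - 1) / real q ^ d"
  proof -
    have "- disc_excess \<iota> w E = int (n - 1) - int d"
      using d(1) n_pos by (simp add: disc_excess_def disc_val_def deg of_nat_diff)
    then show ?thesis using q by (simp add: power_int_diff power_int_of_nat)
  qed
  ultimately show ?thesis unfolding q_def[symmetric] by simp
qed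

end

section \<open>The mass formula\<close>

text \<open>\<open>different_bounded w n D g\<close> says that \<open>g'(\<alpha>)\<close> has valuation at most \<open>D\<close> for a root \<open>\<alpha>\<close>
  of the Eisenstein polynomial \<open>g\<close>, in terms of the coefficients of \<open>g\<close>.\<close>

definition different_bounded :: "('k::field \<Rightarrow> int) \<Rightarrow> nat \<Rightarrow> nat \<Rightarrow> 'k poly \<Rightarrow> bool" where
  "different_bounded w n D g \<longleftrightarrow> (\<exists>i<n. of_nat (Suc i) * coeff g (Suc i) \<noteq> 0 \<and>
     int n * w (of_nat (Suc i) * coeff g (Suc i)) + int i \<le> int D)"

context mass_ext
begin

text \<open>The root is a uniformizer, so its powers span \<open>E\<close>; hence it lies in only
  one totally ramified extension of degree \<open>n\<close>.\<close>

lemma root_generates: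
  assumes g: "eisenstein w n g" and b: "\<beta> \<in> E" "evl g \<beta> = 0"
  shows "E = adjoin \<iota> \<beta>"
proof -
  interpret A: uniformized_ext w \<iota> E v n \<beta>
    by unfold_locales (rule eisenstein_root_unif[OF g b])
  show ?thesis
  proof
    show "adjoin \<iota> \<beta> \<subseteq> E" using evl_mem[OF b(1)] by (auto simp: adjoin_def)
    show "E \<subseteq> adjoin \<iota> \<beta>"
    proof
      fix x assume "x \<in> E"
      then have "x = (\<Sum>i<n. \<iota> (A.crd x i) * \<beta> ^ i)" using A.crd_sum by simp
      also have "\<dots> = evl (\<Sum>i<n. monom (A.crd x i) i) \<beta>"
      proof -
        interpret mp: map_poly_comm_ring_hom \<iota> ..
        show ?thesis by (simp add: hom_distribs poly_sum poly_monom)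
      qed
      finally show "x \<in> adjoin \<iota> \<beta>" by (auto simp: adjoin_def)
    qed
  qed
qed

text \<open>The valuation of g'(\<beta>) is visible in the coefficients of g' by
  \<open>vge_lincomb\<close>, so a condition on \<open>E\<close> becomes one on \<open>g\<close>
  alone.\<close>

lemma different_bounded_iff:
  assumes g: "eisenstein w n g" and b: "\<beta> \<in> E" "evl g \<beta> = 0"
  shows "different_bounded w n D g \<longleftrightarrow> disc_val \<le> int D"
proof -
  have u: "unif \<beta>" using eisenstein_root_unif[OF g b] .
  then interpret A: uniformized_ext w \<iota> E v n \<beta> by unfold_locales
  note V = different_val[OF u g b(2)]
  let ?c = "\<lambda>i. of_nat (Suc i) * coeff g (Suc i)"
  have "disc_val \<le> int D \<longleftrightarrow> \<not> val_ge v (int D + 1) (evl (pderiv g) \<beta>)"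
    using V by (auto simp: val_ge_def)
  also have "\<dots> \<longleftrightarrow> \<not> val_ge v (int D + 1) (\<Sum>i<n. \<iota> (?c i) * \<beta> ^ i)"
    using evl_pderiv[OF eisensteinD(1)[OF g] n_pos] by simp
  also have "\<dots> \<longleftrightarrow> different_bounded w n D g"
    unfolding A.vge_lincomb different_bounded_def by force
  finally show ?thesis by simp
qed

end

text \<open>\<open>n \<ge> 2\<close> makes the coefficient of X one of the freely varying
  coefficients, on which the lower bound rests.\<close>

locale mass_formula = local_field_residues w R + separable_closure \<iota>
  for w :: "'k::field \<Rightarrow> int" and R and \<iota> :: "'k \<Rightarrow> 'a::field" +
  fixes n :: nat
  assumes n_ge_2: "n \<ge> 2"
begin

lemma n_pos: "n > 0"
  using n_ge_2 by simp

definition ram :: "'a set set" where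
  "ram = {E. totally_ramified \<iota> w E \<and> ext_degree \<iota> E = n}"

definition disc :: "'a set \<Rightarrow> int" where
  "disc E = ideal_val w (discriminant_ideal \<iota> w E)"

definition ram_le :: "nat \<Rightarrow> 'a set set" where "ram_le D = {E \<in> ram. disc E \<le> int D}"

lemma ram_mass_ext:
  assumes "E \<in> ram"
  obtains v where "mass_ext w \<iota> E v n R"
proof -
  have E: "intermediate_field \<iota> E" "ext_degree \<iota> E = n"
    using assms by (auto simp: ram_def totally_ramified_def)
  obtain v where v: "normalised_valuation_on E v" "\<forall>x. x \<noteq> 0 \<longrightarrow> v (\<iota> x) = int n * w x"
    using assms by (auto simp: ram_def totally_ramified_def has_ramification_index_def)
  have "mass_ext w \<iota> E v n R"
    by unfold_locales (use E v n_pos in auto)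
  then show ?thesis by (rule that)
qed

lemma adjoin_ram:
  assumes "eisenstein w n g" "evl g \<beta> = 0"
  shows "adjoin \<iota> \<beta> \<in> ram" "\<beta> \<in> adjoin \<iota> \<beta>"
proof -
  interpret A: eisenstein_root w n g \<iota> \<beta> by unfold_locales (use assms n_pos in auto)
  show "adjoin \<iota> \<beta> \<in> ram" "\<beta> \<in> adjoin \<iota> \<beta>"
    using A.totally_ramified_adjoin A.ext_degree_adjoin A.root_adjoin by (auto simp: ram_def)
qed

lemma root_in_ram:
  assumes "E \<in> ram" "eisenstein w n g" "\<beta> \<in> E" "evl g \<beta> = 0"
  shows "E = adjoin \<iota> \<beta>" "different_bounded w n D g \<longleftrightarrow> disc E \<le> int D"
proof -
  obtain v where "mass_ext w \<iota> E v n R" using ram_mass_ext[OF assms(1)] .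
  then interpret A: mass_ext w \<iota> E v n R .
  show "E = adjoin \<iota> \<beta>" using A.root_generates assms by blast
  show "different_bounded w n D g \<longleftrightarrow> disc E \<le> int D"
    using A.different_bounded_iff[OF assms(2-4)] by (simp add: disc_def A.disc_val_def)
qed

lemma finite_roots: "eisenstein w n g \<Longrightarrow> finite {\<beta>. evl g \<beta> = 0}"
proof (rule poly_roots_finite)
  assume "eisenstein w n g"
  then have "coeff (map_poly \<iota> g) n = 1" using eisensteinD(3)[of w n g] by simp
  then show "map_poly \<iota> g \<noteq> 0" by force
qed

text \<open>The bound implies g' \<noteq> 0, so the irreducible \<open>g\<close> is coprime to g',
  and the Bezout relation persists over the closure.\<close>

lemma card_all_roots:
  assumes g: "eisenstein w n g" and bd: "different_bounded w n D g"
  shows "card {\<beta>. evl g \<beta> = 0} = n"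
proof -
  interpret mp: map_poly_comm_ring_hom \<iota> ..
  interpret G: eisenstein_poly w n g by unfold_locales (use g n_pos in auto)
  obtain i where "coeff (pderiv g) i \<noteq> 0"
    using bd unfolding different_bounded_def coeff_pderiv by blast
  then have "pderiv g \<noteq> 0" by force
  moreover have "degree (pderiv g) < degree g" using degree_pderiv_le[of g] eisensteinD(1)[OF g] n_pos by simp
  ultimately have "\<not> g dvd pderiv g" by (meson dvd_imp_degree_le not_le)
  then obtain a b where "a * g + b * pderiv g = 1"
    using irreducible_poly_bezout[OF G.irreducible_g] by blast
  then have "map_poly \<iota> (a * g + b * pderiv g) = map_poly \<iota> 1" by simp
  then have *: "map_poly \<iota> a * map_poly \<iota> g + map_poly \<iota> b * pderiv (map_poly \<iota> g) = 1"
    by (simp add: hom_distribs)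
  have "separable_poly (map_poly \<iota> g)"
    unfolding separable_poly_def
  proof (rule coprimeI)
    fix c assume "c dvd map_poly \<iota> g" "c dvd pderiv (map_poly \<iota> g)"
    then have "c dvd map_poly \<iota> a * map_poly \<iota> g + map_poly \<iota> b * pderiv (map_poly \<iota> g)" by simp
    then show "is_unit c" unfolding * .
  qed
  then show ?thesis using card_roots_separable[of "map_poly \<iota> g"] eisensteinD(1)[OF g] by simp
qed

text \<open>A root \<beta> lies in K(\<beta>) and in no other member of \<open>ram\<close>, and
  whether K(\<beta>) belongs to \<open>ram_le D\<close> depends on \<open>g\<close> only. So the
  roots of \<open>g\<close> are counted all or none.\<close>

lemma sum_roots_ram_le:
  assumes g: "eisenstein w n g" and fin: "finite (ram_le D)"
  shows "(\<Sum>E\<in>ram_le D. card {\<beta>\<in>E. evl g \<beta> = 0}) = (if different_bounded w n D g then n else 0)"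
proof -
  let ?r = "\<lambda>E. {\<beta>\<in>E. evl g \<beta> = 0}"
  have "(\<Sum>E\<in>ram_le D. card (?r E)) = card (\<Union>E\<in>ram_le D. ?r E)"
  proof (rule card_UN_disjoint[symmetric, OF fin])
    show "\<forall>E\<in>ram_le D. finite (?r E)"
      using finite_subset[OF _ finite_roots[OF g]] by (metis (mono_tags, lifting) Collect_mono)
    show "\<forall>E\<in>ram_le D. \<forall>E'\<in>ram_le D. E \<noteq> E' \<longrightarrow> ?r E \<inter> ?r E' = {}"
    proof (intro ballI impI)
      fix E E' assume E: "E \<in> ram_le D" "E' \<in> ram_le D" "E \<noteq> E'"
      have "E = adjoin \<iota> \<beta> \<and> E' = adjoin \<iota> \<beta>" if "\<beta> \<in> E" "\<beta> \<in> E'" "evl g \<beta> = 0" for \<beta>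
        using root_in_ram(1)[OF _ g] E that by (auto simp: ram_le_def)
      then show "?r E \<inter> ?r E' = {}" using E(3) by blast
    qed
  qed
  also have "(\<Union>E\<in>ram_le D. ?r E) = (if different_bounded w n D g then {\<beta>. evl g \<beta> = 0} else {})"
  proof (cases "different_bounded w n D g")
    case True
    have "\<beta> \<in> (\<Union>E\<in>ram_le D. ?r E)" if b: "evl g \<beta> = 0" for \<beta>
      using adjoin_ram[OF g b] root_in_ram(2)[OF _ g _ b, of "adjoin \<iota> \<beta>" D] True b
      by (auto simp: ram_le_def)
    then show ?thesis using True by auto
  next
    case False
    have "\<beta> \<notin> (\<Union>E\<in>ram_le D. ?r E)" for \<beta>
      using root_in_ram(2)[OF _ g, of _ \<beta> D] False by (auto simp: ram_le_def)
    then show ?thesis using False by auto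
  qed
  finally show ?thesis using card_all_roots[OF g] by auto
qed

definition weight :: "'a set \<Rightarrow> real" where
  "weight E = real (card R) powi (- disc_excess \<iota> w E)"

lemma card_R_pos: "real (card R) > 0"
  using WR.card_residues_ge_2 by simp

lemma weight_pos: "weight E > 0"
  unfolding weight_def using card_R_pos by (rule zero_less_power_int)

text \<open>A single precision serves all \<open>E\<close> in \<open>ram_le D\<close>, so the sums
  over fields and polynomials can be exchanged. Finiteness comes first: by \<open>weight_pos\<close>
  each such \<open>E\<close> contains a root of some representative and is generated by it.\<close>

lemma mass_ram_le:
  assumes U: "W.complete_system (2 * D + n + 2) U"
  shows "finite (ram_le D)"
    and "real (card (eis_polys w n U)) * (\<Sum>E\<in>ram_le D. weight E) =
      real n * real (card {g \<in> eis_polys w n U. different_bounded w n D g})"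
    and "card (eis_polys w n U) > 0"
proof -
  let ?G = "eis_polys w n U"
  have fG: "finite ?G" using finite_eis_polys[OF n_pos U] .
  have q: "card R \<ge> 2" by (rule WR.card_residues_ge_2)
  have "card R ^ (2 * D + n + 2 - 2) < card R ^ (2 * D + n + 2 - 1)"
    using q by (intro power_strict_increasing) auto
  then show cG: "card ?G > 0"
    unfolding card_eis_polys[OF n_pos U, simplified] using q by simp
  have S: "(\<Sum>g\<in>?G. real (card {\<beta>\<in>E. evl g \<beta> = 0})) = real (card ?G) * weight E"
    if "E \<in> ram_le D" for E
  proof -
    have "E \<in> ram" using that by (simp add: ram_le_def)
    then obtain v where "mass_ext w \<iota> E v n R" by (rule ram_mass_ext)
    then interpret A: mass_ext w \<iota> E v n R .
    show ?thesis unfolding weight_def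
      by (rule A.sum_card_roots[OF U]) (use that in \<open>simp add: ram_le_def disc_def A.disc_val_def\<close>)
  qed
  have "ram_le D \<subseteq> adjoin \<iota> ` (\<Union>g\<in>?G. {\<beta>. evl g \<beta> = 0})"
  proof
    fix E assume E: "E \<in> ram_le D"
    have "(\<Sum>g\<in>?G. real (card {\<beta>\<in>E. evl g \<beta> = 0})) \<noteq> 0"
      unfolding S[OF E] using cG weight_pos[of E] by simp
    then obtain g where g: "g \<in> ?G" "card {\<beta>\<in>E. evl g \<beta> = 0} \<noteq> 0"
      by (metis (mono_tags, lifting) of_nat_0 sum.neutral)
    then obtain \<beta> where b: "\<beta> \<in> E" "evl g \<beta> = 0" by (metis (mono_tags, lifting) card.empty empty_Collect_eq)
    have "E = adjoin \<iota> \<beta>"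
      using root_in_ram(1)[OF _ _ b] E g(1) by (auto simp: ram_le_def eis_polys_def)
    then show "E \<in> adjoin \<iota> ` (\<Union>g\<in>?G. {\<beta>. evl g \<beta> = 0})" using g(1) b(2) by blast
  qed
  moreover have "finite (\<Union>g\<in>?G. {\<beta>. evl g \<beta> = 0})"
    using fG finite_roots by (intro finite_UN_I) (auto simp: eis_polys_def)
  ultimately show fin: "finite (ram_le D)" using finite_surj by blast
  have "real (card ?G) * (\<Sum>E\<in>ram_le D. weight E) =
      (\<Sum>E\<in>ram_le D. \<Sum>g\<in>?G. real (card {\<beta>\<in>E. evl g \<beta> = 0}))"
    unfolding sum_distrib_left using S by (intro sum.cong) auto
  also have "\<dots> = (\<Sum>g\<in>?G. \<Sum>E\<in>ram_le D. real (card {\<beta>\<in>E. evl g \<beta> = 0}))" by (rule sum.swap)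
  also have "\<dots> = (\<Sum>g\<in>?G. if different_bounded w n D g then real n else 0)"
  proof (rule sum.cong)
    fix g assume "g \<in> ?G"
    then have "eisenstein w n g" by (simp add: eis_polys_def)
    from arg_cong[OF sum_roots_ram_le[OF this fin], of real]
    show "(\<Sum>E\<in>ram_le D. real (card {\<beta>\<in>E. evl g \<beta> = 0})) = (if different_bounded w n D g then real n else 0)"
      by (simp split: if_splits)
  qed simp
  also have "\<dots> = real n * real (card {g \<in> ?G. different_bounded w n D g})"
    using sum.inter_filter[OF fG, of "\<lambda>_. real n" "different_bounded w n D"]
    by (simp add: mult.commute)
  finally show "real (card ?G) * (\<Sum>E\<in>ram_le D. weight E) =
      real n * real (card {g \<in> ?G. different_bounded w n D g})" .
qed

lemma mass_ram_le_upper: "(\<Sum>E\<in>ram_le D. weight E) \<le> real n"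
proof -
  obtain U where U: "W.complete_system (2 * D + n + 2) U" using WR.complete_system_ex by blast
  note M = mass_ram_le[OF U]
  have "card {g \<in> eis_polys w n U. different_bounded w n D g} \<le> card (eis_polys w n U)"
    using finite_eis_polys[OF n_pos U] by (intro card_mono) auto
  then have "real (card (eis_polys w n U)) * (\<Sum>E\<in>ram_le D. weight E) \<le> real (card (eis_polys w n U)) * real n"
    unfolding M(2) by (simp add: mult_left_mono mult.commute)
  then show ?thesis using M(3) by simp
qed

text \<open>The coefficient of \<open>X\<close> alone already bounds the different.\<close>

lemma mass_ram_le_lower: "(\<Sum>E\<in>ram_le (n * M). weight E) \<ge> real n * (1 - 1 / real (card R) ^ M)"
proof -
  let ?D = "n * M"
  obtain U where U: "W.complete_system (2 * ?D + n + 2) U" using WR.complete_system_ex by blast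
  let ?G = "eis_polys w n U" and ?q = "real (card R)"
  note M = mass_ram_le[OF U]
  have fG: "finite ?G" using finite_eis_polys[OF n_pos U] .
  let ?B = "{g \<in> ?G. different_bounded w n ?D g}"
  let ?T = "{g \<in> ?G. val_ge w (int (Suc M)) (coeff g 1)}"
  have "1 * M \<le> n * M" using n_pos by (intro mult_right_mono) auto
  then have "M \<le> n * M" by (simp only: mult_1)
  then have L: "Suc M \<le> 2 * ?D + n + 2" by linarith
  \<comment> \<open>The index 0 in \<open>different_bounded\<close> belongs to the coefficient of X:
    if that has valuation at most \<open>M\<close>, its term has valuation at most n M, the bound
    chosen here.\<close>
  have "?G - ?B \<subseteq> ?T"
  proof
    fix g assume g: "g \<in> ?G - ?B"
    then have "coeff g 1 = 0 \<or> \<not> int n * w (coeff g 1) \<le> int n * int M"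
      using n_pos unfolding different_bounded_def by force
    then have "val_ge w (int (Suc M)) (coeff g 1)" using n_pos by (auto simp: val_ge_def)
    then show "g \<in> ?T" using g by simp
  qed
  then have "card (?G - ?B) \<le> card ?T" using fG by (intro card_mono) auto
  then have "card ?G - card ?B \<le> card ?T" using fG by (simp add: card_Diff_subset)
  then have "real (card ?G) - real (card ?B) \<le> real (card ?T)" by linarith
  moreover have "real (card ?T) * ?q ^ M = real (card ?G)"
    using arg_cong[OF card_eis_polys_tail[OF n_ge_2 U L], of real] by simp
  then have "real (card ?T) = real (card ?G) / ?q ^ M"
    using card_R_pos by (simp add: field_simps)
  ultimately have "real (card ?G) * (1 - 1 / ?q ^ M) \<le> real (card ?B)" by (simp add: algebra_simps)
  then have "real n * (real (card ?G) * (1 - 1 / ?q ^ M)) \<le> real n * real (card ?B)"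
    by (rule mult_left_mono) simp
  then have "real (card ?G) * (real n * (1 - 1 / ?q ^ M)) \<le> real (card ?G) * (\<Sum>E\<in>ram_le ?D. weight E)"
    unfolding M(2) by (simp only: mult.left_commute)
  then show ?thesis using M(3) by simp
qed

text \<open>By positivity the sum over a finite set lying between some \<open>ram_le (n * M)\<close>
  and some \<open>ram_le D\<close> is squeezed between the lower and the upper bound.\<close>

lemma has_sum_weight: "(weight has_sum real n) ram"
  unfolding has_sum_def
proof (rule tendstoI)
  fix \<epsilon> :: real assume e: "\<epsilon> > 0"
  let ?q = "real (card R)"
  have q: "?q \<ge> 2" using WR.card_residues_ge_2 by simp
  obtain M where M: "(1 / ?q) ^ M < \<epsilon> / real n"
    using real_arch_pow_inv[of "\<epsilon> / real n" "1 / ?q"] e n_pos q by auto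
  have lower: "real n - \<epsilon> < (\<Sum>E\<in>ram_le (n * M). weight E)"
  proof -
    have "real n * (1 / ?q ^ M) < \<epsilon>" using M n_pos by (simp add: power_one_over field_simps)
    then show ?thesis using mass_ram_le_lower[of M] by (simp add: algebra_simps)
  qed
  have fin: "finite (ram_le D)" for D using mass_ram_le(1) WR.complete_system_ex by blast
  show "\<forall>\<^sub>F Y in finite_subsets_at_top ram. dist (sum weight Y) (real n) < \<epsilon>"
    unfolding eventually_finite_subsets_at_top
  proof (intro exI[of _ "ram_le (n * M)"] conjI allI impI)
    show "finite (ram_le (n * M))" by (rule fin)
    show "ram_le (n * M) \<subseteq> ram" by (auto simp: ram_le_def)
    fix Y assume Y: "finite Y \<and> ram_le (n * M) \<subseteq> Y \<and> Y \<subseteq> ram"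
    have "sum weight (ram_le (n * M)) \<le> sum weight Y"
      using Y weight_pos by (intro sum_mono2) (auto intro: less_imp_le)
    moreover have "sum weight Y \<le> real n"
    proof -
      \<comment> \<open>The sum of the discriminant exponents over the finite set \<open>Y\<close>
        serves as a common bound for them.\<close>
      define D where "D = (\<Sum>E\<in>Y. nat (disc E))"
      have "nat (disc E) \<le> D" if "E \<in> Y" for E
        unfolding D_def using Y that by (intro member_le_sum) auto
      then have "Y \<subseteq> ram_le D" using Y by (force simp: ram_le_def)
      then have "sum weight Y \<le> sum weight (ram_le D)"
        using fin weight_pos by (intro sum_mono2) (auto intro: less_imp_le)
      then show ?thesis using mass_ram_le_upper[of D] by simp
    qed
    ultimately show "dist (sum weight Y) (real n) < \<epsilon>" using lower by (simp add: dist_real_def)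
  qed
qed

end

theorem proposition5p2p4:
  fixes w :: "'k::field \<Rightarrow> int"
    and \<iota> :: "'k \<Rightarrow> 'a::field"
    and p q e n :: nat
  assumes "local_field w"
    and "separable_closure \<iota>"
    and "p = residue_char w"
    and "q = card (residue_field w)"
    and "e > 0" and "\<not> [e = 0] (mod p)"
    and "n = e * p"
  shows "((\<lambda>E. real q powi (- disc_excess \<iota> w E)) has_sum real n)
           {E. totally_ramified \<iota> w E \<and> ext_degree \<iota> E = n}"
proof -
  interpret local_field w by fact
  interpret S: separable_closure \<iota> by fact
  obtain R where R: "finite_valued_field UNIV w R" "card R = card (residue_field w)"
    by (rule residue_system)
  interpret R: finite_valued_field UNIV w R by fact
  have "1 * 2 \<le> e * p" using assms(3,5) residue_char_ge_2 by (intro mult_mono) auto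
  then interpret M: mass_formula w R \<iota> n
    by unfold_locales (use R.residues R.finite_residues assms(7) in auto)
  show ?thesis
    using M.has_sum_weight unfolding M.ram_def M.weight_def[abs_def] assms(4) R(2)[symmetric] .
qed

end
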